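(* For $\kappa>0$ define the stopping time $$S_\kappa=\inf\{t\ge0:\|\hat{\mathbb{X}}\|_{p\text{-var};[0,t]}\ge\kappa\}\wedge T.$$ Assume $Z\sim\mathrm{Exp}(1)$ and $\mathbb{E}[\|Y\|_\infty]<\infty$, where $\|Y\|_\infty=\sup_{t\in[0,T]}|Y_t|$. Then $$\sup_{l\in T((\mathbb{R}^{1+d})^* )}\mathbb{E}[Y_{\tau^r_l\wedge T}]=\lim_{\kappa\to\infty}\lim_{K\to\infty}\lim_{N\to\infty}\ \sup_{|l|+\deg(l)\le K}\mathbb{E}\left[\int_0^{S_\kappa}\big\langle\exp^{\sqcup\!\sqcup}(-(l\sqcup\!\sqcup l)1),\hat{\mathbb{X}}^{\le N}_{0,t}\big\rangle\,dY_t\right]+\mathbb{E}[Y_0],$$ where the supremum on the right is over $l\in T((\mathbb{R}^{1+d})^* )$ with $|l|+\deg(l)\le K$, and the first two limits ($\kappa\to\infty$ and $K\to\infty$) may be interchanged.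
   Context: Fix $p\ge 1$, $T>0$, $d\ge 1$, and let $V=\mathbb{R}^{1+d}$ with standard basis $e_1,\dots,e_{1+d}$. Tensor algebra: $T((V))=\prod_{n\ge0}V^{\otimes n}$, $T^N(V)=\bigoplus_{n=0}^N V^{\otimes n}$, $T(V^* )=\bigoplus_{n\ge0}(V^* )^{\otimes n}$ (finite sums), $T((V^* ))=\prod_{n\ge0}(V^* )^{\otimes n}$, with $V^{\otimes 0}=\mathbb{R}$, product $\otimes$, unit $\mathbf{1}=(1,0,0,\dots)$, projections $\pi_n:T((V))\to V^{\otimes n}$ and $\pi_{\le N}:T((V))\to T^N(V)$, and natural pairing $\langle\cdot,\cdot\rangle$ between $T(V^* )$ and $T((V))$, and likewise between $T((V^* ))$ and $T^N(V)$. $T(V^* )$ is identified with the linear span of words in the letters $1,\dots,1+d$ via $e_{i_1}^*\otimes\cdots\otimes e_{i_n}^*\leftrightarrow i_1\cdots i_n$; juxtaposition denotes concatenation, so $l1$ is $l$ concatenated on the right with the letter $1$ (the time component). $\deg(l)$ is the maximal length of a word occurring in $l$ with nonzero coefficient ($\deg(0)=0$), and $|l|$ is the sum of absolute values of the coefficients of $l$. The shuffle product is the bilinear product with $w\sqcup\!\sqcup\varnothing=\varnothing\sqcup\!\sqcup w=w$ and $wi\sqcup\!\sqcup vj=(w\sqcup\!\sqcup vj)i+(wi\sqcup\!\sqcup v)j$. For $l=a_0\varnothing+\tilde l$ with $\tilde l$ having no $\varnothing$-component, $\exp^{\sqcup\!\sqcup}(l)=\exp(a_0)\sum_{r\ge0}\frac1{r!}\tilde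 l^{\sqcup\!\sqcup r}\in T((V^* ))$. $G(V)$ is the group (under $\otimes$) of all $\mathbf{a}\in T((V))\setminus\{\mathbf 0\}$ with $\langle l_1\sqcup\!\sqcup l_2,\mathbf{a}\rangle=\langle l_1,\mathbf{a}\rangle\langle l_2,\mathbf{a}\rangle$ for all $l_1,l_2\in T(V^* )$, and $G^N(V)=\pi_{\le N}(G(V))$ (a group under truncated multiplication). Rough paths: on $V^{\otimes n}$ use the maximum norm of coordinates. For a path $\mathbb{X}$ in $G^{N}(V)$ put $\mathbb{X}_{s,t}=\mathbb{X}_s^{-1}\otimes\mathbb{X}_t$. For two-parameter functions with values in $T^N(V)$, $\|\mathbb{X}\|_{p\text{-var};[s,t]}=\max_{1\le k\le N}\sup_{\mathcal{D}}\big(\sum_{t_i\in\mathcal{D}}|\pi_k(\mathbb{X}_{t_i,t_{i+1}})|^{p/k}\big)^{k/p}$ (supremum over partitions $\mathcal{D}$ of $[s,t]$) and $d_{p\text{-var};[s,t]}(\mathbb{X},\mathbb{Y})=\|\mathbb{X}-\mathbb{Y}\|_{p\text{-var};[s,t]}$. For a continuous bounded variation path $Z:[0,T]\to V$, its signature is $\pi_k(\mathbb{Z}^{<\infty}_t)=\int_{0<t_1<\dots<t_k<t}dZ_{t_1}\otimes\cdots\otimes dZ_{t_k}$, and $\mathbb{Z}^{\le N}=\pi_{\le N}(\mathbb{Z}^{<\infty})$. $\hat\Omega^p_T$ is the closure with respect to $d_{p\text{-var};[0,T]}$ (among continuous paths $[0,T]\to G^{\lfloor p\rfloor}(V)$ started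 at $\mathbf 1$ with finite $p$-variation) of the set of lifts $\hat{\mathbb{X}}^{\le\lfloor p\rfloor}$ of paths $\hat X_t=(t,X_t)\in\mathbb{R}^{1+d}$ with $X:[0,T]\to\mathbb{R}^d$ piecewise smooth. By Lyons' extension theorem each $\hat{\mathbb{X}}\in\hat\Omega^p_T$ has a unique lift to a path $\hat{\mathbb{X}}^{<\infty}$ in $G(V)$ with $\pi_{\le\lfloor p\rfloor}(\hat{\mathbb{X}}^{<\infty})=\hat{\mathbb{X}}$ and $\pi_{\le N}(\hat{\mathbb{X}}^{<\infty})$ of finite $p$-variation for all $N$ (the signature); $\hat{\mathbb{X}}^{<\infty}_{0,t}=\hat{\mathbb{X}}^{<\infty}_t$ and $\hat{\mathbb{X}}^{\le N}_{0,t}=\pi_{\le N}(\hat{\mathbb{X}}^{<\infty}_{0,t})$. Stochastic setting: $(\Omega,\mathcal{F},\mathbb{P})$ is a probability space, $\hat{\mathbb{X}}$ is a stochastic process with sample paths in $\hat\Omega^p_T$ (a random element of $\hat\Omega^p_T$), $\mathcal{F}_t=\sigma(\hat{\mathbb{X}}_{0,s}:0\le s\le t)$, $Y:[0,T]\times\Omega\to\mathbb{R}$ is a continuous $(\mathcal{F}_t)$-adapted process, and $Z$ is a random variable independent of $\hat{\mathbb{X}}$. For $l\in T((\mathbb{R}^{1+d})^* )$, $\tau^r_l=\inf\{t\ge0:\int_0^{t\wedge T}\langle l,\hat{\mathbb{X}}^{<\infty}_{0,s}\rangle^2ds\ge Z\}$, $\inf\emptyset=+\infty$. The function $t\mapsto\langle\exp^{\sqcup\!\sqcup}(-(l\sqcup\!\sqcup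 l)1),\hat{\mathbb{X}}^{\le N}_{0,t}\rangle$ is continuously differentiable, and the integral against $dY_t$ is defined pathwise by integration by parts: $\int_0^S f\,dY=f(S)Y_S-f(0)Y_0-\int_0^S Y_tf'(t)\,dt$. *)

theory Defs
  imports "HOL-Probability.Probability"
begin

section \<open>Tensor algebra and shuffle product\<close>

text \<open>
  With respect to the word basis, an element of \<open>T((V))\<close> or of \<open>T((V\<^sup>*))\<close>, where \<open>V = \<real>\<^sup>'a\<close>, is an
  arbitrary real function on words over the alphabet \<open>'a\<close>; its component in \<open>V\<^sup>\<otimes>\<^sup>n\<close> is its
  restriction to words of length \<open>n\<close>.  \<open>T\<^sup>N(V)\<close> is embedded as the functions vanishing on words
  longer than \<open>N\<close>.  For \<open>\<real>\<^sup>1\<^sup>+\<^sup>d\<close> the alphabet is \<open>'d option\<close> with \<open>d = CARD('d)\<close>; the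
  letter \<open>1\<close> (time) is \<open>None\<close>.
\<close>

type_synonym 'a tensor = "'a list \<Rightarrow> real"

definition tmult :: "'a tensor \<Rightarrow> 'a tensor \<Rightarrow> 'a tensor" where
  "tmult a b = (\<lambda>w. \<Sum>i\<le>length w. a (take i w) * b (drop i w))"

definition tone :: "'a tensor" where
  "tone = (\<lambda>w. if w = [] then 1 else 0)"

definition ttrunc :: "nat \<Rightarrow> 'a tensor \<Rightarrow> 'a tensor" where
  "ttrunc N a = (\<lambda>w. if length w \<le> N then a w else 0)"

definition tfin :: "'a tensor set" \<comment> \<open>\<open>T(V\<^sup>*)\<close>\<close> where
  "tfin = {l. finite {w. l w \<noteq> 0}}"

text \<open>The sum is finite as soon as one argument has finite support, which covers both pairings
  \<open>T(V\<^sup>*) \<times> T((V))\<close> and \<open>T((V\<^sup>*)) \<times> T\<^sup>N(V)\<close>.\<close>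

definition pairing :: "'a tensor \<Rightarrow> 'a tensor \<Rightarrow> real" where
  "pairing l a = (\<Sum>w | l w \<noteq> 0 \<and> a w \<noteq> 0. l w * a w)"

definition tdeg :: "'a tensor \<Rightarrow> nat" where
  "tdeg l = Max (insert 0 (length ` {w. l w \<noteq> 0}))"

definition tabs :: "'a tensor \<Rightarrow> real" where
  "tabs l = (\<Sum>w | l w \<noteq> 0. \<bar>l w\<bar>)"

definition snoc_letter :: "'a tensor \<Rightarrow> 'a \<Rightarrow> 'a tensor" \<comment> \<open>\<open>l \<mapsto> li\<close>\<close> where
  "snoc_letter l i = (\<lambda>w. if w \<noteq> [] \<and> last w = i then l (butlast w) else 0)"

text \<open>Shuffle of two words, as the multiset of its summands.\<close>

function shuffle_word :: "'a list \<Rightarrow> 'a list \<Rightarrow> 'a list multiset" where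
  "shuffle_word w v =
    (if v = [] then {#w#}
     else if w = [] then {#v#}
     else image_mset (\<lambda>u. u @ [last w]) (shuffle_word (butlast w) v)
        + image_mset (\<lambda>u. u @ [last v]) (shuffle_word w (butlast v)))"
  by pat_completeness auto
termination
  by (relation "Wellfounded.measure (\<lambda>(w, v). length w + length v)") auto

declare shuffle_word.simps [simp del]

lemma shuffle_word_empty:
  "shuffle_word w [] = {#w#}" "shuffle_word [] w = {#w#}"
  by (subst shuffle_word.simps; simp)+

lemma shuffle_word_snoc:
  "shuffle_word (w @ [i]) (v @ [j]) =
     image_mset (\<lambda>u. u @ [j]) (shuffle_word (w @ [i]) v)
   + image_mset (\<lambda>u. u @ [i]) (shuffle_word w (v @ [j]))"
  by (subst shuffle_word.simps) simp

text \<open>Bilinear extension.  A word of length \<open>n\<close> occurs only in shuffles of words whose lengths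
  add up to \<open>n\<close>, so that for a finite alphabet the sum is finite and makes sense on \<open>T((V\<^sup>*))\<close>.\<close>

definition shuffle_prod :: "'a tensor \<Rightarrow> 'a tensor \<Rightarrow> 'a tensor" where
  "shuffle_prod l1 l2 = (\<lambda>u. \<Sum>(w, v) | length w + length v = length u.
     l1 w * l2 v * real (count (shuffle_word w v) u))"

text \<open>Coefficientwise the series has only finitely many nonzero terms, since the \<open>r\<close>-th shuffle
  power of an element without constant term vanishes on words shorter than \<open>r\<close>.\<close>

definition shuffle_exp :: "'a tensor \<Rightarrow> 'a tensor" where
  "shuffle_exp l = (\<lambda>u. exp (l []) * (\<Sum>r. (shuffle_prod (l([] := 0)) ^^ r) tone u / fact r))"

definition grouplike :: "'a tensor set" \<comment> \<open>\<open>G(V)\<close>\<close> where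
  "grouplike = {a. a \<noteq> (\<lambda>_. 0) \<and>
     (\<forall>l1\<in>tfin. \<forall>l2\<in>tfin. pairing (shuffle_prod l1 l2) a = pairing l1 a * pairing l2 a)}"

definition grouplike_trunc :: "nat \<Rightarrow> 'a tensor set" \<comment> \<open>\<open>G\<^sup>N(V)\<close>\<close> where
  "grouplike_trunc N = ttrunc N ` grouplike"

definition ginv :: "nat \<Rightarrow> 'a tensor \<Rightarrow> 'a tensor" \<comment> \<open>inverse in the group \<open>G\<^sup>N(V)\<close>\<close> where
  "ginv N a = (THE b. b \<in> grouplike_trunc N \<and>
     ttrunc N (tmult a b) = tone \<and> ttrunc N (tmult b a) = tone)"


section \<open>Rough paths\<close>

definition path_incr :: "nat \<Rightarrow> (real \<Rightarrow> 'a tensor) \<Rightarrow> real \<Rightarrow> real \<Rightarrow> 'a tensor" where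
  "path_incr N X s t = ttrunc N (tmult (ginv N (X s)) (X t))"

definition level_norm :: "nat \<Rightarrow> 'a tensor \<Rightarrow> real" where
  "level_norm k a = Max ((\<lambda>w. \<bar>a w\<bar>) ` {w. length w = k})"

definition partitions :: "real \<Rightarrow> real \<Rightarrow> real list set" where
  "partitions s t = {ts. ts \<noteq> [] \<and> sorted_wrt (<) ts \<and> hd ts = s \<and> last ts = t}"

definition pvar :: "real \<Rightarrow> nat \<Rightarrow> real \<Rightarrow> real \<Rightarrow> (real \<Rightarrow> real \<Rightarrow> 'a tensor) \<Rightarrow> ennreal" where
  "pvar p N s t A = (SUP k\<in>{1..N}. SUP ts\<in>partitions s t.
     ennreal ((\<Sum>i<length ts - 1.
       level_norm k (A (ts ! i) (ts ! Suc i)) powr (p / real k)) powr (real k / p)))"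

abbreviation pvar_path :: "real \<Rightarrow> nat \<Rightarrow> real \<Rightarrow> real \<Rightarrow> (real \<Rightarrow> 'a tensor) \<Rightarrow> ennreal" where
  "pvar_path p N s t X \<equiv> pvar p N s t (path_incr N X)"

abbreviation pvar_dist ::
  "real \<Rightarrow> nat \<Rightarrow> real \<Rightarrow> real \<Rightarrow> (real \<Rightarrow> 'a tensor) \<Rightarrow> (real \<Rightarrow> 'a tensor) \<Rightarrow> ennreal" where
  "pvar_dist p N s t X Y \<equiv>
     pvar p N s t (\<lambda>u v w. path_incr N X u v w - path_incr N Y u v w)"

text \<open>Smoothness on a compact interval, with one-sided derivatives at the end points.\<close>

definition smooth_on_interval :: "real \<Rightarrow> real \<Rightarrow> (real \<Rightarrow> 'b::real_normed_vector) \<Rightarrow> bool" where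
  "smooth_on_interval a b f \<longleftrightarrow> (\<exists>D :: nat \<Rightarrow> real \<Rightarrow> 'b. (\<forall>t\<in>{a..b}. D 0 t = f t) \<and>
     (\<forall>n. \<forall>t\<in>{a..b}. (D n has_vector_derivative D (Suc n) t) (at t within {a..b})))"

text \<open>The pieces are closed intervals, so such paths are continuous.\<close>

definition piecewise_smooth :: "real \<Rightarrow> (real \<Rightarrow> 'b::real_normed_vector) \<Rightarrow> bool" where
  "piecewise_smooth T f \<longleftrightarrow>
     (\<exists>ts\<in>partitions 0 T. \<forall>i. Suc i < length ts \<longrightarrow> smooth_on_interval (ts ! i) (ts ! Suc i) f)"

definition time_aug :: "(real \<Rightarrow> real ^ 'd) \<Rightarrow> real \<Rightarrow> real ^ ('d::finite option)" where
  "time_aug X t = (\<chi> i. case i of None \<Rightarrow> t | Some j \<Rightarrow> X t $ j)"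

text \<open>Coordinate \<open>w\<close> of the signature of \<open>Z\<close>: the iterated integral over \<open>0 < t\<^sub>1 < \<dots> < t\<^sub>k < t\<close>,
  with the last letter integrated outermost.  It is used only for piecewise smooth paths, where
  \<open>dZ = Z' ds\<close>; the finitely many points at which the derivative does not exist do not affect
  the integral.\<close>

function smooth_sig :: "(real \<Rightarrow> real ^ 'a) \<Rightarrow> real \<Rightarrow> 'a list \<Rightarrow> real" where
  "smooth_sig Z t w =
    (if w = [] then 1
     else integral {0..t} (\<lambda>s. smooth_sig Z s (butlast w) * deriv (\<lambda>r. Z r $ last w) s))"
  by pat_completeness auto
termination
  by (relation "Wellfounded.measure (\<lambda>(Z, t, w). length w)") auto

declare smooth_sig.simps [simp del]

definition level :: "real \<Rightarrow> nat" where
  "level p = nat \<lfloor>p\<rfloor>"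

text \<open>Continuity of tensor-valued paths refers to the product topology on functions on words,
  that is, to continuity of every coordinate.\<close>

definition rough_path_space :: "real \<Rightarrow> real \<Rightarrow> (real \<Rightarrow> 'a tensor) set" where
  "rough_path_space p T = {X. continuous_on {0..T} X \<and> (\<forall>t\<in>{0..T}. X t \<in> grouplike_trunc (level p))
     \<and> X 0 = tone \<and> pvar_path p (level p) 0 T X < \<infinity>}"

definition Omega_hat :: "real \<Rightarrow> real \<Rightarrow> (real \<Rightarrow> ('d::finite option) tensor) set" where
  "Omega_hat p T = {X \<in> rough_path_space p T. \<forall>\<epsilon>>0. \<exists>x :: real \<Rightarrow> real ^ 'd. piecewise_smooth T x \<and>
     pvar_dist p (level p) 0 T X (\<lambda>t. ttrunc (level p) (smooth_sig (time_aug x) t)) < \<epsilon>}"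

text \<open>The continuity and the starting point make the Lyons lift unique on \<open>[0,T]\<close>.  Since it
  starts at the unit, its increment over \<open>[0,t]\<close> is its value at \<open>t\<close>.\<close>

definition is_lyons_lift :: "real \<Rightarrow> real \<Rightarrow> (real \<Rightarrow> 'a tensor) \<Rightarrow> (real \<Rightarrow> 'a tensor) \<Rightarrow> bool" where
  "is_lyons_lift p T X S \<longleftrightarrow> continuous_on {0..T} S \<and> S 0 = tone \<and>
     (\<forall>t\<in>{0..T}. S t \<in> grouplike \<and> ttrunc (level p) (S t) = X t) \<and>
     (\<forall>N. pvar_path p N 0 T (\<lambda>t. ttrunc N (S t)) < \<infinity>)"

definition signature :: "real \<Rightarrow> real \<Rightarrow> (real \<Rightarrow> 'a tensor) \<Rightarrow> real \<Rightarrow> 'a tensor" where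
  "signature p T X = (SOME S. is_lyons_lift p T X S)"


section \<open>Stopping\<close>

text \<open>\<open>\<F>\<^sub>t = \<sigma>(X\<^sub>0\<^sub>,\<^sub>s : 0 \<le> s \<le> t)\<close>, where \<open>X\<^sub>0\<^sub>,\<^sub>s = X\<^sub>s\<close> as \<open>X\<^sub>0\<close> is the unit; as words are
  countable, \<open>borel\<close> on tensors is generated by the coordinates.\<close>

definition path_filtration ::
  "'w measure \<Rightarrow> ('w \<Rightarrow> real \<Rightarrow> ('a::countable) tensor) \<Rightarrow> real \<Rightarrow> 'w measure" where
  "path_filtration M X t =
     sigma (space M) {(\<lambda>\<omega>. X \<omega> s) -` B \<inter> space M | s B. 0 \<le> s \<and> s \<le> t \<and> B \<in> sets borel}"

definition tau_r :: "real \<Rightarrow> real \<Rightarrow> 'a tensor \<Rightarrow> (real \<Rightarrow> 'a tensor) \<Rightarrow> real \<Rightarrow> ereal" where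
  "tau_r p T l X z = Inf (ereal ` {t. 0 \<le> t \<and>
     integral {0..min t T} (\<lambda>s. (pairing l (signature p T X s))\<^sup>2) \<ge> z})"

definition S_kappa :: "real \<Rightarrow> real \<Rightarrow> real \<Rightarrow> (real \<Rightarrow> 'a tensor) \<Rightarrow> real" where
  "S_kappa p T \<kappa> X = real_of_ereal (min (ereal T)
     (Inf (ereal ` {t. 0 \<le> t \<and> t \<le> T \<and> pvar_path p (level p) 0 t X \<ge> ennreal \<kappa>})))"

text \<open>Integral of \<open>f\<close> against a continuous path \<open>y\<close> for continuously differentiable \<open>f\<close>, by parts;
  the values of \<open>deriv f\<close> at the two end points are irrelevant.\<close>

definition ibp_integral :: "real \<Rightarrow> (real \<Rightarrow> real) \<Rightarrow> (real \<Rightarrow> real) \<Rightarrow> real" where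
  "ibp_integral S f y = f S * y S - f 0 * y 0 - integral {0..S} (\<lambda>t. y t * deriv f t)"

definition stopping_payoff ::
  "real \<Rightarrow> real \<Rightarrow> real \<Rightarrow> nat \<Rightarrow> ('d::finite option) tensor \<Rightarrow>
   (real \<Rightarrow> ('d option) tensor) \<Rightarrow> (real \<Rightarrow> real) \<Rightarrow> real" where
  "stopping_payoff p T \<kappa> N l X y = ibp_integral (S_kappa p T \<kappa> X)
     (\<lambda>t. pairing (shuffle_exp (\<lambda>w. - snoc_letter (shuffle_prod l l) None w))
            (ttrunc N (signature p T X t))) y"

end

theory Submission
  imports Defs "HOL-Computational_Algebra.Polynomial"
begin

text \<open>
  Put \<open>\<Lambda>\<^sub>t = \<integral>\<^sub>0\<^sup>t \<langle>l, X\<^sub>s\<rangle>\<^sup>2 ds\<close>.  Integrating out the independent exponential variable turns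
  \<open>E[Y\<^sub>\<tau>]\<close> into \<open>E[Y\<^sub>0 + \<integral> exp (- \<Lambda>\<^sub>t) dY\<^sub>t]\<close>.  Stopping the integral at \<open>S\<^sub>\<kappa>\<close> costs at most
  \<open>4 E[\<parallel>Y\<parallel>; S\<^sub>\<kappa> < T]\<close>, uniformly in \<open>l\<close>, which makes the limits in \<open>\<kappa>\<close> and \<open>K\<close> interchangeable.

  For \<open>N \<rightarrow> \<infinity>\<close>, pairing is graded: the words of length \<open>n\<close> in \<open>\<langle>l, X\<^sub>t\<rangle>\<close> are the \<open>n\<close>-th coefficient of a
  polynomial, and shuffle products become products of polynomials because the signature is grouplike.
  Hence pairing the shuffle exponential with a truncated signature sums the coefficients up to degree
  \<open>N\<close> of \<open>exp (P\<^sub>t)\<close>, where \<open>P\<^sub>t\<close> takes the value \<open>- \<Lambda>\<^sub>t\<close> at \<open>1\<close>, and the error is a tail of an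
  exponential series once the coordinates of the signature are bounded up to \<open>S\<^sub>\<kappa>\<close>.

  That bound, and the existence of the signature, come from one sewing estimate for multiplicative
  functionals: levels up to \<open>p\<close> control all levels, for a single path and for the difference of two paths,
  so the signatures of smooth approximations form a uniform Cauchy sequence.
\<close>

subsection \<open>Characters of the shuffle algebra\<close>

text \<open>Truncation at level \<open>N\<close> cuts by word length, not by powers. With
  \<open>k\<close> a bound for \<open>tdeg l\<close>, the power \<open>P^r\<close> of the exponent
  has degree at most \<open>r * (2 * k + 1)\<close>, so every \<open>r <= N div (2 * k + 1)\<close>
  is seen completely, while higher powers are cut at arbitrary places. Their errors are therefore
  measured by sums of absolute values of coefficients (\<open>poly_norm\<close>) and not by values
  at \<open>1\<close>. Since the integral against \<open>Y\<close> is taken by parts, the time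
  derivative needs the same estimate as the function itself. To pass through the expectation and the
  supremum, the error must be a deterministic factor times the supremum of \<open>Y\<close>:
  stopping at \<kappa> bounds the coordinates of the signature, \<open>K\<close> bounds coefficients
  and degree of \<open>l\<close>.

  \<open>signature\<close> is chosen by \<open>SOME\<close>, so what is used of it must hold for
  every lift. That appending the time letter integrates over time is not part of the definition of a
  lift: it is inherited from the smooth approximations by the lift constructed here and carried over
  by uniqueness. Uniqueness and measurability both rest on one Riemann sum formula, which expresses
  a coordinate above level \<open>p\<close> through shorter words.\<close>

definition character :: "'a tensor \<Rightarrow> bool" where
  "character a \<longleftrightarrow> a [] = 1 \<and> (\<forall>w v. a w * a v = (\<Sum>u\<in>#shuffle_word w v. a u))"

definition antip :: "'a tensor \<Rightarrow> 'a tensor" where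
  "antip a = (\<lambda>w. (-1) ^ length w * a (rev w))"

text \<open>The increment \<open>S s\<close> inverse times \<open>S t\<close>, with the inverse
  written as the antipode. In contrast to \<open>path_incr\<close>, no truncation level and no
  definite description occur, so one function serves all levels; \<open>path_incr_ttrunc\<close> and
  \<open>path_incr_lift\<close> give the connection.\<close>

definition incr :: "(real \<Rightarrow> 'a tensor) \<Rightarrow> real \<Rightarrow> real \<Rightarrow> 'a tensor" where
  "incr S s t = tmult (antip (S s)) (S t)"

section \<open>Words over a finite alphabet and their shuffles\<close>

lemma finite_words [simp, intro]: "finite {w::'a::finite list. length w = n}"
  using finite_lists_length_eq[of "UNIV::'a set" n] by simp

lemma finite_words_le [simp, intro]: "finite {w::'a::finite list. length w \<le> n}"
  using finite_lists_length_le[of "UNIV::'a set" n] by simp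

lemma shuffle_word_length: "u \<in># shuffle_word w v \<Longrightarrow> length u = length w + length v"
proof (induction w v arbitrary: u rule: shuffle_word.induct)
  case (1 w v)
  show ?case
  proof (cases "w = [] \<or> v = []")
    case True
    then show ?thesis using "1.prems" by (auto simp: shuffle_word_empty)
  next
    case False
    then obtain w' i v' j where wv: "w = w' @ [i]" "v = v' @ [j]"
      by (metis rev_exhaust)
    from "1.prems" have "u \<in># shuffle_word (w' @ [i]) (v' @ [j])" by (simp add: wv)
    then consider x where "u = x @ [j]" "x \<in># shuffle_word w v'"
      | x where "u = x @ [i]" "x \<in># shuffle_word w' v"
      unfolding shuffle_word_snoc wv by auto
    then show ?thesis
    proof cases
      case 1
      then show ?thesis using "1.IH"(2)[of x] False wv by auto
    next
      case 2
      then show ?thesis using "1.IH"(1)[of x] False wv by auto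
    qed
  qed
qed

text \<open>The shuffle is defined by recursion on last letters. The recursion on first letters
  follows by induction, because splitting off a first letter commutes with splitting off a last one;
  one-letter words are special since both letters coincide.\<close>

lemma shuffle_word_Cons:
  "shuffle_word (i # w) (j # v) =
     image_mset ((#) i) (shuffle_word w (j # v)) + image_mset ((#) j) (shuffle_word (i # w) v)"
proof (induction "length w + length v" arbitrary: i w j v rule: less_induct)
  case less
  have cw: "w = [] \<or> (\<exists>w' i'. w = w' @ [i'])" by (metis rev_exhaust)
  have cv: "v = [] \<or> (\<exists>v' j'. v = v' @ [j'])" by (metis rev_exhaust)
  \<comment> \<open>\<open>s1\<close> to \<open>s4\<close> expand the left side of the goal by last
    letters and \<open>s5\<close> to \<open>s8\<close> the right side, according to which words
    consist of one letter only.\<close>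
  have s1: "shuffle_word [i] [j] = {#[i,j], [j,i]#}" for i j :: 'a
    using shuffle_word_snoc[of "[]" i "[]" j] by (simp add: shuffle_word_empty)
  have s2: "shuffle_word [i] (j # v' @ [j']) =
      image_mset (\<lambda>u. u @ [j']) (shuffle_word [i] (j # v')) + {# j # v' @ [j', i] #}" for i j v' j'
    using shuffle_word_snoc[of "[]" i "j # v'" j'] by (simp add: shuffle_word_empty)
  have s3: "shuffle_word (i # w' @ [i']) [j] =
      {# i # w' @ [i', j] #} + image_mset (\<lambda>u. u @ [i']) (shuffle_word (i # w') [j])" for i w' i' j
    using shuffle_word_snoc[of "i # w'" i' "[]" j] by (simp add: shuffle_word_empty)
  have s4: "shuffle_word (i # w' @ [i']) (j # v' @ [j']) =
      image_mset (\<lambda>u. u @ [j']) (shuffle_word (i # w' @ [i']) (j # v'))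
    + image_mset (\<lambda>u. u @ [i']) (shuffle_word (i # w') (j # v' @ [j']))" for i w' i' j v' j'
    using shuffle_word_snoc[of "i # w'" i' "j # v'" j'] by simp
  have s5: "shuffle_word [i] (v' @ [j']) =
      image_mset (\<lambda>u. u @ [j']) (shuffle_word [i] v') + {# v' @ [j', i] #}" for i v' j'
    using shuffle_word_snoc[of "[]" i "v'" j'] by (simp add: shuffle_word_empty)
  have s6: "shuffle_word (w' @ [i']) [j] =
      {# w' @ [i', j] #} + image_mset (\<lambda>u. u @ [i']) (shuffle_word w' [j])" for w' i' j
    using shuffle_word_snoc[of "w'" i' "[]" j] by (simp add: shuffle_word_empty)
  have s7: "shuffle_word (w' @ [i']) (j # v' @ [j']) =
      image_mset (\<lambda>u. u @ [j']) (shuffle_word (w' @ [i']) (j # v'))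
    + image_mset (\<lambda>u. u @ [i']) (shuffle_word w' (j # v' @ [j']))" for w' i' j v' j'
    using shuffle_word_snoc[of "w'" i' "j # v'" j'] by simp
  have s8: "shuffle_word (i # w' @ [i']) (v' @ [j']) =
      image_mset (\<lambda>u. u @ [j']) (shuffle_word (i # w' @ [i']) v')
    + image_mset (\<lambda>u. u @ [i']) (shuffle_word (i # w') (v' @ [j']))" for i w' i' v' j'
    using shuffle_word_snoc[of "i # w'" i' "v'" j'] by simp
  show ?case
  proof (cases "w = []")
    case True
    show ?thesis
    proof (cases "v = []")
      case True
      then show ?thesis using \<open>w = []\<close> by (simp add: s1 shuffle_word_empty add.commute)
    next
      case False
      then obtain v' j' where v: "v = v' @ [j']" using cv by auto
      show ?thesis using less[of "[]" "v'" i j] unfolding v \<open>w = []\<close>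
        by (simp add: s2 s5 shuffle_word_empty image_mset.compositionality o_def ac_simps)
    qed
  next
    case False
    then obtain w' i' where w: "w = w' @ [i']" using cw by auto
    show ?thesis
    proof (cases "v = []")
      case True
      show ?thesis using less[of w' "[]" i j] unfolding w \<open>v = []\<close>
        by (simp add: s3 s6 shuffle_word_empty image_mset.compositionality o_def ac_simps)
    next
      case False
      then obtain v' j' where v: "v = v' @ [j']" using cv by auto
      show ?thesis using less[of w' v i j] less[of w v' i j] unfolding w v
        by (simp add: s4 s7 s8 shuffle_word_empty image_mset.compositionality o_def ac_simps)
    qed
  qed
qed

text \<open>Reversal exchanges the recursions \<open>shuffle_word_snoc\<close> and
  \<open>shuffle_word_Cons\<close>.\<close>

lemma shuffle_word_rev: "shuffle_word (rev w) (rev v) = image_mset rev (shuffle_word w v)"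
proof (induction "length w + length v" arbitrary: w v rule: less_induct)
  case less
  show ?case
  proof (cases "w = [] \<or> v = []")
    case True
    then show ?thesis by (auto simp: shuffle_word_empty)
  next
    case False
    then obtain i w' j v' where wv: "w = i # w'" "v = j # v'"
      by (meson neq_Nil_conv)
    show ?thesis using less[of w' "v"] less[of w v'] unfolding wv
      by (simp add: shuffle_word_snoc shuffle_word_Cons image_mset.compositionality o_def)
  qed
qed

text \<open>The antipode of the shuffle Hopf algebra reverses words with a sign; it inverts grouplike elements.\<close>

lemma character_antip:
  assumes "character a" shows "character (antip a)"
proof -
  have "antip a w * antip a v = (\<Sum>u\<in>#shuffle_word w v. antip a u)" for w v
  proof -
    have "antip a w * antip a v = (-1) ^ (length w + length v) * (a (rev w) * a (rev v))"
      by (simp add: antip_def power_add)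
    also have "\<dots> = (-1) ^ (length w + length v) * (\<Sum>u\<in>#shuffle_word w v. a (rev u))"
      using assms by (simp add: character_def shuffle_word_rev image_mset.compositionality o_def)
    also have "\<dots> = (\<Sum>u\<in>#shuffle_word w v. (-1) ^ (length w + length v) * a (rev u))"
      by (simp add: sum_mset_distrib_left)
    also have "\<dots> = (\<Sum>u\<in>#shuffle_word w v. antip a u)"
      by (intro arg_cong[where f=sum_mset] image_mset_cong) (simp add: antip_def shuffle_word_length)
    finally show ?thesis .
  qed
  then show ?thesis using assms by (simp add: character_def antip_def)
qed

lemma antip_antip [simp]: "antip (antip a) = a"
  by (auto simp: antip_def fun_eq_iff simp flip: power_add mult.assoc)

lemma antip_tone [simp]: "antip tone = tone"
  by (auto simp: antip_def tone_def fun_eq_iff)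

lemma antip_ttrunc: "antip (ttrunc N a) = ttrunc N (antip a)"
  by (auto simp: antip_def ttrunc_def fun_eq_iff)

text \<open>By the character property each summand \<open>a (take i w) * a (rev (drop i w))\<close>
  is a sum over shuffles. Sorting these by their last letter, which is \<open>w ! i\<close> or
  \<open>w ! (i - 1)\<close>, turns the summand into \<open>g i + g (i - 1)\<close>, and the
  alternating signs cancel everything.\<close>

lemma tmult_antip:
  assumes "character a" shows "tmult a (antip a) = tone"
proof
  fix w
  show "tmult a (antip a) w = tone w"
  proof (cases "w = []")
    case True
    then show ?thesis using assms by (simp add: tmult_def tone_def antip_def character_def)
  next
    case False
    define n where "n = length w"
    have n: "n > 0" using False by (simp add: n_def)
    define g where "g i = (\<Sum>u\<in>#shuffle_word (take i w) (rev (drop (Suc i) w)). a (u @ [w ! i]))" for i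
    have T: "a (take i w) * a (rev (drop i w)) =
       (if i < n then g i else 0) + (if i > 0 then g (i - 1) else 0)" if "i \<le> n" for i
    proof -
      have eq: "a (take i w) * a (rev (drop i w)) = (\<Sum>u\<in>#shuffle_word (take i w) (rev (drop i w)). a u)"
        using assms by (simp add: character_def)
      have d: "rev (drop i w) = rev (drop (Suc i) w) @ [w ! i]" if "i < n"
        using that by (simp add: n_def Cons_nth_drop_Suc[symmetric])
      have t: "take i w = take (i - 1) w @ [w ! (i - 1)]" if "i > 0"
        using that \<open>i \<le> n\<close> take_Suc_conv_app_nth[of "i-1" w] by (simp add: n_def)
      consider "i = 0" | "0 < i" "i < n" | "i = n" "i > 0" using \<open>i \<le> n\<close> by linarith
      then show ?thesis
      proof cases
        case 1
        then have "a (take i w) * a (rev (drop i w)) = a (rev (drop 1 w) @ [w ! 0])"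
          using n d assms by (simp add: character_def)
        then show ?thesis using n 1 by (simp add: g_def shuffle_word_empty)
      next
        case 2
        show ?thesis unfolding eq g_def
          apply (subst t[OF 2(1)], subst d[OF 2(2)], subst shuffle_word_snoc)
          using 2 t d by (simp add: image_mset.compositionality o_def)
      next
        case 3
        then have w: "w = take (i - 1) w @ [w ! (i - 1)]" using t[OF 3(2)] by (simp add: n_def)
        have "drop i w = []" "take i w = w" using 3 by (auto simp: n_def)
        then have "a (take i w) * a (rev (drop i w)) = a (take (i - 1) w @ [w ! (i - 1)])"
          using arg_cong[OF w, of a] assms by (metis character_def mult.right_neutral rev.simps(1))
        moreover have "drop (Suc (i - 1)) w = []" using 3 by (auto simp: n_def)
        ultimately show ?thesis using 3 by (simp add: g_def shuffle_word_empty)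
      qed
    qed
    have "tmult a (antip a) w = (\<Sum>i\<le>n. (-1) ^ (n - i) * (a (take i w) * a (rev (drop i w))))"
      by (simp add: tmult_def antip_def n_def mult_ac)
    also have "\<dots> = (\<Sum>i\<le>n. (-1) ^ (n - i) * (if i < n then g i else 0))
       + (\<Sum>i\<le>n. (-1) ^ (n - i) * (if i > 0 then g (i - 1) else 0))"
      unfolding sum.distrib[symmetric] by (intro sum.cong refl) (simp add: T distrib_left)
    also have "(\<Sum>i\<le>n. (-1) ^ (n - i) * (if i < n then g i else 0)) = (\<Sum>i<n. (-1) ^ (n - i) * g i)"
      by (rule sum.mono_neutral_cong_right) auto
    also have "(\<Sum>i\<le>n. (-1) ^ (n - i) * (if i > 0 then g (i - 1) else 0)) = (\<Sum>i<n. (-1) ^ (n - Suc i) * g i)"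
    proof -
      obtain m where m: "n = Suc m" using n by (cases n) auto
      show ?thesis unfolding m by (subst sum.atMost_Suc_shift) (simp add: lessThan_Suc_atMost)
    qed
    also have "\<dots> = - (\<Sum>i<n. (-1) ^ (n - i) * g i)"
      unfolding sum_negf[symmetric]
      by (intro sum.cong refl) (metis Suc_diff_Suc lessThan_iff minus_mult_left mult_minus1 power_Suc minus_minus)
    finally show ?thesis using False by (simp add: tone_def)
  qed
qed

lemma tmult_antip_left:
  assumes "character a" shows "tmult (antip a) a = tone"
  using tmult_antip[OF character_antip[OF assms]] by simp

section \<open>Tensor multiplication and truncation\<close>

lemma tmult_tone_left [simp]: "tmult tone a = a"
proof
  fix w show "tmult tone a w = a w"
    unfolding tmult_def tone_def
    by (subst sum.mono_neutral_right[where S="{0}"]) auto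
qed

lemma tmult_tone_right [simp]: "tmult a tone = a"
proof
  fix w show "tmult a tone w = a w"
    unfolding tmult_def tone_def
    by (subst sum.mono_neutral_right[where S="{length w}"]) auto
qed

lemma tmult_assoc: "tmult (tmult a b) (c :: 'a tensor) = tmult a (tmult b c)"
proof
  fix w :: "'a list"
  define n where "n = length w"
  define g where "g j k = (a (take j w) :: real) * b (take k (drop j w)) * c (drop (j + k) w)" for j k
  have "tmult (tmult a b) c w = (\<Sum>i\<le>n. \<Sum>j\<le>i. g j (i - j))"
    unfolding tmult_def n_def g_def
    by (intro sum.cong refl) (simp add: sum_distrib_right min_absorb1 min_absorb2 drop_take)
  also have "\<dots> = (\<Sum>(i,j)\<in>{(i,j). i+j \<le> n}. g i j)"
    by (rule sum.triangle_reindex_eq[symmetric])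
  also have "{(i,j). i+j \<le> n} = (SIGMA j:{..n}. {..n-j})" by auto
  also have "(\<Sum>(i,j)\<in>(SIGMA j:{..n}. {..n-j}). g i j) = (\<Sum>j\<le>n. \<Sum>k\<le>n-j. g j k)"
    by (simp add: sum.Sigma)
  also have "\<dots> = tmult a (tmult b c) w"
    unfolding tmult_def n_def g_def
    by (intro sum.cong refl) (simp add: sum_distrib_left mult.assoc add.commute)
  finally show "tmult (tmult a b) c w = tmult a (tmult b c) w" .
qed

lemma ttrunc_tmult:
  "ttrunc N (tmult (ttrunc N a) b) = ttrunc N (tmult a b)"
  "ttrunc N (tmult a (ttrunc N b)) = ttrunc N (tmult a b)"
  by (auto simp: ttrunc_def tmult_def fun_eq_iff intro!: sum.cong)

lemma ttrunc_ttrunc [simp]: "ttrunc N (ttrunc N a) = ttrunc N a"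
  by (auto simp: ttrunc_def)

lemma ttrunc_tone [simp]: "ttrunc N tone = tone"
  by (auto simp: ttrunc_def tone_def fun_eq_iff)

definition word_ind :: "'a list \<Rightarrow> 'a tensor" where "word_ind w = (\<lambda>v. if v = w then 1 else 0)"

lemma word_ind_tfin [simp]: "word_ind w \<in> tfin"
  by (simp add: word_ind_def tfin_def)

lemma pairing_eq_sum:
  assumes "finite W" "\<And>w. l w \<noteq> 0 \<Longrightarrow> a w \<noteq> 0 \<Longrightarrow> w \<in> W"
  shows "pairing l a = (\<Sum>w\<in>W. l w * a w)"
  unfolding pairing_def by (rule sum.mono_neutral_left) (use assms in auto)

lemma shuffle_prod_word_ind:
  "shuffle_prod (word_ind w) (word_ind v) u = real (count (shuffle_word w v) u)" for u :: "'a::finite list"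
proof (cases "length w + length v = length u")
  case True
  have fin: "finite {(x::'a list, y::'a list). length x + length y = length u}"
    by (rule finite_subset[of _ "{x. length x \<le> length u} \<times> {x. length x \<le> length u}"]) auto
  have "shuffle_prod (word_ind w) (word_ind v) u = (\<Sum>(x, y)\<in>{(w,v)}. word_ind w x * word_ind v y * real (count (shuffle_word x y) u))"
    unfolding shuffle_prod_def
    by (rule sum.mono_neutral_right[OF fin]) (use True in \<open>auto simp: word_ind_def split: if_splits\<close>)
  then show ?thesis by (simp add: word_ind_def)
next
  case False
  then have "count (shuffle_word w v) u = 0"
    by (metis not_in_iff shuffle_word_length)
  moreover have "shuffle_prod (word_ind w) (word_ind v) u = 0"
    unfolding shuffle_prod_def by (rule sum.neutral) (use False in \<open>auto simp: word_ind_def\<close>)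
  ultimately show ?thesis by simp
qed

lemma sum_mset_count: "(\<Sum>u\<in>#M. f u) = (\<Sum>u\<in>set_mset M. real (count M u) * f u)"
  for f :: "'b \<Rightarrow> real"
proof (induction M)
  case (add x M)
  show ?case
  proof (cases "x \<in># M")
    case True
    have "(\<Sum>u\<in>set_mset M. real (count (add_mset x M) u) * f u)
        = (\<Sum>u\<in>set_mset M. real (count M u) * f u + (if u = x then f u else 0))"
      by (intro sum.cong refl) (auto simp: algebra_simps)
    also have "\<dots> = (\<Sum>u\<in>set_mset M. real (count M u) * f u) + f x"
      using True by (simp add: sum.distrib)
    finally show ?thesis using add True by (simp add: insert_absorb)
  next
    case False
    have "(\<Sum>u\<in>set_mset M. real (count (add_mset x M) u) * f u)
        = (\<Sum>u\<in>set_mset M. real (count M u) * f u)"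
      using False by (intro sum.cong refl) auto
    then show ?thesis using add False by (simp add: not_in_iff)
  qed
qed simp

text \<open>Trades the multiset for a linear combination over a fixed finite set of words, the form
  in which pairings and limits can be taken term by term.\<close>

lemma sum_mset_shuffle_word:
  fixes a :: "'a::finite tensor"
  shows "(\<Sum>u\<in>#shuffle_word w v. a u) =
    (\<Sum>u | length u = length w + length v. real (count (shuffle_word w v) u) * a u)"
  unfolding sum_mset_count
  by (rule sum.mono_neutral_left) (auto simp: shuffle_word_length not_in_iff)

subsection \<open>Graded pairing\<close>

definition level_pairing :: "nat \<Rightarrow> 'a tensor \<Rightarrow> 'a tensor \<Rightarrow> real" where
  "level_pairing n l a = (\<Sum>w | length w = n. l w * a w)"

definition pairing_poly :: "'a tensor \<Rightarrow> 'a tensor \<Rightarrow> real poly" where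
  "pairing_poly l a = (\<Sum>n\<le>tdeg l. monom (level_pairing n l a) n)"

lemma tfin_length_le_tdeg: "l \<in> tfin \<Longrightarrow> l w \<noteq> 0 \<Longrightarrow> length w \<le> tdeg l"
  unfolding tdeg_def tfin_def by (intro Max_ge) auto

lemma tfinI: "(\<And>w::'a::finite list. l w \<noteq> 0 \<Longrightarrow> length w \<le> N) \<Longrightarrow> l \<in> tfin"
  unfolding tfin_def by (auto intro: finite_subset[OF _ finite_words_le[of N]])

lemma tdeg_leI: "l \<in> tfin \<Longrightarrow> (\<And>w. l w \<noteq> 0 \<Longrightarrow> length w \<le> N) \<Longrightarrow> tdeg l \<le> N"
  unfolding tdeg_def tfin_def by (subst Max_le_iff) auto

lemma level_pairing_gt_tdeg: "l \<in> tfin \<Longrightarrow> n > tdeg l \<Longrightarrow> level_pairing n l a = 0"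
  unfolding level_pairing_def
  by (rule sum.neutral) (use tfin_length_le_tdeg[of l] in fastforce)

lemma coeff_pairing_poly: "l \<in> tfin \<Longrightarrow> coeff (pairing_poly l a) n = level_pairing n l a"
  by (auto simp: pairing_poly_def coeff_sum level_pairing_gt_tdeg)

lemma degree_pairing_poly: "degree (pairing_poly l a) \<le> tdeg l"
  unfolding pairing_poly_def
  by (intro degree_sum_le) (auto intro: order.trans[OF degree_monom_le])

lemma sum_words_le:
  fixes f :: "'a::finite list \<Rightarrow> real"
  shows "(\<Sum>w | length w \<le> N. f w) = (\<Sum>n\<le>N. \<Sum>w | length w = n. f w)"
proof -
  have "{w::'a list. length w \<le> N} = (\<Union>n\<in>{..N}. {w. length w = n})" by auto
  then show ?thesis by (simp add: sum.UNION_disjoint disjoint_iff)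
qed

lemma pairing_eq_poly:
  fixes l :: "'a::finite tensor"
  assumes "l \<in> tfin" shows "pairing l a = poly (pairing_poly l a) 1"
proof -
  have "pairing l a = (\<Sum>w | length w \<le> tdeg l. l w * a w)"
    by (rule pairing_eq_sum) (use assms in \<open>auto simp: tfin_length_le_tdeg\<close>)
  also have "\<dots> = (\<Sum>n\<le>tdeg l. level_pairing n l a)"
    by (simp add: sum_words_le level_pairing_def)
  also have "\<dots> = poly (pairing_poly l a) 1"
    by (simp add: pairing_poly_def poly_sum poly_monom)
  finally show ?thesis .
qed

lemma shuffle_prod_nonzero:
  assumes "shuffle_prod l1 l2 u \<noteq> 0" "l1 \<in> tfin" "l2 \<in> tfin"
  shows "length u \<le> tdeg l1 + tdeg l2"
proof -
  obtain w v where "length w + length v = length u" "l1 w * l2 v * real (count (shuffle_word w v) u) \<noteq> 0"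
    using assms(1) unfolding shuffle_prod_def by (auto elim!: sum.not_neutral_contains_not_neutral)
  then show ?thesis using tfin_length_le_tdeg[OF assms(2), of w] tfin_length_le_tdeg[OF assms(3), of v] by auto
qed

lemma shuffle_prod_tfin: "l1 \<in> tfin \<Longrightarrow> l2 \<in> tfin \<Longrightarrow> shuffle_prod l1 l2 \<in> tfin" for l1 :: "'a::finite tensor"
  by (rule tfinI[of _ "tdeg l1 + tdeg l2"]) (rule shuffle_prod_nonzero)

text \<open>Shuffling adds word lengths, so the character property, applied to each pair of words,
  distributes level \<open>n\<close> over the pairs of levels that add up to \<open>n\<close>. This
  is the coefficient formula of a product of polynomials.\<close>

lemma level_pairing_shuffle:
  fixes a :: "'a::finite tensor"
  assumes "character a"
  shows "level_pairing n (shuffle_prod l1 l2) a = (\<Sum>i\<le>n. level_pairing i l1 a * level_pairing (n - i) l2 a)"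
proof -
  have "level_pairing n (shuffle_prod l1 l2) a =
     (\<Sum>u | length u = n. \<Sum>(w, v) | length w + length v = n. l1 w * l2 v * (real (count (shuffle_word w v) u) * a u))"
    unfolding level_pairing_def shuffle_prod_def
    by (intro sum.cong refl) (auto simp: sum_distrib_right intro!: sum.cong)
  also have "\<dots> = (\<Sum>(w, v) | length w + length v = n. \<Sum>u | length u = n. l1 w * l2 v * (real (count (shuffle_word w v) u) * a u))"
    by (subst sum.swap) (simp add: case_prod_unfold)
  also have "\<dots> = (\<Sum>(w, v) | length w + length v = n. (l1 w * a w) * (l2 v * a v))"
  proof (intro sum.cong refl, clarify)
    fix w v :: "'a list" assume n: "n = length w + length v"
    have "(l1 w * a w) * (l2 v * a v) = l1 w * l2 v * (\<Sum>u\<in>#shuffle_word w v. a u)"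
      using assms by (simp add: character_def)
    also have "\<dots> = (\<Sum>u | length u = length w + length v. l1 w * l2 v * (real (count (shuffle_word w v) u) * a u))"
      by (simp add: sum_mset_shuffle_word sum_distrib_left)
    finally show "(\<Sum>u | length u = length w + length v. l1 w * l2 v * (real (count (shuffle_word w v) u) * a u))
      = (l1 w * a w) * (l2 v * a v)" ..
  qed
  also have "{(w::'a list, v::'a list). length w + length v = n} = (\<Union>i\<in>{..n}. {w. length w = i} \<times> {v. length v = n - i})"
    by auto
  also have "(\<Sum>(w, v)\<in>(\<Union>i\<in>{..n}. {w. length w = i} \<times> {v. length v = n - i}). (l1 w * a w) * (l2 v * a v))
     = (\<Sum>i\<le>n. \<Sum>(w, v)\<in>{w. length w = i} \<times> {v. length v = n - i}. (l1 w * a w) * (l2 v * a v))"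
    by (rule sum.UNION_disjoint) auto
  also have "\<dots> = (\<Sum>i\<le>n. level_pairing i l1 a * level_pairing (n - i) l2 a)"
    unfolding level_pairing_def sum_product by (simp add: sum.cartesian_product)
  finally show ?thesis .
qed

lemma pairing_poly_shuffle:
  fixes a :: "'a::finite tensor"
  assumes "character a" "l1 \<in> tfin" "l2 \<in> tfin"
  shows "pairing_poly (shuffle_prod l1 l2) a = pairing_poly l1 a * pairing_poly l2 a"
  by (rule poly_eqI)
    (simp add: coeff_mult coeff_pairing_poly shuffle_prod_tfin assms level_pairing_shuffle)

lemma pairing_word_ind: "pairing (word_ind w) a = a w"
  by (subst pairing_eq_sum[of "{w}"]) (auto simp: word_ind_def split: if_splits)

text \<open>From left to right the pairing is tested on single words; \<open>a [] = 1\<close> then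
  follows from \<open>a [] * a w = a w\<close> at a word where \<open>a\<close> does not vanish. The
  converse evaluates the product of pairing polynomials at \<open>1\<close>.\<close>

lemma grouplike_iff_character: "a \<in> grouplike \<longleftrightarrow> character a" for a :: "'a::finite tensor"
proof
  assume a: "a \<in> grouplike"
  have mult: "a w * a v = (\<Sum>u\<in>#shuffle_word w v. a u)" for w v
  proof -
    have "a w * a v = pairing (shuffle_prod (word_ind w) (word_ind v)) a"
      using a by (simp add: grouplike_def pairing_word_ind)
    also have "\<dots> = (\<Sum>u | length u = length w + length v. real (count (shuffle_word w v) u) * a u)"
      by (subst pairing_eq_sum[of "{u. length u = length w + length v}"])
         (auto simp: shuffle_prod_word_ind shuffle_word_length)
    finally show ?thesis by (simp add: sum_mset_shuffle_word)
  qed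
  obtain w where "a w \<noteq> 0" using a by (auto simp: grouplike_def fun_eq_iff)
  then have "a [] = 1" using mult[of "[]" w] by (simp add: shuffle_word_empty)
  then show "character a" using mult by (simp add: character_def)
next
  assume a: "character a"
  then have "a \<noteq> (\<lambda>_. 0)" by (auto simp: character_def)
  then show "a \<in> grouplike"
    by (simp add: grouplike_def pairing_eq_poly shuffle_prod_tfin pairing_poly_shuffle a)
qed

section \<open>Inverses and increments in the truncated groups\<close>

lemma character_Nil: "character a \<Longrightarrow> a [] = 1"
  by (simp add: character_def)

text \<open>The antipode commutes with truncation and inverts \<open>a\<close>. Any other inverse
  \<open>b\<close> agrees with it by the group argument \<open>b = b (a a') = (b a) a'\<close>,
  carried out modulo truncation.\<close>

lemma ginv_ttrunc:
  fixes a :: "'a::finite tensor"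
  assumes "character a"
  shows "ginv N (ttrunc N a) = ttrunc N (antip a)"
  unfolding ginv_def
proof (rule the_equality)
  show "ttrunc N (antip a) \<in> grouplike_trunc N \<and>
     ttrunc N (tmult (ttrunc N a) (ttrunc N (antip a))) = tone \<and>
     ttrunc N (tmult (ttrunc N (antip a)) (ttrunc N a)) = tone"
    using assms character_antip[OF assms]
    by (simp add: grouplike_trunc_def grouplike_iff_character ttrunc_tmult tmult_antip tmult_antip_left)
next
  fix b assume b: "b \<in> grouplike_trunc N \<and> ttrunc N (tmult (ttrunc N a) b) = tone \<and>
    ttrunc N (tmult b (ttrunc N a)) = tone"
  have "b = ttrunc N b" using b by (auto simp: grouplike_trunc_def)
  also have "\<dots> = ttrunc N (tmult b (tmult a (antip a)))" by (simp add: tmult_antip assms)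
  also have "\<dots> = ttrunc N (tmult (ttrunc N (tmult b a)) (antip a))"
    by (simp add: tmult_assoc ttrunc_tmult)
  also have "\<dots> = ttrunc N (antip a)" using b by (simp add: ttrunc_tmult)
  finally show "b = ttrunc N (antip a)" .
qed

text \<open>Applies to a path that is known only up to level \<open>N\<close>: its value is the
  truncation of some character, and \<open>incr\<close> on words of length at most \<open>N\<close>
  depends on that truncation alone.\<close>

lemma path_incr_ttrunc:
  fixes X :: "real \<Rightarrow> 'a::finite tensor"
  assumes "X s \<in> grouplike_trunc N"
  shows "path_incr N X s t = ttrunc N (incr X s t)"
proof -
  obtain a where a: "character a" "X s = ttrunc N a"
    using assms unfolding grouplike_trunc_def grouplike_iff_character[symmetric] by blast
  show ?thesis unfolding path_incr_def incr_def a(2)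
    by (simp add: ginv_ttrunc a(1) antip_ttrunc ttrunc_tmult)
qed

lemma incr_same: "character (S s) \<Longrightarrow> incr S s s = tone"
  by (simp add: incr_def tmult_antip_left)

lemma incr_Chen: "character (S u) \<Longrightarrow> tmult (incr S s u) (incr S u t) = incr S s t"
proof -
  assume "character (S u)"
  then have "tmult (S u) (tmult (antip (S u)) (S t)) = S t"
    by (simp add: tmult_assoc[symmetric] tmult_antip)
  then show ?thesis by (simp add: incr_def tmult_assoc)
qed

lemma incr_from_tone: "S s = tone \<Longrightarrow> incr S s t = S t"
  by (simp add: incr_def)

lemma incr_mult: "character (S s) \<Longrightarrow> tmult (S s) (incr S s t) = S t"
  by (simp add: incr_def tmult_assoc[symmetric] tmult_antip)

subsection \<open>Controls and sewing\<close>

text \<open>Superadditivity is the whole content. Smallness on short intervals enters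
  \<open>sewing\<close> separately, as a hypothesis on Riemann sums.\<close>

definition control :: "real \<Rightarrow> (real \<Rightarrow> real \<Rightarrow> real) \<Rightarrow> bool" where
  "control T \<omega> \<longleftrightarrow> (\<forall>s t. 0 \<le> s \<and> s \<le> t \<and> t \<le> T \<longrightarrow> 0 \<le> \<omega> s t) \<and>
     (\<forall>s u t. 0 \<le> s \<and> s \<le> u \<and> u \<le> t \<and> t \<le> T \<longrightarrow> \<omega> s u + \<omega> u t \<le> \<omega> s t)"

lemma control_nonneg: "control T \<omega> \<Longrightarrow> 0 \<le> s \<Longrightarrow> s \<le> t \<Longrightarrow> t \<le> T \<Longrightarrow> 0 \<le> \<omega> s t"
  and control_superadd: "control T \<omega> \<Longrightarrow> 0 \<le> s \<Longrightarrow> s \<le> u \<Longrightarrow> u \<le> t \<Longrightarrow> t \<le> T \<Longrightarrow> \<omega> s u + \<omega> u t \<le> \<omega> s t"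
  by (auto simp: control_def)

lemma control_mono_left:
  "control T \<omega> \<Longrightarrow> 0 \<le> s \<Longrightarrow> s \<le> u \<Longrightarrow> u \<le> t \<Longrightarrow> t \<le> T \<Longrightarrow> \<omega> s u \<le> \<omega> s t"
  using control_superadd[of T \<omega> s u t] control_nonneg[of T \<omega> u t] by auto

lemma control_mono_right:
  "control T \<omega> \<Longrightarrow> 0 \<le> s \<Longrightarrow> s \<le> u \<Longrightarrow> u \<le> t \<Longrightarrow> t \<le> T \<Longrightarrow> \<omega> u t \<le> \<omega> s t"
  using control_superadd[of T \<omega> s u t] control_nonneg[of T \<omega> s u] by auto

text \<open>The double steps with even and with odd starting index form two chains of adjacent
  intervals. Superadditivity bounds each chain by one value of the control, which gives the two
  terms on the right.\<close>

lemma control_two_step_sum: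
  assumes c: "control T \<omega>" and "mono \<tau>" "0 \<le> \<tau> 0" "\<tau> (Suc m) \<le> T"
  shows "(\<Sum>i<m. \<omega> (\<tau> i) (\<tau> (Suc (Suc i)))) \<le> \<omega> (\<tau> 0) (\<tau> (Suc m)) + \<omega> (\<tau> 0) (\<tau> m)"
  using assms(4)
proof (induction m)
  case 0
  have "\<tau> 0 \<le> \<tau> (Suc 0)" by (rule monoD[OF assms(2)]) simp
  then show ?case using 0 assms control_nonneg[OF c, of "\<tau> 0" "\<tau> 0"] control_nonneg[OF c, of "\<tau> 0" "\<tau> (Suc 0)"]
    by auto
next
  case (Suc m)
  have le: "\<tau> 0 \<le> \<tau> m" "\<tau> m \<le> \<tau> (Suc (Suc m))" "\<tau> (Suc m) \<le> \<tau> (Suc (Suc m))"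
    by (auto intro!: monoD[OF assms(2)])
  then show ?case using Suc assms control_superadd[OF c, of "\<tau> 0" "\<tau> m" "\<tau> (Suc (Suc m))"]
    by auto
qed

text \<open>Bookkeeping for the deletion of the partition point \<open>Suc i\<close>, whose two
  adjacent intervals become one.\<close>

lemma sum_merge_two:
  fixes f :: "nat \<Rightarrow> real"
  assumes "i \<le> m"
  shows "(\<Sum>j<Suc (Suc m). f j) = (\<Sum>j<Suc m. if j < i then f j else if j = i then f i + f (Suc i) else f (Suc j))"
  using assms
proof (induction m)
  case (Suc m)
  show ?case
  proof (cases "i = Suc m")
    case True
    have "(\<Sum>j<Suc m. if j < i then f j else if j = i then f i + f (Suc i) else f (Suc j)) = (\<Sum>j<Suc m. f j)"
      using True by (intro sum.cong) auto
    then show ?thesis using True by simp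
  next
    case False
    then show ?thesis using Suc by simp
  qed
qed simp

text \<open>Young's argument: remove successively a point whose two adjacent intervals carry little of
  the control.\<close>

lemma point_removal:
  fixes D :: "real \<Rightarrow> real \<Rightarrow> real"
  assumes c: "control T \<omega>" and B: "B \<ge> 0" "\<theta> \<ge> 0"
    and D: "\<And>s u t. 0 \<le> s \<Longrightarrow> s \<le> u \<Longrightarrow> u \<le> t \<Longrightarrow> t \<le> T \<Longrightarrow> \<bar>D s t - D s u - D u t\<bar> \<le> B * \<omega> s t powr \<theta>"
    and \<tau>: "mono \<tau>" "0 \<le> \<tau> 0" "\<tau> (Suc m) \<le> T"
  shows "\<bar>D (\<tau> 0) (\<tau> (Suc m)) - (\<Sum>i<Suc m. D (\<tau> i) (\<tau> (Suc i)))\<bar>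
     \<le> B * (\<omega> (\<tau> 0) (\<tau> (Suc m)) powr \<theta> * (\<Sum>j<m. (2 / real (Suc j)) powr \<theta>))"
  using \<tau>
proof (induction m arbitrary: \<tau>)
  case (Suc m)
  define W where "W = \<omega> (\<tau> 0) (\<tau> (Suc (Suc m)))"
  have mono: "\<tau> i \<le> \<tau> j" if "i \<le> j" for i j using Suc.prems(1) that by (rule monoD)
  have le: "0 \<le> \<tau> i" for i using Suc.prems(2) mono[of 0 i] by simp
  have leT: "\<tau> i \<le> T" if "i \<le> Suc (Suc m)" for i using Suc.prems(3) mono[OF that] by simp
  have W: "W \<ge> 0" unfolding W_def using control_nonneg[OF c] le leT mono by simp
  have "(\<Sum>i<Suc m. \<omega> (\<tau> i) (\<tau> (Suc (Suc i)))) \<le> W + \<omega> (\<tau> 0) (\<tau> (Suc m))"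
    unfolding W_def by (rule control_two_step_sum[OF c Suc.prems])
  also have "\<omega> (\<tau> 0) (\<tau> (Suc m)) \<le> W"
    unfolding W_def using le leT mono by (intro control_mono_left[OF c]) auto
  finally have sum2: "(\<Sum>i<Suc m. \<omega> (\<tau> i) (\<tau> (Suc (Suc i)))) \<le> 2 * W" by simp
  \<comment> \<open>The \<open>Suc m\<close> double steps carry at most \<open>2 * W\<close> in
    total, so one of them carries at most the average; deleting its middle point costs
    \<open>B * (2 * W / Suc m) powr \<theta>\<close>.\<close>
  obtain i where i: "i < Suc m" "\<omega> (\<tau> i) (\<tau> (Suc (Suc i))) \<le> 2 * W / real (Suc m)"
  proof (rule ccontr)
    assume "\<not> thesis"
    then have "\<And>i. i < Suc m \<Longrightarrow> 2 * W / real (Suc m) < \<omega> (\<tau> i) (\<tau> (Suc (Suc i)))"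
      using that not_le by blast
    then have "(\<Sum>i<Suc m. 2 * W / real (Suc m)) < (\<Sum>i<Suc m. \<omega> (\<tau> i) (\<tau> (Suc (Suc i))))"
      by (intro sum_strict_mono) auto
    with sum2 show False by simp
  qed
  define \<sigma> where "\<sigma> j = (if j \<le> i then \<tau> j else \<tau> (Suc j))" for j
  have \<sigma>: "mono \<sigma>" unfolding \<sigma>_def by (intro monoI) (auto intro!: mono)
  have \<sigma>0: "\<sigma> 0 = \<tau> 0" by (simp add: \<sigma>_def)
  have \<sigma>m: "\<sigma> (Suc m) = \<tau> (Suc (Suc m))" using i by (simp add: \<sigma>_def)
  have IH: "\<bar>D (\<tau> 0) (\<tau> (Suc (Suc m))) - (\<Sum>i<Suc m. D (\<sigma> i) (\<sigma> (Suc i)))\<bar>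
     \<le> B * (W powr \<theta> * (\<Sum>j<m. (2 / real (Suc j)) powr \<theta>))"
    using Suc.IH[OF \<sigma>] Suc.prems unfolding \<sigma>0 \<sigma>m W_def by simp
  define d where "d = D (\<tau> i) (\<tau> (Suc (Suc i))) - D (\<tau> i) (\<tau> (Suc i)) - D (\<tau> (Suc i)) (\<tau> (Suc (Suc i)))"
  have "(\<Sum>j<Suc (Suc m). D (\<tau> j) (\<tau> (Suc j))) =
      (\<Sum>j<Suc m. if j < i then D (\<tau> j) (\<tau> (Suc j)) else if j = i
         then D (\<tau> i) (\<tau> (Suc i)) + D (\<tau> (Suc i)) (\<tau> (Suc (Suc i))) else D (\<tau> (Suc j)) (\<tau> (Suc (Suc j))))"
    using i by (intro sum_merge_two) auto
  also have "\<dots> = (\<Sum>j<Suc m. D (\<sigma> j) (\<sigma> (Suc j)) - (if j = i then d else 0))"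
    by (intro sum.cong) (auto simp: \<sigma>_def d_def)
  also have "\<dots> = (\<Sum>j<Suc m. D (\<sigma> j) (\<sigma> (Suc j))) - d"
    using i by (simp add: sum_subtractf)
  finally have eq: "(\<Sum>j<Suc (Suc m). D (\<tau> j) (\<tau> (Suc j))) = (\<Sum>j<Suc m. D (\<sigma> j) (\<sigma> (Suc j))) - d" .
  have "\<bar>d\<bar> \<le> B * \<omega> (\<tau> i) (\<tau> (Suc (Suc i))) powr \<theta>"
    unfolding d_def using i by (intro D) (auto intro!: le leT mono)
  also have "\<dots> \<le> B * (2 * W / real (Suc m)) powr \<theta>"
    using i B by (intro mult_left_mono powr_mono2 control_nonneg[OF c]) (auto intro!: le leT mono)
  also have "(2 * W / real (Suc m)) powr \<theta> = W powr \<theta> * (2 / real (Suc m)) powr \<theta>"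
    using W by (simp add: powr_mult[symmetric] mult_ac)
  finally have d: "\<bar>d\<bar> \<le> B * (W powr \<theta> * (2 / real (Suc m)) powr \<theta>)" .
  have "\<bar>D (\<tau> 0) (\<tau> (Suc (Suc m))) - (\<Sum>j<Suc (Suc m). D (\<tau> j) (\<tau> (Suc j)))\<bar>
     \<le> B * (W powr \<theta> * (\<Sum>j<m. (2 / real (Suc j)) powr \<theta>)) + B * (W powr \<theta> * (2 / real (Suc m)) powr \<theta>)"
    unfolding eq using IH d by linarith
  also have "\<dots> = B * (W powr \<theta> * (\<Sum>j<Suc m. (2 / real (Suc j)) powr \<theta>))"
    by (simp add: algebra_simps)
  finally show ?case unfolding W_def .
qed simp

text \<open>The total relative cost of deleting all interior points of a partition; it equals
  \<open>2 powr \<theta>\<close> times the zeta function at \<theta> and is finite for \<theta>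
  above \<open>1\<close>.\<close>

definition sew_const :: "real \<Rightarrow> real" where
  "sew_const \<theta> = (\<Sum>j. (2 / real (Suc j)) powr \<theta>)"

lemma summable_sew: assumes "\<theta> > 1" shows "summable (\<lambda>j. (2 / real (Suc j)) powr \<theta>)"
proof -
  have "summable (\<lambda>j. real j powr (-\<theta>))"
    using assms by (simp add: summable_real_powr_iff)
  then have "summable (\<lambda>j. real (Suc j) powr (-\<theta>))"
    by (subst summable_Suc_iff)
  then have "summable (\<lambda>j. 2 powr \<theta> * real (Suc j) powr (-\<theta>))" by (rule summable_mult)
  then show ?thesis by (simp add: powr_divide powr_minus_divide)
qed

lemma sew_const_nonneg: "\<theta> > 1 \<Longrightarrow> sew_const \<theta> \<ge> 0"
  unfolding sew_const_def by (intro suminf_nonneg summable_sew) auto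

text \<open>The \<open>i\<close>-th point of the partition of \<open>[s, t]\<close> into
  \<open>Suc m\<close> equal intervals; the successor excludes a division by zero.\<close>

definition upart :: "real \<Rightarrow> real \<Rightarrow> nat \<Rightarrow> nat \<Rightarrow> real" where
  "upart s t m i = s + (t - s) * real i / real (Suc m)"

lemma upart_mono: "s \<le> t \<Longrightarrow> mono (upart s t m)"
  unfolding upart_def by (intro monoI) (auto intro!: divide_right_mono mult_left_mono)

lemma upart_0 [simp]: "upart s t m 0 = s" and upart_Suc [simp]: "upart s t m (Suc m) = t"
  by (auto simp: upart_def)

lemma upart_bounds:
  assumes "s \<le> t" "i \<le> Suc m" shows "s \<le> upart s t m i" "upart s t m i \<le> t"
  using monoD[OF upart_mono[OF assms(1)], of 0 i m] monoD[OF upart_mono[OF assms(1)], of i "Suc m" m] assms by auto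

text \<open>The bound from \<open>point_removal\<close> does not depend on the number of points.
  Along the uniform partitions the sum of the small pieces vanishes by \<open>lim\<close>, and only
  \<open>D s t\<close> is left.\<close>

lemma sewing:
  fixes D :: "real \<Rightarrow> real \<Rightarrow> real"
  assumes c: "control T \<omega>" and B: "B \<ge> 0" "\<theta> > 1"
    and D: "\<And>s u t. 0 \<le> s \<Longrightarrow> s \<le> u \<Longrightarrow> u \<le> t \<Longrightarrow> t \<le> T \<Longrightarrow> \<bar>D s t - D s u - D u t\<bar> \<le> B * \<omega> s t powr \<theta>"
    and st: "0 \<le> s" "s \<le> t" "t \<le> T"
    and lim: "(\<lambda>m. \<Sum>i<Suc m. D (upart s t m i) (upart s t m (Suc i))) \<longlonglongrightarrow> 0"
  shows "\<bar>D s t\<bar> \<le> B * (\<omega> s t powr \<theta> * sew_const \<theta>)"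
proof -
  have "\<bar>D s t - (\<Sum>i<Suc m. D (upart s t m i) (upart s t m (Suc i)))\<bar> \<le> B * (\<omega> s t powr \<theta> * sew_const \<theta>)" for m
  proof -
    have "\<bar>D s t - (\<Sum>i<Suc m. D (upart s t m i) (upart s t m (Suc i)))\<bar>
       \<le> B * (\<omega> s t powr \<theta> * (\<Sum>j<m. (2 / real (Suc j)) powr \<theta>))"
      using point_removal[OF c, of B \<theta> D "upart s t m" m] B D st upart_mono by simp
    also have "\<dots> \<le> B * (\<omega> s t powr \<theta> * sew_const \<theta>)"
      unfolding sew_const_def using B
      by (intro mult_left_mono sum_le_suminf summable_sew) auto
    finally show ?thesis .
  qed
  moreover have "(\<lambda>m. \<bar>D s t - (\<Sum>i<Suc m. D (upart s t m i) (upart s t m (Suc i)))\<bar>) \<longlonglongrightarrow> \<bar>D s t - 0\<bar>"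
    by (intro tendsto_intros lim)
  ultimately show ?thesis
    by (intro LIMSEQ_le_const2[of _ "\<bar>D s t\<bar>"]) auto
qed

subsection \<open>The extension estimate\<close>

definition multiplicative :: "real \<Rightarrow> (real \<Rightarrow> real \<Rightarrow> 'a tensor) \<Rightarrow> bool" where
  "multiplicative T A \<longleftrightarrow> (\<forall>s t. 0 \<le> s \<and> s \<le> t \<and> t \<le> T \<longrightarrow> A s t [] = 1) \<and>
     (\<forall>s u t. 0 \<le> s \<and> s \<le> u \<and> u \<le> t \<and> t \<le> T \<longrightarrow> tmult (A s u) (A u t) = A s t)"

text \<open>The constants of the extension estimate by word length: \<open>1\<close> on the levels
  assumed, then the sewing constant times the sum over all ways to cut a word. The factor
  \<open>2\<close> is due to the difference of two functionals, where the product rule yields two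
  such sums.\<close>

function ext_const :: "real \<Rightarrow> nat \<Rightarrow> nat \<Rightarrow> real" where
  "ext_const p M n = (if n \<le> M then 1
     else 2 * sew_const (real n / p) * (\<Sum>i\<in>{1..<n}. ext_const p M i * ext_const p M (n - i)))"
  by pat_completeness auto
termination
  by (relation "Wellfounded.measure (\<lambda>(p, M, n). n)") auto

declare ext_const.simps [simp del]

lemma ext_const_nonneg:
  assumes "p > 0" "real (Suc M) > p"
  shows "ext_const p M n \<ge> 0"
proof (induction n rule: less_induct)
  case (less n)
  show ?case
  proof (cases "n \<le> M")
    case False
    then have "real n / p > 1" using assms by (auto simp: field_simps)
    then show ?thesis using False less sew_const_nonneg[of "real n / p"] 
      by (subst ext_const.simps) (auto intro!: mult_nonneg_nonneg sum_nonneg)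
  qed (simp add: ext_const.simps)
qed

text \<open>The failure of additivity at \<open>w\<close> involves only proper prefixes and suffixes
  of \<open>w\<close>. This is what lets \<open>extension_estimate\<close> proceed by induction on
  the word length.\<close>

lemma multiplicative_defect:
  assumes "multiplicative T A" "0 \<le> s" "s \<le> u" "u \<le> t" "t \<le> T" "w \<noteq> []"
  shows "A s t w - A s u w - A u t w = (\<Sum>i\<in>{1..<length w}. A s u (take i w) * A u t (drop i w))"
proof -
  define g where "g i = A s u (take i w) * A u t (drop i w)" for i
  have e: "A s u [] = 1" "A u t [] = 1" using assms by (auto simp: multiplicative_def)
  have "A s t w = tmult (A s u) (A u t) w" using assms by (auto simp: multiplicative_def)
  also have "\<dots> = (\<Sum>i\<le>length w. g i)" by (simp add: tmult_def g_def)
  also have "{..length w} = insert 0 (insert (length w) {1..<length w})" using assms(6) by auto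
  also have "sum g \<dots> = g 0 + g (length w) + (\<Sum>i\<in>{1..<length w}. g i)" using assms(6) by simp
  finally show ?thesis by (simp add: g_def e)
qed

text \<open>Sewing applied to each word, by induction on its length.  The constants depend only on \<open>p\<close> and on the length,
  so that closeness of two functionals passes from the low levels to all levels.\<close>

lemma extension_estimate:
  assumes p: "p > 0" "real (Suc M) > p" and c: "control T \<omega>"
    and A: "multiplicative T A" and B: "multiplicative T B" and \<epsilon>: "\<epsilon> \<ge> 0"
    and low: "\<And>s t w. 0 \<le> s \<Longrightarrow> s \<le> t \<Longrightarrow> t \<le> T \<Longrightarrow> 1 \<le> length w \<Longrightarrow> length w \<le> M \<Longrightarrow>
        \<bar>A s t w\<bar> \<le> \<omega> s t powr (real (length w) / p) \<and> \<bar>B s t w\<bar> \<le> \<omega> s t powr (real (length w) / p) \<and>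
        \<bar>A s t w - B s t w\<bar> \<le> \<epsilon> * \<omega> s t powr (real (length w) / p)"
    and limA: "\<And>s t w. 0 \<le> s \<Longrightarrow> s \<le> t \<Longrightarrow> t \<le> T \<Longrightarrow> M < length w \<Longrightarrow>
        (\<lambda>m. \<Sum>i<Suc m. A (upart s t m i) (upart s t m (Suc i)) w) \<longlonglongrightarrow> 0"
    and limB: "\<And>s t w. 0 \<le> s \<Longrightarrow> s \<le> t \<Longrightarrow> t \<le> T \<Longrightarrow> M < length w \<Longrightarrow>
        (\<lambda>m. \<Sum>i<Suc m. B (upart s t m i) (upart s t m (Suc i)) w) \<longlonglongrightarrow> 0"
    and st: "0 \<le> s" "s \<le> t" "t \<le> T" and w: "w \<noteq> []"
  shows "\<bar>A s t w\<bar> \<le> ext_const p M (length w) * \<omega> s t powr (real (length w) / p) \<and>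
     \<bar>B s t w\<bar> \<le> ext_const p M (length w) * \<omega> s t powr (real (length w) / p) \<and>
     \<bar>A s t w - B s t w\<bar> \<le> \<epsilon> * (ext_const p M (length w) * \<omega> s t powr (real (length w) / p))"
  using w st
proof (induction "length w" arbitrary: w s t rule: less_induct)
  case (less w s t)
  define n where "n = length w"
  define e where "e = ext_const p M"
  have e0: "e i \<ge> 0" for i unfolding e_def by (rule ext_const_nonneg[OF p])
  show ?case
  proof (cases "n \<le> M")
    case True
    then have "ext_const p M (length w) = 1" "1 \<le> length w" "length w \<le> M"
      using less.prems(1) by (auto simp: ext_const.simps[of p M "length w"] n_def Suc_le_eq)
    then show ?thesis using low[of s t w] less.prems by simp
  next
    case False
    define \<theta> where "\<theta> = real n / p"
    have \<theta>: "\<theta> > 1" using False p by (auto simp: \<theta>_def field_simps)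
    define Q where "Q = (\<Sum>i\<in>{1..<n}. e i * e (n - i))"
    have Q: "Q \<ge> 0" unfolding Q_def by (auto intro!: sum_nonneg mult_nonneg_nonneg e0)
    have en: "e n = 2 * sew_const \<theta> * Q"
      using False unfolding e_def Q_def \<theta>_def by (subst ext_const.simps) simp
    have K: "sew_const \<theta> \<ge> 0" by (rule sew_const_nonneg[OF \<theta>])
    have len: "length (take i w) = i" "length (drop i w) = n - i" "take i w \<noteq> []" "drop i w \<noteq> []"
      if "i \<in> {1..<n}" for i using that by (auto simp: n_def)
    \<comment> \<open>Both controls are enlarged to the whole interval; then the exponents
      \<open>i / p\<close> and \<open>(n - i) / p\<close> add up to \<theta>, whatever the cut
      \<open>i\<close>.\<close>
    have prod: "x * y \<le> a * b * \<omega> s t powr \<theta>"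
      if "i \<in> {1..<n}" "0 \<le> s" "s \<le> u" "u \<le> t" "t \<le> T"
        "0 \<le> x" "0 \<le> y" "0 \<le> a" "0 \<le> b" "x \<le> a * \<omega> s u powr (real i / p)" "y \<le> b * \<omega> u t powr (real (n - i) / p)"
      for x y a b i s u t
    proof -
      have "\<omega> s u powr (real i / p) \<le> \<omega> s t powr (real i / p)"
        using that p by (intro powr_mono2 control_mono_left[OF c] control_nonneg[OF c]) auto
      moreover have "\<omega> u t powr (real (n - i) / p) \<le> \<omega> s t powr (real (n - i) / p)"
        using that p by (intro powr_mono2 control_mono_right[OF c] control_nonneg[OF c]) auto
      ultimately have "x \<le> a * \<omega> s t powr (real i / p)" "y \<le> b * \<omega> s t powr (real (n - i) / p)"
        using that by (meson mult_left_mono order.trans)+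
      then have "x * y \<le> (a * \<omega> s t powr (real i / p)) * (b * \<omega> s t powr (real (n - i) / p))"
        using that by (intro mult_mono) auto
      also have "\<dots> = a * b * (\<omega> s t powr (real i / p) * \<omega> s t powr (real (n - i) / p))"
        by (simp add: mult_ac)
      also have "\<omega> s t powr (real i / p) * \<omega> s t powr (real (n - i) / p) = \<omega> s t powr \<theta>"
        using that p unfolding powr_add[symmetric] \<theta>_def by (simp add: of_nat_diff field_simps)
      finally show ?thesis .
    qed
    have IH: "\<bar>A s u (take i w)\<bar> \<le> e i * \<omega> s u powr (real i / p)" "\<bar>B s u (take i w)\<bar> \<le> e i * \<omega> s u powr (real i / p)"
       "\<bar>A s u (take i w) - B s u (take i w)\<bar> \<le> \<epsilon> * (e i * \<omega> s u powr (real i / p))"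
       "\<bar>A s u (drop i w)\<bar> \<le> e (n - i) * \<omega> s u powr (real (n - i) / p)" "\<bar>B s u (drop i w)\<bar> \<le> e (n - i) * \<omega> s u powr (real (n - i) / p)"
       "\<bar>A s u (drop i w) - B s u (drop i w)\<bar> \<le> \<epsilon> * (e (n - i) * \<omega> s u powr (real (n - i) / p))"
      if "i \<in> {1..<n}" "0 \<le> s" "s \<le> u" "u \<le> T" for i s u
      using less.hyps[of "take i w" s u] less.hyps[of "drop i w" s u] that len[OF that(1)] unfolding e_def n_def
      by auto
    \<comment> \<open>The sewing bound for a single functional, stated for \<open>F\<close> so that
      it serves \<open>A\<close> and \<open>B\<close>.\<close>
    have one: "\<bar>F s t w\<bar> \<le> Q * (\<omega> s t powr \<theta> * sew_const \<theta>)"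
      if F: "multiplicative T F"
       "\<And>i s u. i \<in> {1..<n} \<Longrightarrow> 0 \<le> s \<Longrightarrow> s \<le> u \<Longrightarrow> u \<le> T \<Longrightarrow> \<bar>F s u (take i w)\<bar> \<le> e i * \<omega> s u powr (real i / p)"
       "\<And>i s u. i \<in> {1..<n} \<Longrightarrow> 0 \<le> s \<Longrightarrow> s \<le> u \<Longrightarrow> u \<le> T \<Longrightarrow> \<bar>F s u (drop i w)\<bar> \<le> e (n - i) * \<omega> s u powr (real (n - i) / p)"
       "(\<lambda>m. \<Sum>i<Suc m. F (upart s t m i) (upart s t m (Suc i)) w) \<longlonglongrightarrow> 0" for F
    proof (rule sewing[OF c Q \<theta> _ less.prems(2-4) that(4)])
      fix s u t assume s: "0 \<le> s" "s \<le> u" "u \<le> t" "t \<le> T"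
      have "\<bar>F s t w - F s u w - F u t w\<bar> = \<bar>\<Sum>i\<in>{1..<n}. F s u (take i w) * F u t (drop i w)\<bar>"
        unfolding n_def by (subst multiplicative_defect[OF F(1) s less.prems(1)]) simp
      also have "\<dots> \<le> (\<Sum>i\<in>{1..<n}. e i * e (n - i) * \<omega> s t powr \<theta>)"
      proof (rule order.trans[OF sum_abs], rule sum_mono)
        fix i assume i: "i \<in> {1..<n}"
        show "\<bar>F s u (take i w) * F u t (drop i w)\<bar> \<le> e i * e (n - i) * \<omega> s t powr \<theta>"
          unfolding abs_mult using s i by (intro prod[where u=u]) (auto intro!: F e0)
      qed
      finally show "\<bar>F s t w - F s u w - F u t w\<bar> \<le> Q * \<omega> s t powr \<theta>"
        by (simp add: Q_def sum_distrib_right)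
    qed
    have Mw: "M < length w" using False by (simp add: n_def)
    have "\<bar>A s t w - B s t w\<bar> \<le> (2 * \<epsilon> * Q) * (\<omega> s t powr \<theta> * sew_const \<theta>)"
    proof (rule sewing[OF c _ \<theta> _ less.prems(2-4)])
      show "0 \<le> 2 * \<epsilon> * Q" using \<epsilon> Q by simp
      have "(\<lambda>m. (\<Sum>i<Suc m. A (upart s t m i) (upart s t m (Suc i)) w) - (\<Sum>i<Suc m. B (upart s t m i) (upart s t m (Suc i)) w)) \<longlonglongrightarrow> 0 - 0"
        using less.prems Mw by (intro tendsto_diff limA limB)
      then show "(\<lambda>m. \<Sum>i<Suc m. A (upart s t m i) (upart s t m (Suc i)) w - B (upart s t m i) (upart s t m (Suc i)) w) \<longlonglongrightarrow> 0"
        by (simp add: sum_subtractf)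
    next
      fix s u t assume s: "0 \<le> s" "s \<le> u" "u \<le> t" "t \<le> T"
      have "\<bar>(A s t w - B s t w) - (A s u w - B s u w) - (A u t w - B u t w)\<bar>
         = \<bar>(A s t w - A s u w - A u t w) - (B s t w - B s u w - B u t w)\<bar>" by simp
      \<comment> \<open>The product rule \<open>a a' - b b' = (a - b) a' + b (a' - b')\<close>: each
        half contains exactly one difference and hence one factor \<epsilon>.\<close>
      also have "\<dots> = \<bar>(\<Sum>i\<in>{1..<n}. (A s u (take i w) - B s u (take i w)) * A u t (drop i w)
            + B s u (take i w) * (A u t (drop i w) - B u t (drop i w)))\<bar>"
        unfolding n_def multiplicative_defect[OF A s less.prems(1)] multiplicative_defect[OF B s less.prems(1)]
        by (simp add: sum_subtractf[symmetric] algebra_simps)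
      also have "\<dots> \<le> (\<Sum>i\<in>{1..<n}. 2 * \<epsilon> * (e i * e (n - i)) * \<omega> s t powr \<theta>)"
      proof (rule order.trans[OF sum_abs], rule sum_mono)
        fix i assume i: "i \<in> {1..<n}"
        have "\<bar>A s u (take i w) - B s u (take i w)\<bar> * \<bar>A u t (drop i w)\<bar> \<le> (\<epsilon> * e i) * e (n - i) * \<omega> s t powr \<theta>"
          using s i IH[OF i] \<epsilon> by (intro prod[where u=u]) (auto simp: mult.assoc intro!: e0 mult_nonneg_nonneg)
        moreover have "\<bar>B s u (take i w)\<bar> * \<bar>A u t (drop i w) - B u t (drop i w)\<bar> \<le> e i * (\<epsilon> * e (n - i)) * \<omega> s t powr \<theta>"
          using s i IH[OF i] \<epsilon> by (intro prod[where u=u]) (auto simp: mult.assoc intro!: e0 mult_nonneg_nonneg)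
        ultimately show "\<bar>(A s u (take i w) - B s u (take i w)) * A u t (drop i w)
            + B s u (take i w) * (A u t (drop i w) - B u t (drop i w))\<bar> \<le> 2 * \<epsilon> * (e i * e (n - i)) * \<omega> s t powr \<theta>"
          using abs_triangle_ineq[of "(A s u (take i w) - B s u (take i w)) * A u t (drop i w)"
            "B s u (take i w) * (A u t (drop i w) - B u t (drop i w))"]
          unfolding abs_mult by (simp add: mult_ac)
      qed
      finally show "\<bar>(A s t w - B s t w) - (A s u w - B s u w) - (A u t w - B u t w)\<bar> \<le> 2 * \<epsilon> * Q * \<omega> s t powr \<theta>"
        by (simp add: Q_def sum_distrib_right sum_distrib_left)
    qed
    also have "(2 * \<epsilon> * Q) * (\<omega> s t powr \<theta> * sew_const \<theta>) = \<epsilon> * (e n * \<omega> s t powr \<theta>)"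
      by (simp add: en)
    finally have 3: "\<bar>A s t w - B s t w\<bar> \<le> \<epsilon> * (e n * \<omega> s t powr \<theta>)" .
    have "Q * (\<omega> s t powr \<theta> * sew_const \<theta>) \<le> e n * \<omega> s t powr \<theta>"
      using Q K by (simp add: en mult_ac)
    moreover have "\<bar>A s t w\<bar> \<le> Q * (\<omega> s t powr \<theta> * sew_const \<theta>)"
      using less.prems Mw by (intro one A IH limA) auto
    moreover have "\<bar>B s t w\<bar> \<le> Q * (\<omega> s t powr \<theta> * sew_const \<theta>)"
      using less.prems Mw by (intro one B IH limB) auto
    ultimately show ?thesis using 3 unfolding e_def n_def \<theta>_def by linarith
  qed
qed

subsection \<open>Partition sums\<close>

definition psum :: "(real \<Rightarrow> real \<Rightarrow> real) \<Rightarrow> real list \<Rightarrow> real" where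
  "psum f ts = (\<Sum>i<length ts - 1. f (ts ! i) (ts ! Suc i))"

lemma psum_Nil [simp]: "psum f [] = 0" and psum_single [simp]: "psum f [x] = 0"
  by (auto simp: psum_def)

lemma psum_Cons [simp]: "psum f (x # y # ys) = f x y + psum f (y # ys)"
  unfolding psum_def by (simp add: sum.lessThan_Suc_shift del: sum.lessThan_Suc)

lemma psum_append: "psum f (xs @ u # ys) = psum f (xs @ [u]) + psum f (u # ys)"
proof (induction xs)
  case (Cons x xs)
  then show ?case by (cases xs) auto
qed simp

lemma partitions_memD:
  assumes "ts \<in> partitions s t" "x \<in> set ts" shows "s \<le> x" "x \<le> t"
proof -
  have ts: "ts \<noteq> []" "sorted_wrt (<) ts" "hd ts = s" "last ts = t" using assms by (auto simp: partitions_def)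
  then show "s \<le> x" using assms(2) by (cases ts) auto
  obtain xs where "ts = xs @ [t]" using ts by (metis append_butlast_last_id)
  then show "x \<le> t" using assms(2) ts by (auto simp: sorted_wrt_append)
qed

lemma partitions_append:
  assumes "xs \<in> partitions s u" "ys \<in> partitions u t"
  shows "\<exists>zs\<in>partitions s t. \<forall>f. psum f zs = psum f xs + psum f ys"
proof -
  obtain a where a: "xs = a @ [u]" using assms(1) by (auto simp: partitions_def) (metis append_butlast_last_id)
  obtain b where b: "ys = u # b" using assms(2) by (auto simp: partitions_def) (metis list.collapse)
  have "a @ u # b \<in> partitions s t"
    using assms unfolding a b partitions_def by (auto simp: sorted_wrt_append hd_append)
      (use dual_order.strict_trans in blast)
  moreover have "psum f (a @ u # b) = psum f xs + psum f ys" for f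
    unfolding a b by (rule psum_append)
  ultimately show ?thesis by blast
qed

lemma partitions_ex: "s \<le> t \<Longrightarrow> \<exists>ts. ts \<in> partitions s t"
  by (rule exI[of _ "if s = t then [s] else [s, t]"]) (auto simp: partitions_def)

lemma psum_nonneg:
  assumes "\<And>u v. u \<in> set ts \<Longrightarrow> v \<in> set ts \<Longrightarrow> 0 \<le> f u v" shows "0 \<le> psum f ts"
  unfolding psum_def by (intro sum_nonneg assms) auto

lemma psum_mono:
  assumes "sorted_wrt (<) ts" "\<And>u v. u \<in> set ts \<Longrightarrow> v \<in> set ts \<Longrightarrow> u < v \<Longrightarrow> f u v \<le> g u v"
  shows "psum f ts \<le> psum g ts"
  unfolding psum_def
proof (intro sum_mono)
  fix i assume "i \<in> {..<length ts - 1}"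
  then show "f (ts ! i) (ts ! Suc i) \<le> g (ts ! i) (ts ! Suc i)"
    using assms by (auto simp: sorted_wrt_iff_nth_less)
qed

lemma partitions_sorted: "ts \<in> partitions s t \<Longrightarrow> sorted_wrt (<) ts"
  by (simp add: partitions_def)

text \<open>A partition of \<open>[s, t]\<close> is completed to one of \<open>[0, T]\<close> by
  partitions of the two remaining intervals, whose sums are nonnegative.\<close>

lemma psum_subinterval_le:
  assumes h: "\<And>s t. 0 \<le> s \<Longrightarrow> s \<le> t \<Longrightarrow> t \<le> T \<Longrightarrow> 0 \<le> h s t"
    and C: "\<And>ts. ts \<in> partitions 0 T \<Longrightarrow> psum h ts \<le> C"
    and st: "0 \<le> s" "s \<le> t" "t \<le> T" and ts: "ts \<in> partitions s t"
  shows "psum h ts \<le> C"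
proof -
  have nn: "0 \<le> psum h xs" if "xs \<in> partitions a b" "0 \<le> a" "b \<le> T" for xs a b
  proof -
    have "psum (\<lambda>_ _. 0) xs \<le> psum h xs"
      using that partitions_memD[OF that(1)] by (intro psum_mono partitions_sorted[OF that(1)] h) force+
    then show ?thesis by (simp add: psum_def)
  qed
  obtain xs zs where x: "xs \<in> partitions 0 s" "zs \<in> partitions t T" using partitions_ex st by metis
  obtain ys where y: "ys \<in> partitions 0 t" "psum h ys = psum h xs + psum h ts"
    using partitions_append[OF x(1) ts] by blast
  obtain us where u: "us \<in> partitions 0 T" "psum h us = psum h ys + psum h zs"
    using partitions_append[OF y(1) x(2)] by blast
  show ?thesis using C[OF u(1)] u(2) y(2) nn[OF x(1)] nn[OF x(2)] st by auto
qed

text \<open>The supremum of the sums over all partitions of \<open>[s, t]\<close> is superadditive,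
  because partitions of adjacent intervals concatenate; the bound \<open>C\<close> keeps it
  finite.\<close>

lemma control_of_partition_sums:
  assumes h: "\<And>s t. 0 \<le> s \<Longrightarrow> s \<le> t \<Longrightarrow> t \<le> T \<Longrightarrow> 0 \<le> h s t"
    and h0: "\<And>s. 0 \<le> s \<Longrightarrow> s \<le> T \<Longrightarrow> h s s = 0"
    and C: "\<And>ts. ts \<in> partitions 0 T \<Longrightarrow> psum h ts \<le> C"
  obtains \<omega> where "control T \<omega>" "\<And>s t. 0 \<le> s \<Longrightarrow> s \<le> t \<Longrightarrow> t \<le> T \<Longrightarrow> h s t \<le> \<omega> s t"
    "\<And>s t. 0 \<le> s \<Longrightarrow> s \<le> t \<Longrightarrow> t \<le> T \<Longrightarrow> \<omega> s t \<le> C"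
proof
  define \<omega> where "\<omega> s t = (SUP ts\<in>partitions s t. psum h ts)" for s t
  have bdd: "bdd_above (psum h ` partitions s t)" if "0 \<le> s" "s \<le> t" "t \<le> T" for s t
    using psum_subinterval_le[OF h C that] by (intro bdd_aboveI2) auto
  have ne: "partitions s t \<noteq> {}" if "s \<le> t" for s t using partitions_ex[OF that] by auto
  show le: "h s t \<le> \<omega> s t" if "0 \<le> s" "s \<le> t" "t \<le> T" for s t
  proof -
    \<comment> \<open>Partitions are strictly increasing, so a degenerate interval has only the
      partition \<open>[s]\<close> with sum \<open>0\<close>; this is where \<open>h0\<close>
      enters.\<close>
    have "(if s = t then [s] else [s,t]) \<in> partitions s t" using that by (auto simp: partitions_def)
    then have "psum h (if s = t then [s] else [s,t]) \<le> \<omega> s t"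
      unfolding \<omega>_def by (rule cSUP_upper) (rule bdd[OF that])
    then show ?thesis using h0[of s] that by (auto split: if_splits)
  qed
  show "\<omega> s t \<le> C" if "0 \<le> s" "s \<le> t" "t \<le> T" for s t
    unfolding \<omega>_def using ne[OF that(2)] psum_subinterval_le[OF h C that] by (intro cSUP_least) auto
  show "control T \<omega>"
    unfolding control_def
  proof (intro conjI allI impI)
    show "0 \<le> \<omega> s t" if "0 \<le> s \<and> s \<le> t \<and> t \<le> T" for s t
      using le[of s t] h[of s t] that by auto
    fix s u t assume s: "0 \<le> s \<and> s \<le> u \<and> u \<le> t \<and> t \<le> T"
    have *: "psum h xs + psum h ys \<le> \<omega> s t" if xy: "xs \<in> partitions s u" "ys \<in> partitions u t" for xs ys
    proof -
      obtain zs where zs: "zs \<in> partitions s t" "psum h zs = psum h xs + psum h ys"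
        using partitions_append[OF xy] by blast
      show ?thesis unfolding zs(2)[symmetric] \<omega>_def using s by (intro cSUP_upper zs bdd) auto
    qed
    have "\<omega> s u \<le> \<omega> s t - psum h ys" if "ys \<in> partitions u t" for ys
      unfolding \<omega>_def[of s u] using s ne *[OF _ that] by (intro cSUP_least) (auto simp: algebra_simps)
    then have "\<omega> u t \<le> \<omega> s t - \<omega> s u"
      unfolding \<omega>_def[of u t] using s ne by (intro cSUP_least) (force simp: algebra_simps)+
    then show "\<omega> s u + \<omega> u t \<le> \<omega> s t" by simp
  qed
qed

lemma control_psum:
  assumes c: "control T \<omega>" and ts: "ts \<in> partitions s t" and st: "0 \<le> s" "t \<le> T"
  shows "psum \<omega> ts \<le> \<omega> s t"
proof -
  have "psum \<omega> (x # xs) \<le> \<omega> x (last (x # xs))"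
    if "sorted_wrt (<) (x # xs)" "0 \<le> x" "last (x # xs) \<le> T" for x xs
    using that
  proof (induction xs arbitrary: x)
    case Nil
    then show ?case using control_nonneg[OF c, of x x] by simp
  next
    case (Cons y ys)
    have y: "x < y" "y \<le> last (y # ys)"
      using Cons.prems(1) last_in_set[of "y # ys"] by (auto simp del: last_in_set split: if_splits) 
    have "psum \<omega> (y # ys) \<le> \<omega> y (last (y # ys))" using Cons y by (intro Cons.IH) auto
    then show ?case using control_superadd[OF c, of x y "last (y # ys)"] Cons.prems y by auto
  qed
  moreover obtain x xs where "ts = x # xs" using ts by (cases ts) (auto simp: partitions_def)
  ultimately show ?thesis using ts st by (auto simp: partitions_def)
qed

subsection \<open>Level norms and variation\<close>

lemma words_nonempty: "{w::'a list. length w = k} \<noteq> {}"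
  using Ex_list_of_length by auto

lemma abs_le_level_norm: "length w = k \<Longrightarrow> \<bar>a w\<bar> \<le> level_norm k a" for a :: "'a::finite tensor"
  unfolding level_norm_def by (intro Max_ge) auto

lemma level_norm_attained:
  fixes a :: "'a::finite tensor"
  obtains w where "length w = k" "level_norm k a = \<bar>a w\<bar>"
proof -
  have "level_norm k a \<in> (\<lambda>w. \<bar>a w\<bar>) ` {w. length w = k}"
    unfolding level_norm_def using words_nonempty by (intro Max_in) auto
  then show ?thesis using that by auto
qed

lemma level_norm_nonneg: "0 \<le> level_norm k a" for a :: "'a::finite tensor"
  by (metis level_norm_attained abs_ge_zero)

lemma level_norm_cong: "(\<And>w. length w = k \<Longrightarrow> a w = b w) \<Longrightarrow> level_norm k a = level_norm k b"
  unfolding level_norm_def by (intro arg_cong[where f=Max] image_cong) auto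

lemma level_norm_triangle:
  fixes a b c :: "'a::finite tensor"
  assumes "\<And>w. length w = k \<Longrightarrow> \<bar>a w\<bar> \<le> \<bar>b w\<bar> + \<bar>c w\<bar>"
  shows "level_norm k a \<le> level_norm k b + level_norm k c"
proof -
  obtain w where w: "length w = k" "level_norm k a = \<bar>a w\<bar>" by (rule level_norm_attained)
  show ?thesis using assms[OF w(1)] abs_le_level_norm[OF w(1), of b] abs_le_level_norm[OF w(1), of c] w(2) by linarith
qed

text \<open>From \<open>x <= 2 * max y z\<close>. It replaces the triangle inequality for sums of
  \<open>q\<close>-th powers.\<close>

lemma powr_add_le:
  fixes x y z q :: real
  assumes "0 \<le> x" "0 \<le> y" "0 \<le> z" "x \<le> y + z" "0 \<le> q"
  shows "x powr q \<le> 2 powr q * (y powr q + z powr q)"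
proof -
  have "x powr q \<le> (2 * max y z) powr q" using assms by (intro powr_mono2) auto
  also have "\<dots> = 2 powr q * max y z powr q" using assms by (simp add: powr_mult)
  also have "\<dots> \<le> 2 powr q * (y powr q + z powr q)" by (auto simp: max_def)
  finally show ?thesis .
qed

lemma level_norm_powr_le_sum:
  fixes a :: "'a::finite tensor"
  shows "level_norm k a powr q \<le> (\<Sum>w | length w = k. \<bar>a w\<bar> powr q)"
proof -
  obtain w where w: "length w = k" "level_norm k a = \<bar>a w\<bar>" by (rule level_norm_attained)
  show ?thesis unfolding w(2) by (rule member_le_sum) (use w in auto)
qed

text \<open>Leaves the extended reals and undoes the root \<open>k / p\<close> in
  \<open>pvar\<close>: the control is built from plain partition sums, which are superadditive,
  whereas their roots need not be.\<close>

lemma pvar_psum_le: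
  fixes A :: "real \<Rightarrow> real \<Rightarrow> 'a::finite tensor"
  assumes "pvar p N s t A \<le> ennreal c" "0 \<le> c" "0 < p" "k \<in> {1..N}" "ts \<in> partitions s t"
  shows "psum (\<lambda>u v. level_norm k (A u v) powr (p / real k)) ts \<le> c powr (p / real k)"
proof -
  define S where "S = psum (\<lambda>u v. level_norm k (A u v) powr (p / real k)) ts"
  have S: "S \<ge> 0" unfolding S_def by (intro psum_nonneg) simp
  have k: "real k > 0" using assms by auto
  have "ennreal (S powr (real k / p)) \<le> pvar p N s t A"
    unfolding pvar_def S_def psum_def
    by (rule SUP_upper2[OF assms(4)], rule SUP_upper2[OF assms(5)]) simp
  then have "ennreal (S powr (real k / p)) \<le> ennreal c" using assms(1) by (rule order.trans)
  then have "S powr (real k / p) \<le> c" using assms(2) by (simp add: ennreal_le_iff)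
  then have "(S powr (real k / p)) powr (p / real k) \<le> c powr (p / real k)"
    using assms k by (intro powr_mono2) auto
  also have "(S powr (real k / p)) powr (p / real k) = S"
    using S assms(3) k by (simp add: powr_powr)
  finally show ?thesis by (simp add: S_def)
qed

lemma pvar_finiteI:
  assumes "\<And>k. k \<in> {1..N} \<Longrightarrow> \<exists>c. \<forall>ts\<in>partitions s t. psum (\<lambda>u v. level_norm k (A u v) powr (p / real k)) ts \<le> c"
    and "0 < p"
  shows "pvar p N s t (A :: real \<Rightarrow> real \<Rightarrow> 'a::finite tensor) < \<infinity>"
proof -
  obtain c where c: "\<And>k ts. k \<in> {1..N} \<Longrightarrow> ts \<in> partitions s t \<Longrightarrow> psum (\<lambda>u v. level_norm k (A u v) powr (p / real k)) ts \<le> c k"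
    using assms(1) by metis
  have nn: "0 \<le> psum (\<lambda>u v. level_norm k (A u v) powr (p / real k)) ts" for k ts
    by (intro psum_nonneg) simp
  define b where "b = (\<Sum>k\<in>{1..N}. \<bar>c k\<bar> powr (real k / p))"
  have "pvar p N s t A \<le> ennreal b"
    unfolding pvar_def
  proof (intro SUP_least ennreal_leI)
    fix k ts assume k: "k \<in> {1..N}" "ts \<in> partitions s t"
    have "psum (\<lambda>u v. level_norm k (A u v) powr (p / real k)) ts powr (real k / p) \<le> \<bar>c k\<bar> powr (real k / p)"
      using c[OF k] nn[of k ts] assms(2) by (intro powr_mono2) auto
    also have "\<dots> \<le> b" unfolding b_def by (rule member_le_sum) (use k in auto)
    finally show "(\<Sum>i<length ts - 1. level_norm k (A (ts ! i) (ts ! Suc i)) powr (p / real k)) powr (real k / p) \<le> b"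
      by (simp add: psum_def)
  qed
  then show ?thesis by (rule le_less_trans) simp
qed

subsection \<open>Signatures of piecewise smooth paths\<close>

text \<open>Off the finite set \<open>F\<close> of break points the coordinates have a continuous
  derivative bounded by \<open>L\<close>. On \<open>F\<close> and at the end points nothing is known
  about \<open>deriv\<close>, so integrals below are modified on a finite set or restricted to the
  complement.\<close>

locale piecewise_C1 =
  fixes T :: real and z :: "real \<Rightarrow> real ^ 'a" and F :: "real set" and L :: real
  assumes T: "T > 0" and F: "finite F" and L: "L \<ge> 0"
    and cont: "continuous_on {0..T} (\<lambda>t. z t $ i)"
    and der: "t \<in> {0<..<T} - F \<Longrightarrow> ((\<lambda>r. z r $ i) has_real_derivative deriv (\<lambda>r. z r $ i) t) (at t)"
    and bnd: "t \<in> {0<..<T} - F \<Longrightarrow> \<bar>deriv (\<lambda>r. z r $ i) t\<bar> \<le> L"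
    and cder: "t \<in> {0<..<T} - F \<Longrightarrow> isCont (deriv (\<lambda>r. z r $ i)) t"
begin

abbreviation v :: "'a \<Rightarrow> real \<Rightarrow> real" where "v i \<equiv> deriv (\<lambda>r. z r $ i)"

abbreviation sig :: "real \<Rightarrow> 'a list \<Rightarrow> real" where "sig \<equiv> smooth_sig z"

text \<open>\<open>v i\<close> is integrable by the fundamental theorem of calculus. Set to
  \<open>0\<close> on the exceptional points it is bounded by \<open>L\<close>, hence absolutely
  integrable, and so is its product with a continuous function.\<close>

lemma integrable_mult_v:
  assumes f: "continuous_on {0..T} f"
  shows "(\<lambda>s. f s * v i s) integrable_on {0..T}"
proof -
  define v' where "v' t = (if t \<in> insert 0 (insert T F) then 0 else v i t)" for t
  have "(v i has_integral (z T $ i - z 0 $ i)) {0..T}"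
    using T F cont der
    by (intro fundamental_theorem_of_calculus_interior_strong[of F])
       (auto simp: has_real_derivative_iff_has_vector_derivative[symmetric])
  then have "v i integrable_on {0..T}" by blast
  then have "v' integrable_on {0..T}"
    by (rule integrable_spike_finite[of "insert 0 (insert T F)", rotated 2]) (use F in \<open>auto simp: v'_def\<close>)
  then have v': "v' absolutely_integrable_on {0..T}"
    by (rule absolutely_integrable_integrable_bound[rotated, where g="\<lambda>_. L"])
       (use bnd L in \<open>auto simp: v'_def integrable_on_const\<close>)
  have "(\<lambda>s. f s * v' s) absolutely_integrable_on {0..T}"
    using f by (intro absolutely_integrable_bounded_measurable_product_real v'
        continuous_imp_measurable_on_sets_lebesgue compact_imp_bounded compact_continuous_image) auto
  then have "(\<lambda>s. f s * v' s) integrable_on {0..T}" by (simp add: absolutely_integrable_on_def)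
  then show ?thesis
    by (rule integrable_spike_finite[of "insert 0 (insert T F)", rotated 2]) (use F in \<open>auto simp: v'_def\<close>)
qed

lemma sig_Nil [simp]: "sig t [] = 1"
  by (simp add: smooth_sig.simps)

lemma sig_snoc: "sig t (w @ [i]) = integral {0..t} (\<lambda>s. sig s w * v i s)"
  by (subst smooth_sig.simps) simp

lemma sig_continuous: "continuous_on {0..T} (\<lambda>t. sig t w)"
proof (induction w rule: rev_induct)
  case (snoc i w)
  show ?case unfolding sig_snoc
    by (rule indefinite_integral_continuous_1[OF integrable_mult_v[OF snoc]])
qed simp

lemma sig_0: "w \<noteq> [] \<Longrightarrow> sig 0 w = 0"
  by (cases w rule: rev_cases) (auto simp: sig_snoc)

lemma sig_0_tone: "sig 0 = tone"
  by (auto simp: tone_def sig_0 fun_eq_iff)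

lemma sig_deriv:
  assumes t: "t \<in> {0<..<T} - F"
  shows "((\<lambda>t. sig t (w @ [i])) has_vector_derivative sig t w * v i t) (at t)"
proof -
  have op: "open ({0<..<T} - F)" using F by (intro open_Diff finite_imp_closed) auto
  have at: "at t within ({0..T} - ({0,T} \<union> F)) = at t"
  proof -
    have "{0..T} - ({0,T} \<union> F) = {0<..<T} - F" by auto
    then show ?thesis using at_within_open[OF t op] by simp
  qed
  have "continuous_on ({0<..<T} - F) (\<lambda>t. sig t w)"
    by (rule continuous_on_subset[OF sig_continuous]) auto
  then have "isCont (\<lambda>t. sig t w) t" using op t by (simp add: continuous_on_eq_continuous_at)
  then have "continuous (at t within ({0..T} - ({0,T} \<union> F))) (\<lambda>s. sig s w * v i s)"
    unfolding at by (intro continuous_mult cder t)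
  then have "((\<lambda>u. integral {0..u} (\<lambda>s. sig s w * v i s)) has_vector_derivative sig t w * v i t) (at t within ({0..T} - ({0,T} \<union> F)))"
    by (intro integral_has_vector_derivative_continuous_at integrable_mult_v sig_continuous)
       (use t F in auto)
  then show ?thesis unfolding at sig_snoc .
qed

lemma sig_zero_derivative:
  fixes f :: "real \<Rightarrow> real"
  assumes "continuous_on {0..T} f" "f 0 = 0"
    and "\<And>t. t \<in> {0<..<T} - F \<Longrightarrow> (f has_vector_derivative 0) (at t)" and t: "t \<in> {0..T}"
  shows "f t = 0"
proof -
  have "((\<lambda>_. 0) has_integral (f t - f 0)) {0..t}"
    using assms F by (intro fundamental_theorem_of_calculus_interior_strong[of F])
      (auto intro: continuous_on_subset)
  then show ?thesis using assms(2) has_integral_unique has_integral_0 by fastforce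
qed

lemma continuous_on_sum_mset:
  assumes "\<And>u. u \<in># M \<Longrightarrow> continuous_on S (\<lambda>t. f t u :: real)"
  shows "continuous_on S (\<lambda>t. \<Sum>u\<in>#M. f t u)"
  using assms by (induction M) (auto intro!: continuous_intros)

lemma has_vector_derivative_sum_mset:
  assumes "\<And>u. u \<in># M \<Longrightarrow> ((\<lambda>t. f t u :: real) has_vector_derivative g u) (at t)"
  shows "((\<lambda>t. \<Sum>u\<in>#M. f t u) has_vector_derivative (\<Sum>u\<in>#M. g u)) (at t)"
  using assms by (induction M) (auto intro!: has_vector_derivative_add)

text \<open>Both sides agree at time \<open>0\<close> and have the same derivative off
  \<open>F\<close>: the two terms of the product rule match the two terms of the last-letter
  recursion, with the induction hypothesis applied to the shortened words.\<close>

lemma sig_shuffle: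
  assumes "t \<in> {0..T}"
  shows "sig t w * sig t w' = (\<Sum>u\<in>#shuffle_word w w'. sig t u)"
  using assms
proof (induction "length w + length w'" arbitrary: w w' t rule: less_induct)
  case less
  show ?case
  proof (cases "w = [] \<or> w' = []")
    case True
    then show ?thesis by (auto simp: shuffle_word_empty)
  next
    case False
    then obtain x i y j where w: "w = x @ [i]" "w' = y @ [j]" by (metis rev_exhaust)
    define f where "f t = sig t w * sig t w' - (\<Sum>u\<in>#shuffle_word w w'. sig t u)" for t
    have "f t = 0"
    proof (rule sig_zero_derivative[OF _ _ _ less.prems])
      show "continuous_on {0..T} f"
        unfolding f_def by (intro continuous_intros continuous_on_sum_mset sig_continuous)
      have "(\<Sum>u\<in>#shuffle_word w w'. sig 0 u) = (\<Sum>u\<in>#shuffle_word w w'. 0)"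
        using False by (intro arg_cong[where f=sum_mset] image_mset_cong sig_0)
          (auto dest: shuffle_word_length)
      then show "f 0 = 0" using False by (simp add: f_def sig_0)
    next
      fix t assume t: "t \<in> {0<..<T} - F"
      have IH: "sig t x * sig t w' = (\<Sum>u\<in>#shuffle_word x w'. sig t u)"
         "sig t w * sig t y = (\<Sum>u\<in>#shuffle_word w y. sig t u)"
        using t by (auto intro!: less.hyps simp: w)
      have "(f has_vector_derivative ((sig t w * (sig t y * v j t) + (sig t x * v i t) * sig t w')
         - ((\<Sum>u\<in>#shuffle_word w y. sig t u * v j t) + (\<Sum>u\<in>#shuffle_word x w'. sig t u * v i t)))) (at t)"
        unfolding f_def w shuffle_word_snoc image_mset_union sum_mset.union image_mset.compositionality o_def
        by (intro has_vector_derivative_diff has_vector_derivative_add has_vector_derivative_sum_mset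
            has_vector_derivative_mult sig_deriv t)
      also have "(\<Sum>u\<in>#shuffle_word w y. sig t u * v j t) = sig t w * sig t y * v j t"
        by (simp add: IH sum_mset_distrib_right)
      also have "(\<Sum>u\<in>#shuffle_word x w'. sig t u * v i t) = sig t x * sig t w' * v i t"
        by (simp add: IH sum_mset_distrib_right)
      finally show "(f has_vector_derivative 0) (at t)" by (simp add: algebra_simps)
    qed
    then show ?thesis by (simp add: f_def)
  qed
qed

lemma sig_character: "t \<in> {0..T} \<Longrightarrow> character (sig t)"
  by (simp add: character_def sig_shuffle)

text \<open>For fixed \<open>s\<close> the factor \<open>antip (sig s)\<close> is constant, so
  increments solve the same linear equation in \<open>t\<close> as the signature.\<close>

lemma incr_sig_deriv:
  assumes t: "t \<in> {0<..<T} - F"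
  shows "((\<lambda>t. incr sig s t (w @ [i])) has_vector_derivative incr sig s t w * v i t) (at t)"
proof -
  define a where "a = antip (sig s)"
  have eq: "incr sig s t (w @ [i]) = (\<Sum>j\<le>length w. a (take j w) * sig t (drop j w @ [i])) + a (w @ [i])" for t
    unfolding incr_def tmult_def a_def by simp
  have "((\<lambda>t. incr sig s t (w @ [i])) has_vector_derivative (\<Sum>j\<le>length w. a (take j w) * (sig t (drop j w) * v i t)) + 0) (at t)"
    unfolding eq
    by (intro has_vector_derivative_add has_vector_derivative_sum has_vector_derivative_mult_right sig_deriv t
        has_vector_derivative_const)
  also have "(\<Sum>j\<le>length w. a (take j w) * (sig t (drop j w) * v i t)) + 0 = incr sig s t w * v i t"
    by (simp add: incr_def tmult_def a_def sum_distrib_right mult.assoc)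
  finally show ?thesis .
qed

lemma incr_sig_continuous: "continuous_on {0..T} (\<lambda>t. incr sig s t w)"
  unfolding incr_def tmult_def by (intro continuous_intros sig_continuous)

text \<open>Each further letter integrates the previous bound against a derivative of size at most
  \<open>L\<close>. Bounding the shorter word by its value at \<open>t\<close> loses the factorial
  but keeps the power of \<open>t - s\<close>.\<close>

lemma incr_sig_bound:
  assumes "0 \<le> s" "s \<le> t" "t \<le> T"
  shows "\<bar>incr sig s t w\<bar> \<le> (L * (t - s)) ^ length w"
  using assms(2,3)
proof (induction w arbitrary: t rule: rev_induct)
  case Nil
  have "character (sig s)" "character (sig t)" using sig_character assms Nil by auto
  then show ?case by (simp add: incr_def tmult_def antip_def character_Nil)
next
  case (snoc i w)
  have "((\<lambda>r. incr sig s r w * v i r) has_integral (incr sig s t (w @ [i]) - incr sig s s (w @ [i]))) {s..t}"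
    using snoc.prems assms(1) F
    by (intro fundamental_theorem_of_calculus_interior_strong[of F] incr_sig_deriv)
       (auto intro!: continuous_on_subset[OF incr_sig_continuous])
  also have "incr sig s s (w @ [i]) = 0"
    using assms snoc.prems by (simp add: incr_same sig_character tone_def)
  finally have *: "((\<lambda>r. incr sig s r w * v i r) has_integral incr sig s t (w @ [i])) {s..t}" by simp
  have "norm (incr sig s t (w @ [i])) \<le> ((L * (t - s)) ^ length w * L) * measure lborel {s..t}"
  proof (rule has_integral_bound_real[OF _ _ *])
    show "0 \<le> (L * (t - s)) ^ length w * L" using L snoc.prems by auto
    show "finite (insert 0 (insert T F))" using F by simp
    fix r assume r: "r \<in> {s..t} - insert 0 (insert T F)"
    have "\<bar>incr sig s r w\<bar> \<le> (L * (r - s)) ^ length w" using r snoc.prems by (intro snoc.IH) auto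
    also have "\<dots> \<le> (L * (t - s)) ^ length w" using r L by (intro power_mono mult_left_mono) auto
    finally show "norm (incr sig s r w * v i r) \<le> (L * (t - s)) ^ length w * L"
      using r snoc.prems assms(1) L unfolding real_norm_def abs_mult by (intro mult_mono bnd) auto
  qed
  then show ?case using snoc.prems by (simp add: mult_ac)
qed

end

lemma smooth_piece:
  fixes f :: "real \<Rightarrow> 'b::real_normed_vector"
  assumes "smooth_on_interval a b f"
  obtains f' where "continuous_on {a..b} f" "continuous_on {a..b} f'"
    "\<And>t. t \<in> {a<..<b} \<Longrightarrow> (f has_vector_derivative f' t) (at t)"
proof -
  obtain D :: "nat \<Rightarrow> real \<Rightarrow> 'b" where D: "\<And>t. t \<in> {a..b} \<Longrightarrow> D 0 t = f t"
     "\<And>n t. t \<in> {a..b} \<Longrightarrow> (D n has_vector_derivative D (Suc n) t) (at t within {a..b})"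
    using assms unfolding smooth_on_interval_def by blast
  have c: "continuous_on {a..b} (D n)" for n
    using D(2) by (meson has_vector_derivative_continuous continuous_on_eq_continuous_within)
  show thesis
  proof
    show "continuous_on {a..b} f" using c[of 0] by (rule continuous_on_eq) (rule D(1))
    show "continuous_on {a..b} (D 1)" by (rule c)
    show "(f has_vector_derivative D 1 t) (at t)" if t: "t \<in> {a<..<b}" for t
    proof (rule has_vector_derivative_transform_within_open[of "D 0" _ _ "{a<..<b}"])
      show "(D 0 has_vector_derivative D 1 t) (at t)"
        using D(2)[of t 0] t by (simp add: at_within_Icc_at)
    qed (use t D(1) in auto)
  qed
qed

lemma sorted_list_interval:
  assumes "sorted_wrt (<) ts" "ts \<noteq> []" "hd ts < t" "t < last ts" "t \<notin> set (ts :: real list)"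
  shows "\<exists>i. Suc i < length ts \<and> ts ! i < t \<and> t < ts ! Suc i"
  using assms
proof (induction ts)
  case (Cons x xs)
  show ?case
  proof (cases xs)
    case Nil
    then show ?thesis using Cons by simp
  next
    case (Cons y ys)
    show ?thesis
    proof (cases "t < y")
      case True
      then show ?thesis using Cons.prems \<open>xs = y # ys\<close> by (intro exI[of _ 0]) auto
    next
      case False
      have "\<exists>i. Suc i < length xs \<and> xs ! i < t \<and> t < xs ! Suc i"
        using Cons.prems False by (intro Cons.IH) (auto simp: \<open>xs = y # ys\<close>)
      then show ?thesis by (metis Suc_less_eq length_Cons nth_Cons_Suc)
    qed
  qed
qed simp

lemma piecewise_smooth_time_aug:
  fixes x :: "real \<Rightarrow> real ^ 'd"
  assumes T: "T > 0" and x: "piecewise_smooth T x"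
  obtains F L where "piecewise_C1 T (time_aug x) F L"
proof -
  obtain ts where ts: "ts \<in> partitions 0 T" "\<And>i. Suc i < length ts \<Longrightarrow> smooth_on_interval (ts ! i) (ts ! Suc i) x"
    using x by (auto simp: piecewise_smooth_def)
  have "\<exists>f'. continuous_on {ts ! i..ts ! Suc i} x \<and> continuous_on {ts ! i..ts ! Suc i} f' \<and>
     (\<forall>t\<in>{ts ! i<..<ts ! Suc i}. (x has_vector_derivative f' t) (at t))" if "Suc i < length ts" for i
    using smooth_piece[OF ts(2)[OF that]] by (metis (no_types, lifting))
  then obtain f' where f': "\<And>i. Suc i < length ts \<Longrightarrow> continuous_on {ts ! i..ts ! Suc i} x"
    "\<And>i. Suc i < length ts \<Longrightarrow> continuous_on {ts ! i..ts ! Suc i} (f' i)"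
    "\<And>i t. Suc i < length ts \<Longrightarrow> t \<in> {ts ! i<..<ts ! Suc i} \<Longrightarrow> (x has_vector_derivative f' i t) (at t)"
    by metis
  have "\<exists>B. \<forall>t\<in>{ts ! i..ts ! Suc i}. norm (f' i t) \<le> B" if "Suc i < length ts" for i
    using compact_imp_bounded[OF compact_continuous_image[OF f'(2)[OF that]]] by (auto simp: bounded_iff)
  then obtain B where B: "\<And>i t. Suc i < length ts \<Longrightarrow> t \<in> {ts ! i..ts ! Suc i} \<Longrightarrow> norm (f' i t) \<le> B i" by metis
  \<comment> \<open>The summand \<open>1\<close> covers the time coordinate, whose derivative is
    \<open>1\<close>.\<close>
  define L where "L = 1 + (\<Sum>i<length ts. \<bar>B i\<bar>)"
  have L: "1 \<le> L" unfolding L_def by (simp add: sum_nonneg)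
  have BL: "\<bar>B i\<bar> \<le> L" if "Suc i < length ts" for i
    unfolding L_def using that member_le_sum[of i "{..<length ts}" "\<lambda>i. \<bar>B i\<bar>"] by simp
  have tsp: "sorted_wrt (<) ts" "ts \<noteq> []" "hd ts = 0" "last ts = T" using ts(1) by (auto simp: partitions_def)
  have cx: "continuous_on {0..T} x"
  proof -
    have sub: "{0..T} \<subseteq> (\<Union>i\<in>{i. Suc i < length ts}. {ts ! i..ts ! Suc i})"
    proof
      fix t assume t: "t \<in> {0..T}"
      show "t \<in> (\<Union>i\<in>{i. Suc i < length ts}. {ts ! i..ts ! Suc i})"
      proof (cases "t \<in> set ts")
        case True
        then obtain k where k: "k < length ts" "t = ts ! k" by (auto simp: in_set_conv_nth)
        have len: "length ts > 1"
        proof (rule ccontr)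
          assume "\<not> length ts > 1"
          then obtain a where "ts = [a]" using tsp(2) by (cases ts) auto
          then show False using tsp T by simp
        qed
        have mono: "ts ! i \<le> ts ! Suc i" if "Suc i < length ts" for i
          using tsp(1) that by (auto simp: sorted_wrt_iff_nth_less less_imp_le)
        show ?thesis
        proof (cases "Suc k < length ts")
          case True
          then show ?thesis using k mono[of k] by auto
        next
          case False
          then have "Suc (k - 1) = k" using len k by auto
          then show ?thesis using k mono[of "k-1"] by (intro UN_I[of "k-1"]) auto
        qed
      next
        case False
        then have "hd ts < t" "t < last ts" using t tsp hd_in_set[of ts] last_in_set[of ts] by (fastforce simp: less_le)+
        from sorted_list_interval[OF tsp(1,2) this False] show ?thesis by force
      qed
    qed
    have "finite {i. Suc i < length ts}" by (rule finite_subset[of _ "{..length ts}"]) auto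
    then have "continuous_on (\<Union>i\<in>{i. Suc i < length ts}. {ts ! i..ts ! Suc i}) x"
      by (intro continuous_on_closed_Union) (auto intro: f')
    then show ?thesis by (rule continuous_on_subset[OF _ sub])
  qed
  \<comment> \<open>A local representative \<open>g\<close> of the derivative. Since
    \<open>deriv\<close> coincides with \<open>g\<close> on a neighbourhood \<open>U\<close>, its
    continuity and its bound can be read off from \<open>g\<close>.\<close>
  have key: "\<exists>g U. open U \<and> t \<in> U \<and> isCont g t \<and> \<bar>g t\<bar> \<le> L \<and>
     (\<forall>s\<in>U. ((\<lambda>r. time_aug x r $ i) has_real_derivative g s) (at s))" if t: "t \<in> {0<..<T} - set ts" for t i
  proof (cases i)
    case None
    then show ?thesis using L
      by (intro exI[of _ "\<lambda>_. 1"] exI[of _ UNIV]) (auto simp: time_aug_def)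
  next
    case (Some j)
    obtain k where k: "Suc k < length ts" "ts ! k < t" "t < ts ! Suc k"
      using sorted_list_interval[of ts t] tsp t by auto
    show ?thesis
    proof (rule exI[of _ "\<lambda>s. f' k s $ j"], rule exI[of _ "{ts ! k<..<ts ! Suc k}"], intro conjI ballI)
      have "continuous_on {ts ! k<..<ts ! Suc k} (f' k)"
        by (rule continuous_on_subset[OF f'(2)[OF k(1)]]) auto
      then have "isCont (f' k) t" using k by (simp add: continuous_on_eq_continuous_at)
      then show "isCont (\<lambda>s. f' k s $ j) t" by (rule bounded_linear.isCont[OF bounded_linear_vec_nth])
      have "\<bar>f' k t $ j\<bar> \<le> norm (f' k t)" by (rule component_le_norm_cart)
      also have "\<dots> \<le> L" using B[OF k(1), of t] BL[OF k(1)] k by auto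
      finally show "\<bar>f' k t $ j\<bar> \<le> L" .
      fix s assume "s \<in> {ts ! k<..<ts ! Suc k}"
      then have "(x has_vector_derivative f' k s) (at s)" by (rule f'(3)[OF k(1)])
      then show "((\<lambda>r. time_aug x r $ i) has_real_derivative f' k s $ j) (at s)"
        using bounded_linear.has_vector_derivative[OF bounded_linear_vec_nth[of j]]
        by (simp add: time_aug_def Some has_real_derivative_iff_has_vector_derivative)
    qed (use k in auto)
  qed
  have "piecewise_C1 T (time_aug x) (set ts) L"
  proof
    show "continuous_on {0..T} (\<lambda>t. time_aug x t $ i)" for i
      by (cases i) (auto simp: time_aug_def intro!: continuous_intros cx)
    fix t i assume "t \<in> {0<..<T} - set ts"
    from key[OF this, of i] obtain g U where g: "open U" "t \<in> U" "isCont g t" "\<bar>g t\<bar> \<le> L"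
      "\<And>s. s \<in> U \<Longrightarrow> ((\<lambda>r. time_aug x r $ i) has_real_derivative g s) (at s)" by blast
    have e: "deriv (\<lambda>r. time_aug x r $ i) s = g s" if "s \<in> U" for s by (rule DERIV_imp_deriv[OF g(5)[OF that]])
    show "((\<lambda>r. time_aug x r $ i) has_real_derivative deriv (\<lambda>r. time_aug x r $ i) t) (at t)"
      using g(5)[OF g(2)] e[OF g(2)] by simp
    show "\<bar>deriv (\<lambda>r. time_aug x r $ i) t\<bar> \<le> L" using g e by simp
    have "eventually (\<lambda>s. deriv (\<lambda>r. time_aug x r $ i) s = g s) (nhds t)"
      using g(1,2) e by (auto simp: eventually_nhds)
    then show "isCont (deriv (\<lambda>r. time_aug x r $ i)) t" using g(3) by (simp add: isCont_cong)
  qed (use T L in auto)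
  then show thesis by (rule that)
qed

text \<open>The time coordinate has derivative \<open>1\<close>. This identity survives the passage
  to the limit and turns the cumulative hazard into a linear functional of the signature.\<close>

lemma smooth_sig_snoc_None:
  "smooth_sig (time_aug x) t (w @ [None]) = integral {0..t} (\<lambda>s. smooth_sig (time_aug x) s w)"
proof -
  have "(\<lambda>r. time_aug x r $ None) = (\<lambda>r. r)" by (simp add: time_aug_def)
  then show ?thesis by (subst smooth_sig.simps) simp
qed

subsection \<open>Lyons lifts\<close>

lemma level_bounds: assumes "p \<ge> 1" shows "real (level p) \<le> p" "p < real (Suc (level p))" "1 \<le> level p"
  using assms unfolding level_def by linarith+

lemma psum_sum: "psum (\<lambda>u v. \<Sum>k\<in>K. f k u v) ts = (\<Sum>k\<in>K. psum (f k) ts)"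
  unfolding psum_def by (rule sum.swap)

lemma psum_add: "psum (\<lambda>u v. f u v + g u v) ts = psum f ts + psum g ts"
  unfolding psum_def by (rule sum.distrib)

lemma psum_divide: "psum (\<lambda>u v. f u v / c) ts = psum f ts / c"
  unfolding psum_def by (simp add: sum_divide_distrib)

lemma psum_cmult: "psum (\<lambda>u v. c * f u v) ts = c * psum f ts"
  unfolding psum_def by (simp add: sum_distrib_left)

lemma multiplicative_incr: "(\<And>t. t \<in> {0..T} \<Longrightarrow> character (S t)) \<Longrightarrow> multiplicative T (incr S)"
  unfolding multiplicative_def
  by (auto simp: incr_Chen) (simp add: incr_def tmult_def antip_def character_Nil)

lemma level_norm_tone: "k \<ge> 1 \<Longrightarrow> level_norm k (tone :: 'a::finite tensor) = 0"
  by (rule level_norm_attained[of k "tone :: 'a tensor"]) (auto simp: tone_def)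

text \<open>A single control dominates both paths and their difference: the difference is first
  divided by \<epsilon>, so that at each of the \<open>M\<close> levels three quantities have
  partition sums at most \<open>C\<close>, hence the total \<open>3 * M * C\<close>. Extension then
  returns the factor \<epsilon> at every level.\<close>

lemma variation_estimate:
  fixes S1 S2 :: "real \<Rightarrow> 'a::finite tensor"
  assumes p: "p \<ge> 1" and \<epsilon>: "\<epsilon> > 0" and M: "M = level p"
    and ch: "\<And>t. t \<in> {0..T} \<Longrightarrow> character (S1 t)" "\<And>t. t \<in> {0..T} \<Longrightarrow> character (S2 t)"
    and V1: "\<And>k ts. k \<in> {1..M} \<Longrightarrow> ts \<in> partitions 0 T \<Longrightarrow>
       psum (\<lambda>u v. level_norm k (incr S1 u v) powr (p / real k)) ts \<le> C"
    and V2: "\<And>k ts. k \<in> {1..M} \<Longrightarrow> ts \<in> partitions 0 T \<Longrightarrow>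
       psum (\<lambda>u v. level_norm k (incr S2 u v) powr (p / real k)) ts \<le> C"
    and V12: "\<And>k ts. k \<in> {1..M} \<Longrightarrow> ts \<in> partitions 0 T \<Longrightarrow>
       psum (\<lambda>u v. level_norm k (\<lambda>w. incr S1 u v w - incr S2 u v w) powr (p / real k)) ts \<le> C * \<epsilon> powr (p / real k)"
    and lim1: "\<And>s t w. 0 \<le> s \<Longrightarrow> s \<le> t \<Longrightarrow> t \<le> T \<Longrightarrow> M < length w \<Longrightarrow>
        (\<lambda>m. \<Sum>i<Suc m. incr S1 (upart s t m i) (upart s t m (Suc i)) w) \<longlonglongrightarrow> 0"
    and lim2: "\<And>s t w. 0 \<le> s \<Longrightarrow> s \<le> t \<Longrightarrow> t \<le> T \<Longrightarrow> M < length w \<Longrightarrow>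
        (\<lambda>m. \<Sum>i<Suc m. incr S2 (upart s t m i) (upart s t m (Suc i)) w) \<longlonglongrightarrow> 0"
  obtains \<omega> where "control T \<omega>"
    "\<And>s t. 0 \<le> s \<Longrightarrow> s \<le> t \<Longrightarrow> t \<le> T \<Longrightarrow> \<omega> s t \<le> 3 * real M * C"
    "\<And>s t w. 0 \<le> s \<Longrightarrow> s \<le> t \<Longrightarrow> t \<le> T \<Longrightarrow> w \<noteq> [] \<Longrightarrow>
       \<bar>incr S1 s t w\<bar> \<le> ext_const p M (length w) * \<omega> s t powr (real (length w) / p) \<and>
       \<bar>incr S2 s t w\<bar> \<le> ext_const p M (length w) * \<omega> s t powr (real (length w) / p) \<and>
       \<bar>incr S1 s t w - incr S2 s t w\<bar> \<le> \<epsilon> * (ext_const p M (length w) * \<omega> s t powr (real (length w) / p))"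
proof -
  define a where "a k u v = level_norm k (incr S1 u v) powr (p / real k)" for k u v
  define b where "b k u v = level_norm k (incr S2 u v) powr (p / real k)" for k u v
  define d where "d k u v = (level_norm k (\<lambda>w. incr S1 u v w - incr S2 u v w) / \<epsilon>) powr (p / real k)" for k u v
  define h where "h u v = (\<Sum>k\<in>{1..M}. a k u v + b k u v + d k u v)" for u v
  have d': "d k u v = level_norm k (\<lambda>w. incr S1 u v w - incr S2 u v w) powr (p / real k) / \<epsilon> powr (p / real k)" for k u v
    unfolding d_def using \<epsilon> by (simp add: powr_divide level_norm_nonneg)
  have hC: "psum h ts \<le> 3 * real M * C" if ts: "ts \<in> partitions 0 T" for ts
  proof -
    have "psum h ts = (\<Sum>k\<in>{1..M}. psum (a k) ts + psum (b k) ts + psum (d k) ts)"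
      unfolding h_def by (simp add: psum_sum psum_add)
    also have "\<dots> \<le> (\<Sum>k\<in>{1..M}. C + C + C)"
      using V1[OF _ ts] V2[OF _ ts] V12[OF _ ts] \<epsilon> unfolding a_def b_def d'
      by (intro sum_mono add_mono) (auto simp: psum_divide field_simps)
    finally show ?thesis by simp
  qed
  have hnn: "0 \<le> h s t" for s t unfolding h_def a_def b_def d_def by (intro sum_nonneg) auto
  have h0: "h s s = 0" if "0 \<le> s" "s \<le> T" for s
  proof -
    have "incr S1 s s = tone" "incr S2 s s = tone" using that by (auto intro!: incr_same ch)
    moreover have "level_norm k (\<lambda>w::'a list. 0) = 0" if "k \<ge> 1" for k
      by (rule level_norm_attained[of k "\<lambda>w::'a list. 0"]) auto
    ultimately show ?thesis by (auto simp: h_def a_def b_def d_def level_norm_tone)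
  qed
  obtain \<omega> where \<omega>: "control T \<omega>" "\<And>s t. 0 \<le> s \<Longrightarrow> s \<le> t \<Longrightarrow> t \<le> T \<Longrightarrow> h s t \<le> \<omega> s t"
    "\<And>s t. 0 \<le> s \<Longrightarrow> s \<le> t \<Longrightarrow> t \<le> T \<Longrightarrow> \<omega> s t \<le> 3 * real M * C"
    by (rule control_of_partition_sums[OF hnn h0 hC]) blast+
  show thesis
  proof (rule that[OF \<omega>(1,3)])
    fix s t and w :: "'a list" assume st: "0 \<le> s" "s \<le> t" "t \<le> T" and w: "w \<noteq> []"
    have low: "\<bar>incr S1 s t w\<bar> \<le> \<omega> s t powr (real (length w) / p) \<and> \<bar>incr S2 s t w\<bar> \<le> \<omega> s t powr (real (length w) / p) \<and>
        \<bar>incr S1 s t w - incr S2 s t w\<bar> \<le> \<epsilon> * \<omega> s t powr (real (length w) / p)"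
      if st: "0 \<le> s" "s \<le> t" "t \<le> T" and w: "1 \<le> length w" "length w \<le> M" for s t w
    proof -
      define k where "k = length w"
      have k: "k \<in> {1..M}" "real k > 0" using w by (auto simp: k_def)
      have "a k s t + b k s t + d k s t \<le> h s t"
        unfolding h_def by (rule member_le_sum) (use k in \<open>auto simp: a_def b_def d_def\<close>)
      then have abd: "a k s t \<le> \<omega> s t" "b k s t \<le> \<omega> s t" "d k s t \<le> \<omega> s t"
        using \<omega>(2)[OF st] by (auto simp: a_def b_def d_def intro: order.trans[rotated])
      have root: "x \<le> \<omega> s t powr (real k / p)" if "x powr (p / real k) \<le> \<omega> s t" "0 \<le> x" for x
      proof -
        have "x = (x powr (p / real k)) powr (real k / p)" using k p that by (simp add: powr_powr)
        also have "\<dots> \<le> \<omega> s t powr (real k / p)" using that p by (intro powr_mono2) auto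
        finally show ?thesis .
      qed
      have "level_norm k (incr S1 s t) \<le> \<omega> s t powr (real k / p)" "level_norm k (incr S2 s t) \<le> \<omega> s t powr (real k / p)"
        "level_norm k (\<lambda>w. incr S1 s t w - incr S2 s t w) / \<epsilon> \<le> \<omega> s t powr (real k / p)"
        using abd \<epsilon> unfolding a_def b_def d_def by (auto intro!: root level_norm_nonneg divide_nonneg_pos)
      then show ?thesis
        using abs_le_level_norm[of w k "incr S1 s t"] abs_le_level_norm[of w k "incr S2 s t"] \<epsilon>
          abs_le_level_norm[of w k "\<lambda>w. incr S1 s t w - incr S2 s t w"]
        by (auto simp: k_def field_simps)
    qed
    show "\<bar>incr S1 s t w\<bar> \<le> ext_const p M (length w) * \<omega> s t powr (real (length w) / p) \<and>
       \<bar>incr S2 s t w\<bar> \<le> ext_const p M (length w) * \<omega> s t powr (real (length w) / p) \<and>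
       \<bar>incr S1 s t w - incr S2 s t w\<bar> \<le> \<epsilon> * (ext_const p M (length w) * \<omega> s t powr (real (length w) / p))"
      using p level_bounds[OF p] \<epsilon> unfolding M
      by (intro extension_estimate[OF _ _ \<omega>(1) multiplicative_incr[OF ch(1)] multiplicative_incr[OF ch(2)] _ _ _ _ st w]
           low[unfolded M] lim1[unfolded M] lim2[unfolded M]) auto
  qed
qed

section \<open>Vanishing Riemann sums of increments\<close>

lemma path_incr_lift:
  fixes S :: "real \<Rightarrow> 'a::finite tensor"
  assumes "character (S s)"
  shows "path_incr N (\<lambda>t. ttrunc N (S t)) s t = ttrunc N (incr S s t)"
  using assms unfolding path_incr_def incr_def
  by (simp add: ginv_ttrunc ttrunc_tmult)

lemma upart_step: "upart s t m (Suc i) - upart s t m i = (t - s) / real (Suc m)"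
proof -
  have "(t - s) * real (Suc i) = (t - s) * real i + (t - s)" by (simp add: algebra_simps)
  then show ?thesis by (simp add: upart_def add_divide_distrib del: of_nat_Suc)
qed

lemma upart_partition:
  assumes "s < t" shows "map (upart s t m) [0..<Suc (Suc m)] \<in> partitions s t"
    "psum f (map (upart s t m) [0..<Suc (Suc m)]) = (\<Sum>i<Suc m. f (upart s t m i) (upart s t m (Suc i)))"
proof -
  have "strict_mono (upart s t m)" unfolding upart_def using assms
    by (intro strict_monoI) (auto intro!: divide_strict_right_mono mult_strict_left_mono)
  then have "sorted_wrt (<) (map (upart s t m) [0..<Suc (Suc m)])"
    unfolding sorted_wrt_iff_nth_less strict_mono_def by (simp del: upt_Suc)
  then show "map (upart s t m) [0..<Suc (Suc m)] \<in> partitions s t"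
    by (auto simp: partitions_def hd_map last_map simp del: upt_Suc)
  show "psum f (map (upart s t m) [0..<Suc (Suc m)]) = (\<Sum>i<Suc m. f (upart s t m i) (upart s t m (Suc i)))"
    unfolding psum_def by (intro sum.cong) (auto simp del: upt_Suc)
qed

text \<open>For \<open>q < 1\<close> the sum is at most \<open>(max \<bar>D\<bar>)\<^sup>1\<^sup>-\<^sup>q\<close> times the \<open>q\<close>-variation, where \<open>D\<close> are the increments.\<close>

lemma riemann_vanish:
  fixes S :: "real \<Rightarrow> 'a::finite tensor"
  assumes cont: "continuous_on {0..T} S" and ch: "\<And>t. t \<in> {0..T} \<Longrightarrow> character (S t)"
    and V: "\<And>ts. ts \<in> partitions 0 T \<Longrightarrow> psum (\<lambda>u v. level_norm (length w) (incr S u v) powr q) ts \<le> C"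
    and q: "0 < q" "q < 1" and w: "w \<noteq> []" and st: "0 \<le> s" "s \<le> t" "t \<le> T"
  shows "(\<lambda>m. \<Sum>i<Suc m. incr S (upart s t m i) (upart s t m (Suc i)) w) \<longlonglongrightarrow> 0"
proof (cases "s = t")
  case True
  have "incr S s s w = 0" using incr_same[of S s, OF ch[of s]] st w by (auto simp: tone_def)
  moreover have "upart s s m i = s" for m i by (simp add: upart_def)
  ultimately show ?thesis using True by simp
next
  case False
  then have lt: "s < t" using st by simp
  \<comment> \<open>As a function of both times the increment is uniformly continuous and zero on
    the diagonal, so short steps have small increments.\<close>
  define G where "G x = incr S (fst x) (snd x) w" for x
  have c1: "continuous_on {0..T} (\<lambda>t. S t w)" for w by (rule continuous_on_product_then_coordinatewise[OF cont])
  have "continuous_on ({0..T} \<times> {0..T}) G"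
    unfolding G_def incr_def tmult_def antip_def
    by (intro continuous_intros continuous_on_compose2[OF c1 continuous_on_fst[OF continuous_on_id]]
        continuous_on_compose2[OF c1 continuous_on_snd[OF continuous_on_id]]) auto
  then have uc: "uniformly_continuous_on ({0..T} \<times> {0..T}) G"
    by (intro compact_uniformly_continuous compact_Times) auto
  show ?thesis
  proof (rule LIMSEQ_I)
    fix e :: real assume e: "e > 0"
    \<comment> \<open>Chosen such that \<open>\<eta> powr (1 - q) * C' = e\<close>; the added
      \<open>1\<close> makes \<open>C'\<close> positive and the final inequality strict.\<close>
    define C' where "C' = \<bar>C\<bar> + 1"
    define \<eta> where "\<eta> = (e / C') powr (1 / (1 - q))"
    have C': "C' > 0" unfolding C'_def by simp
    then have \<eta>: "\<eta> > 0" using e by (simp add: \<eta>_def)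
    obtain \<delta> where \<delta>: "\<delta> > 0" "\<And>x y. x \<in> {0..T} \<times> {0..T} \<Longrightarrow> y \<in> {0..T} \<times> {0..T} \<Longrightarrow> dist y x < \<delta> \<Longrightarrow> dist (G y) (G x) < \<eta>"
      using uc \<eta> unfolding uniformly_continuous_on_def by metis
    obtain m0 where m0: "(t - s) / \<delta> < real m0" using reals_Archimedean2 by blast
    have "norm (\<Sum>i<Suc m. incr S (upart s t m i) (upart s t m (Suc i)) w) < e" if m: "m \<ge> m0" for m
    proof -
      have step: "\<bar>incr S (upart s t m i) (upart s t m (Suc i)) w\<bar> \<le>
          \<eta> powr (1 - q) * level_norm (length w) (incr S (upart s t m i) (upart s t m (Suc i))) powr q" if i: "i < Suc m" for i
      proof -
        define u v where "u = upart s t m i" and "v = upart s t m (Suc i)"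
        have uv: "u \<in> {0..T}" "v \<in> {0..T}" using upart_bounds[of s t i m] upart_bounds[of s t "Suc i" m] i st
          by (auto simp: u_def v_def)
        have "v - u = (t - s) / real (Suc m)" unfolding u_def v_def by (rule upart_step)
        also have "\<dots> < \<delta>"
        proof -
          have "(t - s) / \<delta> < real (Suc m)" using m0 m by linarith
          then show ?thesis using \<delta>(1) by (simp add: field_simps)
        qed
        finally have "v - u < \<delta>" .
        moreover have "u \<le> v" unfolding u_def v_def using monoD[OF upart_mono[of s t m], of i "Suc i"] st by simp
        ultimately have "dist (G (u, v)) (G (u, u)) < \<eta>" using uv by (intro \<delta>(2)) (auto simp: dist_Pair_Pair dist_real_def)
        moreover have "G (u, u) = 0" using incr_same[of S u, OF ch[OF uv(1)]] w by (simp add: G_def tone_def)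
        ultimately have D: "\<bar>incr S u v w\<bar> < \<eta>" by (simp add: G_def)
        have "\<bar>incr S u v w\<bar> = \<bar>incr S u v w\<bar> powr (1 - q) * \<bar>incr S u v w\<bar> powr q"
          by (cases "incr S u v w = 0") (auto simp flip: powr_add)
        also have "\<dots> \<le> \<eta> powr (1 - q) * level_norm (length w) (incr S u v) powr q"
          using D q abs_le_level_norm[of w "length w" "incr S u v"] by (intro mult_mono powr_mono2) auto
        finally show ?thesis unfolding u_def v_def .
      qed
      have "norm (\<Sum>i<Suc m. incr S (upart s t m i) (upart s t m (Suc i)) w) \<le>
         (\<Sum>i<Suc m. \<eta> powr (1 - q) * level_norm (length w) (incr S (upart s t m i) (upart s t m (Suc i))) powr q)"
        unfolding real_norm_def by (rule order.trans[OF sum_abs]) (intro sum_mono step, simp)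
      also have "\<dots> = \<eta> powr (1 - q) * psum (\<lambda>u v. level_norm (length w) (incr S u v) powr q) (map (upart s t m) [0..<Suc (Suc m)])"
        by (simp only: upart_partition(2)[OF lt] sum_distrib_left)
      also have "\<dots> \<le> \<eta> powr (1 - q) * C"
        by (intro mult_left_mono psum_subinterval_le[OF _ V st upart_partition(1)[OF lt]]) auto
      also have "\<dots> < \<eta> powr (1 - q) * C'" using \<eta> by (intro mult_strict_left_mono) (auto simp: C'_def)
      also have "\<eta> powr (1 - q) = e / C'" unfolding \<eta>_def using q e C' by (simp add: powr_powr)
      finally show ?thesis using C' by simp
    qed
    then show "\<exists>no. \<forall>n\<ge>no. norm ((\<Sum>i<Suc n. incr S (upart s t n i) (upart s t n (Suc i)) w) - 0) < e" by auto
  qed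
qed

text \<open>A word with at least two letters contributes at most a multiple of
  \<open>1 / Suc m ^ 2\<close> on each of the \<open>Suc m\<close> intervals. As
  \<open>level p >= 1\<close>, this covers all words above level \<open>p\<close>.\<close>

lemma (in piecewise_C1) sig_riemann_vanish:
  assumes st: "0 \<le> s" "s \<le> t" "t \<le> T" and w: "2 \<le> length w"
  shows "(\<lambda>m. \<Sum>i<Suc m. incr sig (upart s t m i) (upart s t m (Suc i)) w) \<longlonglongrightarrow> 0"
proof (rule Lim_null_comparison[OF always_eventually])
  define K where "K = (L * (t - s)) ^ length w"
  have K: "K \<ge> 0" unfolding K_def using L st by auto
  show "\<forall>m. norm (\<Sum>i<Suc m. incr sig (upart s t m i) (upart s t m (Suc i)) w) \<le> K / real (Suc m)"
  proof
    fix m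
    have "\<bar>incr sig (upart s t m i) (upart s t m (Suc i)) w\<bar> \<le> K / real (Suc m) ^ 2" if i: "i < Suc m" for i
    proof -
      define u v where "u = upart s t m i" and "v = upart s t m (Suc i)"
      have uv: "0 \<le> u" "u \<le> v" "v \<le> T"
        using upart_bounds[of s t i m] upart_bounds[of s t "Suc i" m] i st monoD[OF upart_mono[of s t m], of i "Suc i"]
        by (auto simp: u_def v_def)
      have vu: "v - u = (t - s) / real (Suc m)" unfolding u_def v_def by (rule upart_step)
      have "\<bar>incr sig u v w\<bar> \<le> (L * (v - u)) ^ length w" by (rule incr_sig_bound[OF uv])
      also have "\<dots> = K / real (Suc m) ^ length w" unfolding vu K_def by (simp add: power_divide)
      also have "\<dots> \<le> K / real (Suc m) ^ 2"
        using w K by (intro divide_left_mono power_increasing) auto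
      finally show ?thesis unfolding u_def v_def .
    qed
    then have "\<bar>\<Sum>i<Suc m. incr sig (upart s t m i) (upart s t m (Suc i)) w\<bar> \<le> (\<Sum>i<Suc m. K / real (Suc m) ^ 2)"
      by (intro order.trans[OF sum_abs] sum_mono) auto
    also have "\<dots> = K / real (Suc m)" by (simp add: power2_eq_square)
    finally show "norm (\<Sum>i<Suc m. incr sig (upart s t m i) (upart s t m (Suc i)) w) \<le> K / real (Suc m)" by simp
  qed
  show "(\<lambda>m. K / real (Suc m)) \<longlonglongrightarrow> 0"
    using LIMSEQ_Suc[OF lim_const_over_n[of K]] by simp
qed

lemma rough_path_truncation:
  fixes X :: "real \<Rightarrow> 'a::finite tensor"
  assumes "X \<in> rough_path_space p T" "t \<in> {0..T}"
  obtains a where "character a" "X t = ttrunc (level p) a"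
proof -
  have "X t \<in> grouplike_trunc (level p)" using assms by (auto simp: rough_path_space_def)
  then show thesis using that unfolding grouplike_trunc_def by (auto simp: grouplike_iff_character[symmetric])
qed

text \<open>The approximating signatures are uniformly Cauchy in every coordinate by
  \<open>variation_estimate\<close>. Their limit \<open>R\<close> inherits continuity, the shuffle
  identities and the rule for the time letter, and it agrees with \<open>X\<close> on the low
  levels.\<close>

lemma lyons_lift_exists:
  fixes X :: "real \<Rightarrow> ('d::finite option) tensor"
  assumes p: "p \<ge> 1" and T: "T > 0" and X: "X \<in> Omega_hat p T"
  obtains S where "is_lyons_lift p T X S"
    "\<And>t w. t \<in> {0..T} \<Longrightarrow> S t (w @ [None]) = integral {0..t} (\<lambda>s. S s w)"
proof -
  define M where "M = level p"
  note M = level_bounds[OF p, folded M_def]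
  have Xr: "X \<in> rough_path_space p T" using X by (simp add: Omega_hat_def)
  then have X1: "\<And>t. t \<in> {0..T} \<Longrightarrow> X t \<in> grouplike_trunc M" "X 0 = tone" "pvar_path p M 0 T X < \<infinity>"
    by (auto simp: rough_path_space_def M_def)
  obtain c0 where c0: "c0 \<ge> 0" "pvar_path p M 0 T X \<le> ennreal c0"
    using X1(3) by (cases "pvar_path p M 0 T X") auto
  define \<epsilon> where "\<epsilon> n = 1 / real (Suc n)" for n
  have \<epsilon>: "0 < \<epsilon> n" "\<epsilon> n \<le> 1" "m \<le> n \<Longrightarrow> \<epsilon> n \<le> \<epsilon> m" for n m by (auto simp: \<epsilon>_def field_simps)
  have all: "\<forall>\<epsilon>>0. \<exists>x :: real \<Rightarrow> real ^ 'd. piecewise_smooth T x \<and>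
     pvar_dist p M 0 T X (\<lambda>t. ttrunc M (smooth_sig (time_aug x) t)) < \<epsilon>"
    using X unfolding Omega_hat_def M_def mem_Collect_eq by (rule conjunct2)
  have pos: "0 < ennreal (\<epsilon> n)" for n using \<epsilon>(1) by simp
  have "\<forall>n. \<exists>x :: real \<Rightarrow> real ^ 'd. piecewise_smooth T x \<and>
     pvar_dist p M 0 T X (\<lambda>t. ttrunc M (smooth_sig (time_aug x) t)) < ennreal (\<epsilon> n)"
    by (intro allI mp[OF spec[OF all] pos])
  from choice[OF this] obtain x :: "nat \<Rightarrow> real \<Rightarrow> real ^ 'd" where xx: "\<forall>n. piecewise_smooth T (x n) \<and>
     pvar_dist p M 0 T X (\<lambda>t. ttrunc M (smooth_sig (time_aug (x n)) t)) < ennreal (\<epsilon> n)" ..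
  note x = conjunct1[OF spec[OF xx]] conjunct2[OF spec[OF xx]]
  define S where "S n = smooth_sig (time_aug (x n))" for n
  have "\<forall>n. \<exists>F L. piecewise_C1 T (time_aug (x n)) F L"
    using piecewise_smooth_time_aug[OF T x(1)] by metis
  then obtain F L where pc: "\<And>n. piecewise_C1 T (time_aug (x n)) (F n) (L n)" by metis
  note chS = piecewise_C1.sig_character[OF pc, folded S_def]
  note S0 = piecewise_C1.sig_0_tone[OF pc, folded S_def]
  note contS = piecewise_C1.sig_continuous[OF pc, folded S_def]
  have incX: "path_incr M X s t w = incr X s t w" if "s \<in> {0..T}" "length w \<le> M" for s t w
    using that by (simp add: path_incr_ttrunc X1 ttrunc_def)
  have incS: "path_incr M (\<lambda>t. ttrunc M (S n t)) s t w = incr (S n) s t w" if "s \<in> {0..T}" "length w \<le> M" for n s t w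
    using that by (simp add: path_incr_lift chS) (simp add: ttrunc_def)
  have ps_cong: "psum f ts = psum g ts" if "ts \<in> partitions 0 T" "\<And>u v. u \<in> {0..T} \<Longrightarrow> f u v = g u v" for f g ts
    unfolding psum_def using partitions_memD[OF that(1)] by (intro sum.cong refl that(2)) auto
  have VX: "psum (\<lambda>u v. level_norm k (incr X u v) powr (p / real k)) ts \<le> c0 powr (p / real k)"
    if "k \<in> {1..M}" "ts \<in> partitions 0 T" for k ts
  proof -
    have "psum (\<lambda>u v. level_norm k (incr X u v) powr (p / real k)) ts = psum (\<lambda>u v. level_norm k (path_incr M X u v) powr (p / real k)) ts"
      using that by (intro ps_cong arg_cong2[where f="(powr)"] level_norm_cong) (auto simp: incX)
    then show ?thesis using pvar_psum_le[OF c0(2,1) _ that] p by simp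
  qed
  have VD: "psum (\<lambda>u v. level_norm k (\<lambda>w. incr X u v w - incr (S n) u v w) powr (p / real k)) ts \<le> \<epsilon> n powr (p / real k)"
    if "k \<in> {1..M}" "ts \<in> partitions 0 T" for k ts n
  proof -
    have "psum (\<lambda>u v. level_norm k (\<lambda>w. incr X u v w - incr (S n) u v w) powr (p / real k)) ts =
      psum (\<lambda>u v. level_norm k (\<lambda>w. path_incr M X u v w - path_incr M (\<lambda>t. ttrunc M (S n t)) u v w) powr (p / real k)) ts"
      using that by (intro ps_cong arg_cong2[where f="(powr)"] level_norm_cong) (auto simp: incX incS)
    then show ?thesis using pvar_psum_le[OF less_imp_le[OF x(2)[of n]] _ _ that] p \<epsilon>(1)[of n] unfolding S_def by simp
  qed
  \<comment> \<open>The \<open>2\<close> serves twice: it dominates the power of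
    \<open>\<epsilon> n\<close>, at most \<open>1\<close>, in \<open>VS\<close>, and it counts the
    two approximation errors in \<open>VSS\<close>.\<close>
  define C where "C = (\<Sum>k\<in>{1..M}. 2 powr (p / real k) * (c0 powr (p / real k) + 2))"
  have Ck: "2 powr (p / real k) * (c0 powr (p / real k) + 2) \<le> C" if "k \<in> {1..M}" for k
    unfolding C_def by (rule member_le_sum[OF that]) auto
  have VS: "psum (\<lambda>u v. level_norm k (incr (S n) u v) powr (p / real k)) ts \<le> C" if k: "k \<in> {1..M}" "ts \<in> partitions 0 T" for k ts n
  proof -
    have "psum (\<lambda>u v. level_norm k (incr (S n) u v) powr (p / real k)) ts \<le>
       psum (\<lambda>u v. 2 powr (p / real k) * (level_norm k (incr X u v) powr (p / real k) +
           level_norm k (\<lambda>w. incr X u v w - incr (S n) u v w) powr (p / real k))) ts"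
      using p by (intro psum_mono partitions_sorted[OF k(2)] powr_add_le level_norm_nonneg level_norm_triangle) auto
    also have "\<dots> \<le> 2 powr (p / real k) * (c0 powr (p / real k) + \<epsilon> n powr (p / real k))"
      unfolding psum_cmult psum_add using VX[OF k] VD[OF k] by (intro mult_left_mono add_mono) auto
    also have "\<dots> \<le> 2 powr (p / real k) * (c0 powr (p / real k) + 2)"
      using p powr_le1[of "p / real k" "\<epsilon> n"] \<epsilon>[of n] by (intro mult_left_mono add_mono) auto
    finally show ?thesis using Ck[OF k(1)] by simp
  qed
  have VSS: "psum (\<lambda>u v. level_norm k (\<lambda>w. incr (S n) u v w - incr (S m) u v w) powr (p / real k)) ts \<le> C * \<epsilon> N powr (p / real k)"
    if k: "k \<in> {1..M}" "ts \<in> partitions 0 T" and nm: "N \<le> n" "N \<le> m" for k ts n m N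
  proof -
    have "psum (\<lambda>u v. level_norm k (\<lambda>w. incr (S n) u v w - incr (S m) u v w) powr (p / real k)) ts \<le>
       psum (\<lambda>u v. 2 powr (p / real k) * (level_norm k (\<lambda>w. incr X u v w - incr (S n) u v w) powr (p / real k) +
           level_norm k (\<lambda>w. incr X u v w - incr (S m) u v w) powr (p / real k))) ts"
      using p by (intro psum_mono partitions_sorted[OF k(2)] powr_add_le level_norm_nonneg level_norm_triangle) auto
    also have "\<dots> \<le> 2 powr (p / real k) * (\<epsilon> n powr (p / real k) + \<epsilon> m powr (p / real k))"
      unfolding psum_cmult psum_add using VD[OF k] by (intro mult_left_mono add_mono) auto
    also have "\<dots> \<le> 2 powr (p / real k) * (\<epsilon> N powr (p / real k) + \<epsilon> N powr (p / real k))"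
      using p \<epsilon>(1,3) nm by (intro mult_left_mono add_mono powr_mono2) (auto simp: less_imp_le)
    also have "\<dots> = 2 powr (p / real k) * 2 * \<epsilon> N powr (p / real k)" by simp
    also have "\<dots> \<le> C * \<epsilon> N powr (p / real k)"
    proof (rule mult_right_mono)
      have "2 powr (p / real k) * 2 \<le> 2 powr (p / real k) * (c0 powr (p / real k) + 2)" by (intro mult_left_mono) auto
      then show "2 powr (p / real k) * 2 \<le> C" using Ck[OF k(1)] by linarith
    qed simp
    finally show ?thesis .
  qed
  have limS: "(\<lambda>m. \<Sum>i<Suc m. incr (S n) (upart s t m i) (upart s t m (Suc i)) w) \<longlonglongrightarrow> 0"
    if "0 \<le> s" "s \<le> t" "t \<le> T" "M < length w" for n s t w
    unfolding S_def using that M(3) by (intro piecewise_C1.sig_riemann_vanish[OF pc]) auto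
  have est: "\<exists>\<omega>. control T \<omega> \<and> (\<forall>s t. 0 \<le> s \<and> s \<le> t \<and> t \<le> T \<longrightarrow> \<omega> s t \<le> 3 * real M * C) \<and>
    (\<forall>s t w. 0 \<le> s \<and> s \<le> t \<and> t \<le> T \<and> w \<noteq> [] \<longrightarrow>
       \<bar>incr (S n) s t w\<bar> \<le> ext_const p M (length w) * \<omega> s t powr (real (length w) / p) \<and>
       \<bar>incr (S n) s t w - incr (S m) s t w\<bar> \<le> \<epsilon> N * (ext_const p M (length w) * \<omega> s t powr (real (length w) / p)))"
    if nm: "N \<le> n" "N \<le> m" for n m N
  proof -
    show ?thesis
    proof (rule variation_estimate[OF p \<epsilon>(1)[of N] M_def chS[of _ n] chS[of _ m] VS[of _ _ n] VS[of _ _ m] VSS[OF _ _ nm]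
          limS[of _ _ _ n] limS[of _ _ _ m]], assumption+, goal_cases)
      case (1 \<omega>)
      show ?case
        by (rule exI[of _ \<omega>], intro conjI allI impI 1(1); elim conjE) (simp_all add: 1(2,3))
    qed
  qed
  have e0: "ext_const p M n \<ge> 0" for n using p M by (intro ext_const_nonneg) auto
  have ucau: "uniformly_Cauchy_on {0..T} (\<lambda>n t. S n t w)" for w
  proof (cases "w = []")
    case True
    have "S n t [] = 1" if "t \<in> {0..T}" for n t using character_Nil[OF chS[OF that]] by simp
    then show ?thesis using True by (intro uniformly_Cauchy_onI) auto
  next
    case False
    define K where "K = ext_const p M (length w) * (3 * real M * C) powr (real (length w) / p)"
    have K: "K \<ge> 0" unfolding K_def using e0 by simp
    show ?thesis
    proof (rule uniformly_Cauchy_onI)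
      fix e :: real assume e: "e > 0"
      obtain N where N: "(K + 1) / e < real N" using reals_Archimedean2 by blast
      have "dist (S m t w) (S n t w) < e" if t: "t \<in> {0..T}" and nm: "m \<ge> N" "n \<ge> N" for t m n
      proof -
        obtain \<omega> where \<omega>: "control T \<omega>" "\<And>s t. 0 \<le> s \<Longrightarrow> s \<le> t \<Longrightarrow> t \<le> T \<Longrightarrow> \<omega> s t \<le> 3 * real M * C"
          "\<And>s t w. 0 \<le> s \<Longrightarrow> s \<le> t \<Longrightarrow> t \<le> T \<Longrightarrow> w \<noteq> [] \<Longrightarrow>
            \<bar>incr (S m) s t w - incr (S n) s t w\<bar> \<le> \<epsilon> N * (ext_const p M (length w) * \<omega> s t powr (real (length w) / p))"
          using est[OF nm] by blast
        have "dist (S m t w) (S n t w) \<le> \<epsilon> N * (ext_const p M (length w) * \<omega> 0 t powr (real (length w) / p))"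
          using \<omega>(3)[of 0 t w] t False by (simp add: incr_from_tone S0 dist_real_def)
        also have "\<dots> \<le> \<epsilon> N * K"
          unfolding K_def using t p \<omega>(2)[of 0 t] e0 \<epsilon>(1)[of N]
          by (intro mult_left_mono powr_mono2 control_nonneg[OF \<omega>(1)]) auto
        also have "\<dots> < e"
        proof -
          have "K < e * real (Suc N)" using N e K by (auto simp: field_simps)
          then show ?thesis by (simp add: \<epsilon>_def field_simps)
        qed
        finally show ?thesis .
      qed
      then show "\<exists>M. \<forall>x\<in>{0..T}. \<forall>m\<ge>M. \<forall>n\<ge>M. dist (S m x w) (S n x w) < e" by blast
    qed
  qed
  define R where "R t w = lim (\<lambda>n. S n t w)" for t w
  have ul: "uniform_limit {0..T} (\<lambda>n t. S n t w) (\<lambda>t. R t w) sequentially" for w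
    using Cauchy_uniformly_convergent[OF ucau[of w]] unfolding uniformly_convergent_uniform_limit_iff R_def .
  have lim: "(\<lambda>n. S n t w) \<longlonglongrightarrow> R t w" if "t \<in> {0..T}" for t w
    by (rule tendsto_uniform_limitI[OF ul that])
  have contR: "continuous_on {0..T} R"
    by (intro continuous_on_coordinatewise_then_product uniform_limit_theorem[OF _ ul] always_eventually allI contS) auto
  have R0: "R 0 = tone"
  proof
    fix w
    have "(\<lambda>n. S n 0 w) \<longlonglongrightarrow> R 0 w" using T by (intro lim) auto
    then show "R 0 w = tone w" by (simp add: S0 LIMSEQ_const_iff)
  qed
  have chR: "character (R t)" if t: "t \<in> {0..T}" for t
  proof -
    have "(\<lambda>n. S n t []) \<longlonglongrightarrow> 1" using character_Nil[OF chS[OF t]] by simp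
    then have "R t [] = 1" by (rule LIMSEQ_unique[OF lim[OF t]])
    moreover have "R t w * R t v = (\<Sum>u\<in>#shuffle_word w v. R t u)" for w v
    proof (rule LIMSEQ_unique)
      show "(\<lambda>n. S n t w * S n t v) \<longlonglongrightarrow> R t w * R t v" by (intro tendsto_mult lim t)
      have "S n t w * S n t v = (\<Sum>u | length u = length w + length v. real (count (shuffle_word w v) u) * S n t u)" for n
        using chS[OF t, of n] unfolding character_def sum_mset_shuffle_word by blast
      then show "(\<lambda>n. S n t w * S n t v) \<longlonglongrightarrow> (\<Sum>u\<in>#shuffle_word w v. R t u)"
        unfolding sum_mset_shuffle_word by (auto intro!: tendsto_sum tendsto_mult lim t)
    qed
    ultimately show ?thesis by (simp add: character_def)
  qed
  have RX: "ttrunc M (R t) = X t" if t: "t \<in> {0..T}" for t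
  proof
    fix w
    have Xt: "X t = ttrunc M (X t)" using X1(1)[OF t] by (auto simp: grouplike_trunc_def)
    show "ttrunc M (R t) w = X t w"
    proof (cases "length w \<le> M")
      case False
      then show ?thesis by (subst Xt) (simp add: ttrunc_def)
    next
      case True
      show ?thesis
      \<comment> \<open>The variation distance does not see the empty word, and
        \<open>[0, t]\<close> is a partition only for positive \<open>t\<close>.\<close>
      proof (cases "w = [] \<or> t = 0")
        case True
        obtain a where "character a" "X t = ttrunc M a"
          using rough_path_truncation[OF Xr t] unfolding M_def by blast
        then show ?thesis using True character_Nil[OF chR[OF t]]
          by (auto simp: ttrunc_def character_Nil R0 X1(2)) (simp add: tone_def)
      next
        case False
        then have t0: "0 < t" using t by auto
        define k where "k = length w"
        have k: "k \<in> {1..M}" using \<open>length w \<le> M\<close> False by (cases w) (auto simp: k_def)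
        have "\<bar>X t w - S n t w\<bar> \<le> \<epsilon> n" for n
        proof -
          have "[0, t] \<in> partitions 0 t" using t0 by (simp add: partitions_def)
          from psum_subinterval_le[OF _ VD[OF k] _ _ _ this, of T n]
          have "level_norm k (\<lambda>w. incr X 0 t w - incr (S n) 0 t w) powr (p / real k) \<le> \<epsilon> n powr (p / real k)"
            using t by simp
          then have "level_norm k (\<lambda>w. incr X 0 t w - incr (S n) 0 t w) \<le> \<epsilon> n"
          proof (rule contrapos_pp)
            assume "\<not> level_norm k (\<lambda>w. incr X 0 t w - incr (S n) 0 t w) \<le> \<epsilon> n"
            then have "\<epsilon> n powr (p / real k) < level_norm k (\<lambda>w. incr X 0 t w - incr (S n) 0 t w) powr (p / real k)"
              using k p \<epsilon>(1)[of n] by (intro powr_less_mono2) auto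
            then show "\<not> level_norm k (\<lambda>w. incr X 0 t w - incr (S n) 0 t w) powr (p / real k) \<le> \<epsilon> n powr (p / real k)" by simp
          qed
          then show ?thesis
            using abs_le_level_norm[of w k "\<lambda>w. incr X 0 t w - incr (S n) 0 t w"]
            by (simp add: k_def incr_from_tone S0 X1(2))
        qed
        then have "\<forall>\<^sub>F n in sequentially. norm (X t w - S n t w) \<le> \<epsilon> n"
          by (intro always_eventually) simp
        moreover have "\<epsilon> \<longlonglongrightarrow> 0"
          unfolding \<epsilon>_def using LIMSEQ_Suc[OF lim_const_over_n[of 1]] by simp
        ultimately have "(\<lambda>n. X t w - S n t w) \<longlonglongrightarrow> 0"
          by (rule Lim_null_comparison)
        then have "(\<lambda>n. S n t w) \<longlonglongrightarrow> X t w"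
          by (rule Lim_transform2[OF tendsto_const])
        then have "R t w = X t w" by (rule LIMSEQ_unique[OF lim[OF t]])
        then show ?thesis using \<open>length w \<le> M\<close> by (simp add: ttrunc_def)
      qed
    qed
  qed
  \<comment> \<open>Lower semicontinuity of the variation: on a fixed partition the sums for
    \<open>S n\<close> converge to those for \<open>R\<close>, and \<open>est\<close> with
    \<open>n = m\<close> bounds them uniformly in \<open>n\<close>. The maximum over words is first
    replaced by a sum.\<close>
  have pvR: "pvar_path p N 0 T (\<lambda>t. ttrunc N (R t)) < \<infinity>" for N
  proof (rule pvar_finiteI)
    show "0 < p" using p by simp
    fix k assume k: "k \<in> {1..N}"
    define K where "K = (\<Sum>w::'d option list | length w = k. ext_const p M k powr (p / real k) * (3 * real M * C))"
    have "psum (\<lambda>u v. level_norm k (path_incr N (\<lambda>t. ttrunc N (R t)) u v) powr (p / real k)) ts \<le> K" if ts: "ts \<in> partitions 0 T" for ts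
    proof -
      have mem: "u \<in> {0..T}" if "u \<in> set ts" for u using partitions_memD[OF ts that] by auto
      have "psum (\<lambda>u v. level_norm k (path_incr N (\<lambda>t. ttrunc N (R t)) u v) powr (p / real k)) ts
         = psum (\<lambda>u v. level_norm k (incr R u v) powr (p / real k)) ts"
        using k by (intro ps_cong[OF ts] arg_cong2[where f="(powr)"] level_norm_cong refl) (simp add: path_incr_lift chR, simp add: ttrunc_def)
      also have "\<dots> \<le> psum (\<lambda>u v. \<Sum>w | length w = k. \<bar>incr R u v w\<bar> powr (p / real k)) ts"
        by (intro psum_mono partitions_sorted[OF ts] level_norm_powr_le_sum)
      also have "\<dots> \<le> K"
      proof (rule LIMSEQ_le_const2)
        show "(\<lambda>n. psum (\<lambda>u v. \<Sum>w | length w = k. \<bar>incr (S n) u v w\<bar> powr (p / real k)) ts)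
           \<longlonglongrightarrow> psum (\<lambda>u v. \<Sum>w | length w = k. \<bar>incr R u v w\<bar> powr (p / real k)) ts"
          unfolding psum_def incr_def tmult_def antip_def using p k
          by (intro tendsto_sum tendsto_powr' tendsto_rabs tendsto_mult tendsto_const lim mem) auto
        have "psum (\<lambda>u v. \<Sum>w | length w = k. \<bar>incr (S n) u v w\<bar> powr (p / real k)) ts \<le> K" for n
        proof -
          obtain \<omega> where \<omega>: "control T \<omega>" "\<And>s t. 0 \<le> s \<Longrightarrow> s \<le> t \<Longrightarrow> t \<le> T \<Longrightarrow> \<omega> s t \<le> 3 * real M * C"
            "\<And>s t w. 0 \<le> s \<Longrightarrow> s \<le> t \<Longrightarrow> t \<le> T \<Longrightarrow> w \<noteq> [] \<Longrightarrow>
              \<bar>incr (S n) s t w\<bar> \<le> ext_const p M (length w) * \<omega> s t powr (real (length w) / p)"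
            using est[of 0 n n] by blast
          have "psum (\<lambda>u v. \<Sum>w | length w = k. \<bar>incr (S n) u v w\<bar> powr (p / real k)) ts
              \<le> psum (\<lambda>u v. (\<Sum>w::'d option list | length w = k. ext_const p M k powr (p / real k)) * \<omega> u v) ts"
          proof (rule psum_mono[OF partitions_sorted[OF ts]])
            fix u v assume uv: "u \<in> set ts" "v \<in> set ts" "u < v"
            have uv': "0 \<le> u" "u \<le> v" "v \<le> T" using mem[OF uv(1)] mem[OF uv(2)] uv(3) by auto
            have "\<bar>incr (S n) u v w\<bar> powr (p / real k) \<le> ext_const p M k powr (p / real k) * \<omega> u v" if w: "length w = k" for w
            proof -
              have "w \<noteq> []" using w k by auto
              then have "\<bar>incr (S n) u v w\<bar> powr (p / real k) \<le> (ext_const p M k * \<omega> u v powr (real k / p)) powr (p / real k)"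
                using \<omega>(3)[OF uv', of w] w k p by (intro powr_mono2) auto
              also have "\<dots> = ext_const p M k powr (p / real k) * \<omega> u v"
                using k p e0 control_nonneg[OF \<omega>(1) uv'] by (simp add: powr_mult powr_powr)
              finally show ?thesis .
            qed
            then show "(\<Sum>w | length w = k. \<bar>incr (S n) u v w\<bar> powr (p / real k)) \<le>
                (\<Sum>w::'d option list | length w = k. ext_const p M k powr (p / real k)) * \<omega> u v"
              unfolding sum_distrib_right by (intro sum_mono) auto
          qed
          also have "\<dots> \<le> (\<Sum>w::'d option list | length w = k. ext_const p M k powr (p / real k)) * (3 * real M * C)"
            unfolding psum_cmult using control_psum[OF \<omega>(1) ts] \<omega>(2)[of 0 T] T
            by (intro mult_left_mono sum_nonneg) auto
          finally show ?thesis unfolding K_def sum_distrib_right .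
        qed
        then show "\<exists>N. \<forall>n\<ge>N. psum (\<lambda>u v. \<Sum>w | length w = k. \<bar>incr (S n) u v w\<bar> powr (p / real k)) ts \<le> K" by blast
      qed
      finally show ?thesis .
    qed
    then show "\<exists>c. \<forall>ts\<in>partitions 0 T. psum (\<lambda>u v. level_norm k (path_incr N (\<lambda>t. ttrunc N (R t)) u v) powr (p / real k)) ts \<le> c" by blast
  qed
  show thesis
  proof (rule that[of R])
    show "is_lyons_lift p T X R"
      unfolding is_lyons_lift_def using contR R0 chR RX pvR by (auto simp: grouplike_iff_character M_def)
    fix t w assume t: "t \<in> {0..T}"
    \<comment> \<open>Uniform convergence allows the limit to be taken under the integral in
      \<open>smooth_sig_snoc_None\<close>.\<close>
    have "uniform_limit {0..t} (\<lambda>n t. S n t w) (\<lambda>t. R t w) sequentially"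
      by (rule uniform_limit_on_subset[OF ul]) (use t in auto)
    then obtain I J where IJ: "\<And>n. ((\<lambda>s. S n s w) has_integral I n) {0..t}" "((\<lambda>s. R s w) has_integral J) {0..t}" "I \<longlonglongrightarrow> J"
      by (rule uniform_limit_integral) (use t in \<open>auto intro: continuous_on_subset[OF contS]\<close>)
    have "S n t (w @ [None]) = I n" for n
      using integral_unique[OF IJ(1)] unfolding S_def smooth_sig_snoc_None by simp
    then have "(\<lambda>n. S n t (w @ [None])) \<longlonglongrightarrow> J" using IJ(3) by simp
    then show "R t (w @ [None]) = integral {0..t} (\<lambda>s. R s w)"
      unfolding integral_unique[OF IJ(2)] by (rule LIMSEQ_unique[OF lim[OF t]])
  qed
qed

section \<open>Arbitrary lifts: uniqueness, the time letter and bounds\<close>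

lemma lift_coord_continuous: "is_lyons_lift p T X S \<Longrightarrow> continuous_on {0..T} (\<lambda>t. S t w)"
  unfolding is_lyons_lift_def by (auto intro: continuous_on_product_then_coordinatewise)

lemma lift_character:
  fixes S :: "real \<Rightarrow> 'a::finite tensor"
  shows "is_lyons_lift p T X S \<Longrightarrow> t \<in> {0..T} \<Longrightarrow> character (S t)"
  unfolding is_lyons_lift_def by (auto simp: grouplike_iff_character)

lemma lift_start: "is_lyons_lift p T X S \<Longrightarrow> S 0 = tone"
  unfolding is_lyons_lift_def by auto

lemma lift_low_level: "is_lyons_lift p T X S \<Longrightarrow> t \<in> {0..T} \<Longrightarrow> length w \<le> level p \<Longrightarrow> S t w = X t w"
  unfolding is_lyons_lift_def by (metis ttrunc_def)

lemma lift_psum_bounded: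
  fixes S :: "real \<Rightarrow> 'a::finite tensor"
  assumes L: "is_lyons_lift p T X S" and p: "p > 0" and k: "k \<ge> 1"
  obtains C where "\<And>ts. ts \<in> partitions 0 T \<Longrightarrow> psum (\<lambda>u v. level_norm k (incr S u v) powr (p / real k)) ts \<le> C"
proof -
  have "pvar_path p k 0 T (\<lambda>t. ttrunc k (S t)) < \<infinity>" using L unfolding is_lyons_lift_def by blast
  then obtain c where c: "c \<ge> 0" "pvar_path p k 0 T (\<lambda>t. ttrunc k (S t)) \<le> ennreal c"
    by (cases "pvar_path p k 0 T (\<lambda>t. ttrunc k (S t))") auto
  show thesis
  proof (rule that)
    fix ts assume ts: "ts \<in> partitions 0 T"
    have "psum (\<lambda>u v. level_norm k (incr S u v) powr (p / real k)) ts
       = psum (\<lambda>u v. level_norm k (path_incr k (\<lambda>t. ttrunc k (S t)) u v) powr (p / real k)) ts"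
      unfolding psum_def using partitions_memD[OF ts]
      by (intro sum.cong arg_cong2[where f="(powr)"] level_norm_cong refl)
         (simp add: path_incr_lift lift_character[OF L], simp add: ttrunc_def)
    also have "\<dots> \<le> c powr (p / real k)" by (rule pvar_psum_le[OF c(2,1) p _ ts]) (use k in auto)
    finally show "psum (\<lambda>u v. level_norm k (incr S u v) powr (p / real k)) ts \<le> c powr (p / real k)" .
  qed
qed

text \<open>For words longer than \<open>level p\<close> the exponent \<open>p / length w\<close> is
  below \<open>1\<close>, and the lift has finite variation at that level, so
  \<open>riemann_vanish\<close> applies.\<close>

lemma lift_riemann_vanish:
  fixes S :: "real \<Rightarrow> 'a::finite tensor"
  assumes L: "is_lyons_lift p T X S" and p: "p \<ge> 1" and w: "level p < length w" and st: "0 \<le> s" "s \<le> t" "t \<le> T"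
  shows "(\<lambda>m. \<Sum>i<Suc m. incr S (upart s t m i) (upart s t m (Suc i)) w) \<longlonglongrightarrow> 0"
proof -
  have k: "1 \<le> length w" "p < real (length w)" using w level_bounds[OF p] by auto
  have p0: "p > 0" using p by simp
  show ?thesis
  proof (rule lift_psum_bounded[OF L p0 k(1)])
    fix C assume C: "\<And>ts. ts \<in> partitions 0 T \<Longrightarrow> psum (\<lambda>u v. level_norm (length w) (incr S u v) powr (p / real (length w))) ts \<le> C"
    show ?thesis
    proof (rule riemann_vanish[OF _ lift_character[OF L] C _ _ _ st])
      show "continuous_on {0..T} S" using L by (simp add: is_lyons_lift_def)
      show "0 < p / real (length w)" using p0 k by (intro divide_pos_pos) auto
      show "p / real (length w) < 1" using k by (subst divide_less_eq_1_pos) auto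
      show "w \<noteq> []" using w by auto
    qed
  qed
qed

text \<open>This determines the lift by its low levels and shows that it depends measurably on them.\<close>

lemma lift_riemann:
  fixes S :: "real \<Rightarrow> 'a::finite tensor"
  assumes L: "is_lyons_lift p T X S" and p: "p \<ge> 1" and w: "level p < length w" and t: "t \<in> {0..T}"
  shows "(\<lambda>m. \<Sum>i<Suc m. \<Sum>j\<in>{1..<length w}. S (upart 0 t m i) (take j w) *
     incr S (upart 0 t m i) (upart 0 t m (Suc i)) (drop j w)) \<longlonglongrightarrow> S t w"
proof -
  have w0: "w \<noteq> []" using w by auto
  define R where "R m = (\<Sum>i<Suc m. incr S (upart 0 t m i) (upart 0 t m (Suc i)) w)" for m
  have "(\<Sum>i<Suc m. \<Sum>j\<in>{1..<length w}. S (upart 0 t m i) (take j w) *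
     incr S (upart 0 t m i) (upart 0 t m (Suc i)) (drop j w)) = S t w - R m" for m
  proof -
    \<comment> \<open>Expands \<open>S v = tmult (S u) (incr S u v)\<close> at \<open>w\<close>: the
      proper cuts give the increment of the coordinate \<open>w\<close> from \<open>u\<close> to
      \<open>v\<close> minus \<open>incr S u v w\<close>. The increments telescope, the remaining
      terms form \<open>R m\<close>.\<close>
    have "(\<Sum>j\<in>{1..<length w}. S (upart 0 t m i) (take j w) * incr S (upart 0 t m i) (upart 0 t m (Suc i)) (drop j w))
       = (S (upart 0 t m (Suc i)) w - S (upart 0 t m i) w) - incr S (upart 0 t m i) (upart 0 t m (Suc i)) w"
      if i: "i < Suc m" for i
    proof -
      define u v where "u = upart 0 t m i" and "v = upart 0 t m (Suc i)"
      have uv: "u \<in> {0..T}" "v \<in> {0..T}"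
        using upart_bounds[of 0 t i m] upart_bounds[of 0 t "Suc i" m] i t by (auto simp: u_def v_def)
      define g where "g j = S u (take j w) * incr S u v (drop j w)" for j
      have "S v w = tmult (S u) (incr S u v) w" by (simp add: incr_mult lift_character[OF L uv(1)])
      also have "\<dots> = (\<Sum>j\<le>length w. g j)" by (simp add: tmult_def g_def)
      also have "{..length w} = insert 0 (insert (length w) {1..<length w})" using w0 by auto
      also have "sum g \<dots> = g 0 + g (length w) + (\<Sum>j\<in>{1..<length w}. g j)" using w0 by simp
      also have "g 0 = incr S u v w" by (simp add: g_def character_Nil lift_character[OF L uv(1)])
      also have "g (length w) = S u w"
        using uv by (simp add: g_def incr_def tmult_def antip_def character_Nil lift_character[OF L])
      finally show ?thesis unfolding g_def u_def v_def by simp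
    qed
    then have "(\<Sum>i<Suc m. \<Sum>j\<in>{1..<length w}. S (upart 0 t m i) (take j w) *
       incr S (upart 0 t m i) (upart 0 t m (Suc i)) (drop j w))
      = (\<Sum>i<Suc m. (S (upart 0 t m (Suc i)) w - S (upart 0 t m i) w) - incr S (upart 0 t m i) (upart 0 t m (Suc i)) w)"
      by (intro sum.cong refl) (simp del: upart_Suc)
    also have "\<dots> = (\<Sum>i<Suc m. (S (upart 0 t m (Suc i)) w - S (upart 0 t m i) w)) - R m"
      unfolding R_def by (rule sum_subtractf)
    also have "(\<Sum>i<Suc m. (S (upart 0 t m (Suc i)) w - S (upart 0 t m i) w)) = S (upart 0 t m (Suc m)) w - S (upart 0 t m 0) w"
      by (rule sum_lessThan_telescope)
    also have "\<dots> = S t w" using lift_start[OF L] w0 by (simp add: tone_def)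
    finally show ?thesis .
  qed
  moreover have "(\<lambda>m. S t w - R m) \<longlonglongrightarrow> S t w - 0"
    unfolding R_def using t by (intro tendsto_diff tendsto_const lift_riemann_vanish[OF L p w]) auto
  ultimately show ?thesis by simp
qed

text \<open>The Riemann sums of \<open>lift_riemann\<close> involve only words shorter than
  \<open>w\<close>, so two lifts that agree on those agree at \<open>w\<close>; the induction starts
  from the levels prescribed by \<open>X\<close>.\<close>

lemma lift_unique:
  fixes S S' :: "real \<Rightarrow> 'a::finite tensor"
  assumes L: "is_lyons_lift p T X S" and L': "is_lyons_lift p T X S'" and p: "p \<ge> 1" and t: "t \<in> {0..T}"
  shows "S t w = S' t w"
  using t
proof (induction "length w" arbitrary: w t rule: less_induct)
  case less
  show ?case
  proof (cases "length w \<le> level p")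
    case True
    then show ?thesis using lift_low_level[OF L less.prems] lift_low_level[OF L' less.prems] by simp
  next
    case False
    then have w: "level p < length w" by simp
    have inc: "incr S u v (drop j w) = incr S' u v (drop j w)" if "u \<in> {0..T}" "v \<in> {0..T}" "j \<in> {1..<length w}" for u v j
      unfolding incr_def tmult_def antip_def
      by (intro sum.cong refl arg_cong2[where f="(*)"] less.hyps that) (use that in auto)
    have "(\<Sum>i<Suc m. \<Sum>j\<in>{1..<length w}. S (upart 0 t m i) (take j w) *
       incr S (upart 0 t m i) (upart 0 t m (Suc i)) (drop j w)) =
      (\<Sum>i<Suc m. \<Sum>j\<in>{1..<length w}. S' (upart 0 t m i) (take j w) *
       incr S' (upart 0 t m i) (upart 0 t m (Suc i)) (drop j w))" for m
    proof (intro sum.cong refl arg_cong2[where f="(*)"])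
      fix i j assume ij: "i \<in> {..<Suc m}" "j \<in> {1..<length w}"
      have uv: "upart 0 t m i \<in> {0..T}" "upart 0 t m (Suc i) \<in> {0..T}"
        using upart_bounds[of 0 t i m] upart_bounds[of 0 t "Suc i" m] ij less.prems by auto
      show "S (upart 0 t m i) (take j w) = S' (upart 0 t m i) (take j w)" using ij uv by (intro less.hyps) auto
      show "incr S (upart 0 t m i) (upart 0 t m (Suc i)) (drop j w) = incr S' (upart 0 t m i) (upart 0 t m (Suc i)) (drop j w)"
        by (rule inc[OF uv ij(2)])
    qed
    then show ?thesis
      using LIMSEQ_unique[OF lift_riemann[OF L p w less.prems]] lift_riemann[OF L' p w less.prems] by simp
  qed
qed

lemma signature_lift:
  fixes X :: "real \<Rightarrow> ('d::finite option) tensor"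
  assumes p: "p \<ge> 1" and T: "T > 0" and X: "X \<in> Omega_hat p T"
  shows "is_lyons_lift p T X (signature p T X)"
  unfolding signature_def using lyons_lift_exists[OF p T X] by (metis someI)

text \<open>Known for the lift constructed from smooth approximations, and by uniqueness this is the
  chosen one.\<close>

lemma signature_snoc_None:
  fixes X :: "real \<Rightarrow> ('d::finite option) tensor"
  assumes p: "p \<ge> 1" and T: "T > 0" and X: "X \<in> Omega_hat p T" and t: "t \<in> {0..T}"
  shows "signature p T X t (w @ [None]) = integral {0..t} (\<lambda>s. signature p T X s w)"
proof -
  obtain S where S: "is_lyons_lift p T X S"
    "\<And>t w. t \<in> {0..T} \<Longrightarrow> S t (w @ [None]) = integral {0..t} (\<lambda>s. S s w)"
    by (rule lyons_lift_exists[OF p T X]) blast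
  have "signature p T X s v = S s v" if "s \<in> {0..T}" for s v
    by (rule lift_unique[OF signature_lift[OF p T X] S(1) p that])
  then have "integral {0..t} (\<lambda>s. signature p T X s w) = integral {0..t} (\<lambda>s. S s w)"
    using t by (intro integral_cong) auto
  then show ?thesis using S(2)[OF t, of w] \<open>\<And>s v. s \<in> {0..T} \<Longrightarrow> signature p T X s v = S s v\<close>[OF t] by simp
qed

text \<open>The argument of the power is the bound \<open>3 * M * C\<close> of
  \<open>variation_estimate\<close>, with \<open>C\<close> the sum of the partition-sum bounds
  implied by \<kappa>. Summing over \<open>m\<close> covers all word lengths up to \<open>n\<close>
  at once, and the \<open>1\<close> covers the empty word.\<close>

definition lift_bound :: "real \<Rightarrow> real \<Rightarrow> nat \<Rightarrow> real" where
  "lift_bound p \<kappa> n = 1 + (\<Sum>m\<in>{1..n}. ext_const p (level p) m *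
     (3 * real (level p) * (\<Sum>k\<in>{1..level p}. \<kappa> powr (p / real k))) powr (real m / p))"

lemma lift_bound_ge_1: "p \<ge> 1 \<Longrightarrow> 1 \<le> lift_bound p \<kappa> n"
  unfolding lift_bound_def using level_bounds[of p]
  by (auto intro!: sum_nonneg mult_nonneg_nonneg ext_const_nonneg)

text \<open>\<open>variation_estimate\<close> on \<open>[0, t]\<close> with the lift in both places
  and \<epsilon> equal to \<open>1\<close>, so that the difference is zero. Only the variation of
  \<open>X\<close> up to \<open>t\<close> enters, which is what stopping at a level of the variation
  controls.\<close>

lemma lift_coord_bound:
  fixes S :: "real \<Rightarrow> 'a::finite tensor"
  assumes L: "is_lyons_lift p T X S" and X: "X \<in> rough_path_space p T" and p: "p \<ge> 1" and t: "t \<in> {0..T}"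
    and pv: "pvar_path p (level p) 0 t X \<le> ennreal \<kappa>" and \<kappa>: "\<kappa> \<ge> 0" and w: "length w \<le> n"
  shows "\<bar>S t w\<bar> \<le> lift_bound p \<kappa> n"
proof (cases "w = []")
  case True
  then show ?thesis using character_Nil[OF lift_character[OF L t]] lift_bound_ge_1[OF p, of \<kappa> n] by simp
next
  case False
  define M where "M = level p"
  note M = level_bounds[OF p, folded M_def]
  define C where "C = (\<Sum>k\<in>{1..M}. \<kappa> powr (p / real k))"
  have C: "0 \<le> C" unfolding C_def by (intro sum_nonneg) simp
  have ch: "character (S s)" if "s \<in> {0..t}" for s using that t by (intro lift_character[OF L]) auto
  have XS: "X s = ttrunc M (S s)" if "s \<in> {0..T}" for s using L that by (simp add: is_lyons_lift_def M_def)
  have V: "psum (\<lambda>u v. level_norm k (incr S u v) powr (p / real k)) ts \<le> C"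
    if k: "k \<in> {1..M}" and ts: "ts \<in> partitions 0 t" for k ts
  proof -
    have "psum (\<lambda>u v. level_norm k (incr S u v) powr (p / real k)) ts
        = psum (\<lambda>u v. level_norm k (path_incr M X u v) powr (p / real k)) ts"
      unfolding psum_def
    proof (intro sum.cong refl arg_cong2[where f="(powr)"] level_norm_cong)
      fix i and w :: "'a list" assume i: "i \<in> {..<length ts - 1}" and w: "length w = k"
      have mem: "ts ! i \<in> {0..T}" "ts ! Suc i \<in> {0..T}"
        using partitions_memD[OF ts, of "ts ! i"] partitions_memD[OF ts, of "ts ! Suc i"] i t by auto
      have "path_incr M X (ts ! i) (ts ! Suc i) = path_incr M (\<lambda>t. ttrunc M (S t)) (ts ! i) (ts ! Suc i)"
        unfolding path_incr_def using mem by (simp add: XS)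
      then show "incr S (ts ! i) (ts ! Suc i) w = path_incr M X (ts ! i) (ts ! Suc i) w"
        using k w mem(1) lift_character[OF L mem(1)] by (simp add: path_incr_lift) (simp add: ttrunc_def)
    qed
    also have "\<dots> \<le> \<kappa> powr (p / real k)" using pvar_psum_le[OF pv \<kappa> _ _ ts] k p by (simp add: M_def)
    also have "\<dots> \<le> C" unfolding C_def by (rule member_le_sum[OF k]) auto
    finally show ?thesis .
  qed
  have z: "level_norm k (\<lambda>w::'a list. 0) = 0" for k
    by (rule level_norm_attained[of k "\<lambda>w::'a list. 0"]) auto
  have V0: "psum (\<lambda>u v. level_norm k (\<lambda>w. incr S u v w - incr S u v w) powr (p / real k)) ts \<le> C * 1 powr (p / real k)"
    if k: "k \<in> {1..M}" and ts: "ts \<in> partitions 0 t" for k ts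
    using C by (simp add: psum_def z)
  have lim: "(\<lambda>m. \<Sum>i<Suc m. incr S (upart s u m i) (upart s u m (Suc i)) w) \<longlonglongrightarrow> 0"
    if "0 \<le> s" "s \<le> u" "u \<le> t" "M < length w" for s u w
    using that t by (intro lift_riemann_vanish[OF L p]) (auto simp: M_def)
  show ?thesis
  proof (rule variation_estimate[OF p zero_less_one M_def ch ch V V V0 lim lim], assumption+, goal_cases)
    case (1 \<omega>)
    have "\<bar>S t w\<bar> = \<bar>incr S 0 t w\<bar>" by (simp add: incr_from_tone lift_start[OF L])
    also have "\<dots> \<le> ext_const p M (length w) * \<omega> 0 t powr (real (length w) / p)"
      using 1(3)[of 0 t w] False t by simp
    also have "\<dots> \<le> ext_const p M (length w) * (3 * real M * C) powr (real (length w) / p)"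
      using 1(2)[of 0 t] t p M by (intro mult_left_mono powr_mono2 control_nonneg[OF 1(1)] ext_const_nonneg) auto
    also have "\<dots> \<le> (\<Sum>m\<in>{1..n}. ext_const p M m * (3 * real M * C) powr (real m / p))"
      using w False p M by (intro member_le_sum[of "length w" "{1..n}" "\<lambda>m. ext_const p M m * (3 * real M * C) powr (real m / p)"])
        (auto simp: Suc_le_eq intro!: mult_nonneg_nonneg ext_const_nonneg)
    finally show ?case unfolding lift_bound_def C_def M_def by simp
  qed
qed

subsection \<open>Measurability\<close>

text \<open>Induction on the word length: low levels are coordinates of \<open>X\<close>, higher
  ones are limits of the Riemann sums in \<open>lift_riemann\<close>, built from shorter
  words.\<close>

lemma signature_measurable:
  fixes X :: "'w \<Rightarrow> real \<Rightarrow> ('d::finite option) tensor"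
  assumes p: "p \<ge> 1" and T: "T > 0" and X: "\<And>\<omega>. \<omega> \<in> space F \<Longrightarrow> X \<omega> \<in> Omega_hat p T"
    and meas: "\<And>t w. t \<in> {0..T} \<Longrightarrow> (\<lambda>\<omega>. X \<omega> t w) \<in> borel_measurable F" and t: "t \<in> {0..T}"
  shows "(\<lambda>\<omega>. signature p T (X \<omega>) t w) \<in> borel_measurable F"
  using t
proof (induction "length w" arbitrary: w t rule: less_induct)
  case less
  note L = signature_lift[OF p T X]
  show ?case
  proof (cases "length w \<le> level p")
    case True
    have "signature p T (X \<omega>) t w = X \<omega> t w" if "\<omega> \<in> space F" for \<omega>
      by (rule lift_low_level[OF L[OF that] less.prems True])
    then show ?thesis using meas[OF less.prems] by (subst measurable_cong) auto
  next
    case False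
    then have w: "level p < length w" by simp
    show ?thesis
    proof (rule borel_measurable_LIMSEQ_real[OF lift_riemann[OF L p w less.prems]])
      fix m
      show "(\<lambda>\<omega>. \<Sum>i<Suc m. \<Sum>j\<in>{1..<length w}. signature p T (X \<omega>) (upart 0 t m i) (take j w) *
          incr (signature p T (X \<omega>)) (upart 0 t m i) (upart 0 t m (Suc i)) (drop j w)) \<in> borel_measurable F"
        unfolding incr_def tmult_def antip_def
      proof (intro borel_measurable_sum borel_measurable_times borel_measurable_const)
        fix i j assume ij: "i \<in> {..<Suc m}" "j \<in> {1..<length w}"
        have uv: "upart 0 t m i \<in> {0..T}" "upart 0 t m (Suc i) \<in> {0..T}"
          using upart_bounds[of 0 t i m] upart_bounds[of 0 t "Suc i" m] ij less.prems by auto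
        show "(\<lambda>\<omega>. signature p T (X \<omega>) (upart 0 t m i) (take j w)) \<in> borel_measurable F"
          "(\<lambda>\<omega>. signature p T (X \<omega>) (upart 0 t m i) (rev (take k (drop j w)))) \<in> borel_measurable F"
          "(\<lambda>\<omega>. signature p T (X \<omega>) (upart 0 t m (Suc i)) (drop k (drop j w))) \<in> borel_measurable F" for k
          using ij uv by (auto intro!: less.hyps)
      qed
    qed
  qed
qed

section \<open>Measurability of the variation through countably many partitions\<close>

lemma tendsto_level_norm:
  fixes a :: "'b \<Rightarrow> 'a::finite tensor"
  assumes "\<And>w. length w = k \<Longrightarrow> ((\<lambda>n. a n w) \<longlongrightarrow> b w) F"
  shows "((\<lambda>n. level_norm k (a n)) \<longlongrightarrow> level_norm k b) F"
proof (rule Lim_transform[OF tendsto_const], rule Lim_null_comparison[OF always_eventually])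
  show "\<forall>n. norm (level_norm k (a n) - level_norm k b) \<le> (\<Sum>w | length w = k. \<bar>a n w - b w\<bar>)"
  proof
    fix n
    have "level_norm k (a n) \<le> level_norm k b + level_norm k (\<lambda>w. a n w - b w)"
      "level_norm k b \<le> level_norm k (a n) + level_norm k (\<lambda>w. a n w - b w)"
      by (rule level_norm_triangle; linarith)+
    moreover have "level_norm k (\<lambda>w. a n w - b w) \<le> (\<Sum>w | length w = k. \<bar>a n w - b w\<bar>)"
    proof -
      obtain w where w: "length w = k" "level_norm k (\<lambda>w. a n w - b w) = \<bar>a n w - b w\<bar>" by (rule level_norm_attained)
      show ?thesis unfolding w(2) by (rule member_le_sum) (use w in auto)
    qed
    ultimately show "norm (level_norm k (a n) - level_norm k b) \<le> (\<Sum>w | length w = k. \<bar>a n w - b w\<bar>)"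
      by (simp add: abs_le_iff)
  qed
  show "((\<lambda>n. \<Sum>w | length w = k. \<bar>a n w - b w\<bar>) \<longlongrightarrow> 0) F"
    by (rule tendsto_null_sum) (use assms in \<open>auto intro!: tendsto_rabs_zero LIM_zero\<close>)
qed

lemma sorted_partition:
  assumes "sorted xs" "xs \<noteq> []" "\<And>x. x \<in> set xs \<Longrightarrow> D x x = 0"
  shows "\<exists>ys\<in>partitions (hd xs) (last xs). psum D ys = psum D xs"
  using assms
proof (induction xs rule: induct_list012)
  case (2 x)
  then show ?case by (intro bexI[of _ "[x]"]) (auto simp: partitions_def)
next
  case (3 x y zs)
  then obtain ys where ys: "ys \<in> partitions y (last (y # zs))" "psum D ys = psum D (y # zs)" by fastforce
  show ?case
  proof (cases "x = y")
    case True
    then show ?thesis using ys 3 by (intro bexI[of _ ys]) auto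
  next
    case False
    obtain us where us: "ys = y # us" using ys(1) by (auto simp: partitions_def) (metis list.collapse)
    have "x < y" using 3 False by auto
    then have "x # ys \<in> partitions x (last (y # zs))"
      using ys(1) unfolding us partitions_def by auto
    then show ?thesis using ys(2) us by (intro bexI[of _ "x # ys"]) auto
  qed
qed simp

text \<open>Indices of grid points, weakly increasing because distinct points may be rounded to the
  same one; lists of naturals are countable.\<close>

definition grid_lists :: "nat \<Rightarrow> nat list set" where
  "grid_lists m = {js. js \<noteq> [] \<and> sorted js \<and> hd js = 0 \<and> last js = Suc m}"

text \<open>Reduces the \<open>p\<close>-variation of a continuous path to a countable supremum.\<close>

lemma SUP_partitions_grid:
  fixes D :: "real \<Rightarrow> real \<Rightarrow> real" and \<phi> :: "real \<Rightarrow> ennreal"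
  assumes s: "s > 0" and D0: "\<And>x. x \<in> {0..s} \<Longrightarrow> D x x = 0"
    and D: "\<And>f g x y. (\<And>n::nat. f n \<in> {0..s}) \<Longrightarrow> (\<And>n. g n \<in> {0..s}) \<Longrightarrow> f \<longlonglongrightarrow> x \<Longrightarrow> g \<longlonglongrightarrow> y \<Longrightarrow>
       x \<in> {0..s} \<Longrightarrow> y \<in> {0..s} \<Longrightarrow> (\<lambda>n. D (f n) (g n)) \<longlonglongrightarrow> D x y"
    and Dnn: "\<And>x y. D x y \<ge> 0"
    and \<phi>: "\<And>f x. (\<And>n::nat. f n \<ge> 0) \<Longrightarrow> x \<ge> 0 \<Longrightarrow> f \<longlonglongrightarrow> x \<Longrightarrow> (\<lambda>n. \<phi> (f n)) \<longlonglongrightarrow> \<phi> x"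
  shows "(SUP ts\<in>partitions 0 s. \<phi> (psum D ts)) =
    (SUP m. SUP js\<in>grid_lists m. \<phi> (psum D (map (\<lambda>j. s * real j / real (Suc m)) js)))"
proof (rule antisym)
  show "(SUP m. SUP js\<in>grid_lists m. \<phi> (psum D (map (\<lambda>j. s * real j / real (Suc m)) js))) \<le> (SUP ts\<in>partitions 0 s. \<phi> (psum D ts))"
  proof (intro SUP_least)
    fix m js assume js: "js \<in> grid_lists m"
    define xs where "xs = map (\<lambda>j. s * real j / real (Suc m)) js"
    have srt: "sorted xs" using js
      unfolding xs_def grid_lists_def sorted_map by (auto intro!: sorted_wrt_mono_rel[of js "(\<le>)"] divide_right_mono mult_left_mono simp: less_imp_le[OF s])
    have hl: "xs \<noteq> []" "hd xs = 0" "last xs = s" using js by (auto simp: xs_def grid_lists_def hd_map last_map)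
    have "x \<in> {0..s}" if x: "x \<in> set xs" for x
    proof -
      obtain i where i: "i < length xs" "x = xs ! i" using x by (auto simp: in_set_conv_nth)
      have "xs ! 0 \<le> xs ! i" "xs ! i \<le> xs ! (length xs - 1)" using srt i by (auto intro!: sorted_nth_mono)
      then show ?thesis using hl i by (simp add: hd_conv_nth last_conv_nth)
    qed
    then obtain ys where "ys \<in> partitions 0 s" "psum D ys = psum D xs"
      using sorted_partition[OF srt hl(1), of D] D0 hl by auto
    then show "\<phi> (psum D xs) \<le> (SUP ts\<in>partitions 0 s. \<phi> (psum D ts))"
      by (intro SUP_upper2[of ys]) auto
  qed
  show "(SUP ts\<in>partitions 0 s. \<phi> (psum D ts)) \<le> (SUP m. SUP js\<in>grid_lists m. \<phi> (psum D (map (\<lambda>j. s * real j / real (Suc m)) js)))"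
  proof (rule SUP_least)
    fix ts assume ts: "ts \<in> partitions 0 s"
    \<comment> \<open>Rounds down to the grid of mesh \<open>s / Suc m\<close>; the end points
      \<open>0\<close> and \<open>s\<close> stay fixed.\<close>
    define r where "r m x = nat \<lfloor>real (Suc m) * x / s\<rfloor>" for m x
    define g where "g m x = s * real (r m x) / real (Suc m)" for m x
    have mem: "x \<in> {0..s}" if "x \<in> set ts" for x using partitions_memD[OF ts that] by auto
    have g: "g m x \<in> {0..s}" "\<bar>g m x - x\<bar> \<le> s / real (Suc m)" if x: "x \<in> {0..s}" for m x
    proof -
      have "0 \<le> real (Suc m) * x / s" using x s by simp
      then have "real (r m x) \<le> real (Suc m) * x / s" "real (Suc m) * x / s \<le> real (r m x) + 1"
        unfolding r_def by linarith+
      then have "s * real (r m x) \<le> real (Suc m) * x" "real (Suc m) * x \<le> s * real (r m x) + s"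
        using s by (auto simp: field_simps)
      then have le: "g m x \<le> x" "x \<le> g m x + s / real (Suc m)"
        unfolding g_def by (simp_all add: field_simps del: of_nat_Suc)
      moreover have "0 \<le> g m x" using s by (simp add: g_def)
      ultimately show "g m x \<in> {0..s}" "\<bar>g m x - x\<bar> \<le> s / real (Suc m)" using x by auto
    qed
    have glim: "(\<lambda>m. g m x) \<longlonglongrightarrow> x" if "x \<in> {0..s}" for x
    proof (rule Lim_transform[OF tendsto_const], rule Lim_null_comparison[OF always_eventually])
      show "\<forall>m. norm (g m x - x) \<le> s / real (Suc m)" using g(2)[OF that] by simp
      show "(\<lambda>m. s / real (Suc m)) \<longlonglongrightarrow> 0" using LIMSEQ_Suc[OF lim_const_over_n[of s]] by simp
    qed
    have "(\<lambda>m. psum D (map (g m) ts)) \<longlonglongrightarrow> psum D ts"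
      unfolding psum_def using mem by (auto intro!: tendsto_sum D g glim)
    then have lim: "(\<lambda>m. \<phi> (psum D (map (g m) ts))) \<longlonglongrightarrow> \<phi> (psum D ts)"
      by (intro \<phi> psum_nonneg Dnn)
    show "\<phi> (psum D ts) \<le> (SUP m. SUP js\<in>grid_lists m. \<phi> (psum D (map (\<lambda>j. s * real j / real (Suc m)) js)))"
    proof (rule LIMSEQ_le_const2[OF lim], intro exI allI impI)
      fix m
      have "map (r m) ts \<in> grid_lists m"
        using ts s unfolding grid_lists_def partitions_def
        by (auto simp: hd_map last_map r_def sorted_map intro!: sorted_wrt_mono_rel[of ts "(<)"] nat_mono floor_mono divide_right_mono mult_left_mono)
      then show "\<phi> (psum D (map (g m) ts)) \<le> (SUP m. SUP js\<in>grid_lists m. \<phi> (psum D (map (\<lambda>j. s * real j / real (Suc m)) js)))"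
        by (intro SUP_upper2[of m] UNIV_I SUP_upper2[of "map (r m) ts"]) (simp_all add: g_def[abs_def] o_def)
    qed
  qed
qed

lemma incr_measurable:
  assumes "\<And>t w. t \<in> {0..T} \<Longrightarrow> (\<lambda>\<omega>. X \<omega> t w) \<in> borel_measurable F" "u \<in> {0..T}" "v \<in> {0..T}"
  shows "(\<lambda>\<omega>. incr (X \<omega>) u v w) \<in> borel_measurable F"
  unfolding incr_def tmult_def antip_def
  using assms by (intro borel_measurable_sum borel_measurable_times borel_measurable_const) auto

text \<open>After the reduction to grid partitions, each term of the countable supremum depends
  measurably on finitely many coordinates of \<open>X\<close>.\<close>

lemma pvar_measurable:
  fixes X :: "'w \<Rightarrow> real \<Rightarrow> 'a::finite tensor"
  assumes p: "p \<ge> 1" and X: "\<And>\<omega>. \<omega> \<in> space F \<Longrightarrow> X \<omega> \<in> rough_path_space p T"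
    and meas: "\<And>t w. t \<in> {0..T} \<Longrightarrow> (\<lambda>\<omega>. X \<omega> t w) \<in> borel_measurable F" and s: "s \<in> {0..T}"
  shows "(\<lambda>\<omega>. pvar_path p (level p) 0 s (X \<omega>)) \<in> borel_measurable F"
proof (cases "s = 0")
  case True
  have "partitions 0 0 = {[0]}"
  proof -
    have "ts = [0]" if tz: "ts \<in> partitions 0 0" for ts
    proof -
      obtain b where b: "ts = 0 # b" using tz by (cases ts) (auto simp: partitions_def)
      have "b = []"
      proof (rule ccontr)
        assume "b \<noteq> []"
        then have "hd b \<in> set ts" "0 < hd b" using partitions_sorted[OF tz] by (auto simp: b)
        then show False using partitions_memD(2)[OF tz, of "hd b"] by simp
      qed
      then show ?thesis by (simp add: b)
    qed
    then show ?thesis by (auto simp: partitions_def)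
  qed
  then have "(\<lambda>\<omega>. pvar_path p (level p) 0 s (X \<omega>)) = (\<lambda>\<omega>. SUP k\<in>{1..level p}. 0)"
    using True by (auto simp: pvar_def)
  then show ?thesis by simp
next
  case False
  then have s0: "s > 0" using s by simp
  define M where "M = level p"
  define D where "D k \<omega> u v = level_norm k (incr (X \<omega>) u v) powr (p / real k)" for k \<omega> u v
  define \<phi> where "\<phi> k x = ennreal (x powr (real k / p))" for k :: nat and x
  have eq: "pvar_path p M 0 s (X \<omega>) = (SUP k\<in>{1..M}. SUP m. SUP js\<in>grid_lists m. \<phi> k (psum (D k \<omega>) (map (\<lambda>j. s * real j / real (Suc m)) js)))"
    if \<omega>: "\<omega> \<in> space F" for \<omega>
    unfolding pvar_def
  proof (rule SUP_cong[OF refl])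
    fix k assume k: "k \<in> {1..M}"
    note Xr = X[OF \<omega>]
    have cX: "continuous_on {0..T} (\<lambda>t. X \<omega> t w)" for w
      using Xr by (auto simp: rough_path_space_def intro: continuous_on_product_then_coordinatewise)
    have gX: "X \<omega> u \<in> grouplike_trunc M" if "u \<in> {0..T}" for u using Xr that by (auto simp: rough_path_space_def M_def)
    have "(SUP ts\<in>partitions 0 s. ennreal ((\<Sum>i<length ts - 1. level_norm k (path_incr M (X \<omega>) (ts ! i) (ts ! Suc i)) powr (p / real k)) powr (real k / p)))
      = (SUP ts\<in>partitions 0 s. \<phi> k (psum (D k \<omega>) ts))"
    proof (rule SUP_cong[OF refl])
      fix ts assume ts: "ts \<in> partitions 0 s"
      have "level_norm k (path_incr M (X \<omega>) (ts ! i) (ts ! Suc i)) = level_norm k (incr (X \<omega>) (ts ! i) (ts ! Suc i))"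
        if "i < length ts - 1" for i
      proof -
        have "ts ! i \<in> {0..T}" using partitions_memD[OF ts, of "ts ! i"] that s by auto
        then show ?thesis using k by (intro level_norm_cong) (simp add: path_incr_ttrunc gX, simp add: ttrunc_def)
      qed
      then show "ennreal ((\<Sum>i<length ts - 1. level_norm k (path_incr M (X \<omega>) (ts ! i) (ts ! Suc i)) powr (p / real k)) powr (real k / p))
         = \<phi> k (psum (D k \<omega>) ts)" by (simp add: \<phi>_def psum_def D_def)
    qed
    also have "\<dots> = (SUP m. SUP js\<in>grid_lists m. \<phi> k (psum (D k \<omega>) (map (\<lambda>j. s * real j / real (Suc m)) js)))"
    proof (rule SUP_partitions_grid[OF s0])
      show "D k \<omega> x x = 0" if x: "x \<in> {0..s}" for x
      proof -
        have xT: "x \<in> {0..T}" using x s by auto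
        obtain a where a: "character a" "X \<omega> x = ttrunc M a"
          by (rule rough_path_truncation[OF Xr xT]) (auto simp: M_def)
        have "ttrunc M (incr (X \<omega>) x x) = ttrunc M (tmult (antip a) a)"
          unfolding incr_def a(2) by (simp add: antip_ttrunc ttrunc_tmult)
        also have "\<dots> = tone" by (simp add: tmult_antip_left a(1))
        finally have tt: "ttrunc M (incr (X \<omega>) x x) = tone" .
        have "incr (X \<omega>) x x w = tone w" if "length w = k" for w
          using fun_cong[OF tt, of w] k that by (simp add: ttrunc_def)
        then have "level_norm k (incr (X \<omega>) x x) = level_norm k (tone :: 'a tensor)" by (rule level_norm_cong)
        then show ?thesis using k by (simp add: D_def level_norm_tone)
      qed
      show "(\<lambda>n. D k \<omega> (f n) (g n)) \<longlonglongrightarrow> D k \<omega> x y"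
        if fg: "\<And>n::nat. f n \<in> {0..s}" "\<And>n. g n \<in> {0..s}" "f \<longlonglongrightarrow> x" "g \<longlonglongrightarrow> y" "x \<in> {0..s}" "y \<in> {0..s}" for f g x y
      proof -
        have T: "f n \<in> {0..T}" "g n \<in> {0..T}" "x \<in> {0..T}" "y \<in> {0..T}" for n
          using fg(1)[of n] fg(2)[of n] fg(5,6) s by auto
        have cs: "(\<lambda>n. X \<omega> (f n) w) \<longlonglongrightarrow> X \<omega> x w" "(\<lambda>n. X \<omega> (g n) w) \<longlonglongrightarrow> X \<omega> y w" for w
          by (intro continuous_on_tendsto_compose[OF cX] always_eventually allI T fg)+
        show ?thesis unfolding D_def
          by (intro tendsto_powr' tendsto_level_norm tendsto_const)
             (use k p in \<open>auto simp: incr_def tmult_def antip_def level_norm_nonneg intro!: tendsto_intros cs\<close>)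
      qed
      show "D k \<omega> x y \<ge> 0" for x y by (simp add: D_def)
      show "(\<lambda>n. \<phi> k (f n)) \<longlonglongrightarrow> \<phi> k x" if "\<And>n::nat. f n \<ge> 0" "x \<ge> 0" "f \<longlonglongrightarrow> x" for f x
        unfolding \<phi>_def using that k p by (intro tendsto_ennrealI tendsto_powr' tendsto_const) auto
    qed
    finally show "(SUP ts\<in>partitions 0 s. ennreal ((\<Sum>i<length ts - 1. level_norm k (path_incr M (X \<omega>) (ts ! i) (ts ! Suc i)) powr (p / real k)) powr (real k / p)))
      = (SUP m. SUP js\<in>grid_lists m. \<phi> k (psum (D k \<omega>) (map (\<lambda>j. s * real j / real (Suc m)) js)))" .
  qed
  have "(\<lambda>\<omega>. \<phi> k (psum (D k \<omega>) (map (\<lambda>j. s * real j / real (Suc m)) js))) \<in> borel_measurable F"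
    if js: "js \<in> grid_lists m" for k m js
  proof -
    have "s * real (js ! i) / real (Suc m) \<in> {0..T}" if i: "i < length js" for i
    proof -
      have "js ! i \<le> js ! (length js - 1)" using js i by (intro sorted_nth_mono) (auto simp: grid_lists_def)
      moreover have "js ! (length js - 1) = Suc m" using js last_conv_nth[of js] by (simp add: grid_lists_def)
      ultimately have "js ! i \<le> Suc m" by simp
      then have "s * real (js ! i) / real (Suc m) \<le> s" using s0 by (simp add: field_simps del: of_nat_Suc)
      then show ?thesis using s s0 by auto
    qed
    then have "(\<lambda>\<omega>. psum (D k \<omega>) (map (\<lambda>j. s * real j / real (Suc m)) js)) \<in> borel_measurable F"
      unfolding psum_def D_def level_norm_def
      by (intro borel_measurable_sum powr_real_measurable borel_measurable_const borel_measurable_Max borel_measurable_abs)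
         (auto intro!: incr_measurable[OF meas] simp del: of_nat_Suc)
    then show ?thesis unfolding \<phi>_def by measurable
  qed
  then have "(\<lambda>\<omega>. SUP k\<in>{1..M}. SUP m. SUP js\<in>grid_lists m. \<phi> k (psum (D k \<omega>) (map (\<lambda>j. s * real j / real (Suc m)) js))) \<in> borel_measurable F"
    by (intro borel_measurable_SUP) (auto intro: countableI_type)
  then show ?thesis using eq unfolding M_def by (subst measurable_cong) auto
qed

text \<open>A function continuous in time and measurable in the other variable is the limit of
  functions that are piecewise constant in time. The time is clamped to \<open>[0, T]\<close> so
  that the statement lives on the full product.\<close>

lemma continuous_param_measurable:
  fixes f :: "real \<Rightarrow> 'w \<Rightarrow> real"
  assumes T: "T \<ge> 0" and m: "\<And>t. t \<in> {0..T} \<Longrightarrow> f t \<in> borel_measurable F"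
    and c: "\<And>\<omega>. \<omega> \<in> space F \<Longrightarrow> continuous_on {0..T} (\<lambda>t. f t \<omega>)"
  shows "(\<lambda>(t, \<omega>). f (max 0 (min T t)) \<omega>) \<in> borel_measurable (borel \<Otimes>\<^sub>M F)"
proof -
  define c0 where "c0 t = max 0 (min T t)" for t
  have c0: "c0 t \<in> {0..T}" for t using T by (auto simp: c0_def)
  define h where "h n x = f (c0 (real_of_int \<lfloor>real (Suc n) * fst x\<rfloor> / real (Suc n))) (snd x)" for n x
  have "(\<lambda>x. f (c0 (fst x)) (snd x)) \<in> borel_measurable (borel \<Otimes>\<^sub>M F)"
  proof (rule borel_measurable_LIMSEQ_real[of _ h])
    fix x :: "real \<times> 'w" assume x: "x \<in> space (borel \<Otimes>\<^sub>M F)"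
    then have s: "snd x \<in> space F" by (auto simp: space_pair_measure)
    have "(\<lambda>n. real_of_int \<lfloor>real (Suc n) * fst x\<rfloor> / real (Suc n)) \<longlonglongrightarrow> fst x"
    proof (rule Lim_transform[OF tendsto_const], rule Lim_null_comparison[OF always_eventually])
      show "\<forall>n. norm (real_of_int \<lfloor>real (Suc n) * fst x\<rfloor> / real (Suc n) - fst x) \<le> 1 / real (Suc n)"
      proof
        fix n
        have "\<bar>real_of_int \<lfloor>real (Suc n) * fst x\<rfloor> - real (Suc n) * fst x\<bar> \<le> 1" by linarith
        then have "\<bar>real_of_int \<lfloor>real (Suc n) * fst x\<rfloor> - real (Suc n) * fst x\<bar> / real (Suc n) \<le> 1 / real (Suc n)"
          by (intro divide_right_mono) auto
        also have "\<bar>real_of_int \<lfloor>real (Suc n) * fst x\<rfloor> - real (Suc n) * fst x\<bar> / real (Suc n)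
          = \<bar>(real_of_int \<lfloor>real (Suc n) * fst x\<rfloor> - real (Suc n) * fst x) / real (Suc n)\<bar>" by simp
        also have "(real_of_int \<lfloor>real (Suc n) * fst x\<rfloor> - real (Suc n) * fst x) / real (Suc n)
          = real_of_int \<lfloor>real (Suc n) * fst x\<rfloor> / real (Suc n) - fst x" by (simp add: diff_divide_distrib del: of_nat_Suc)
        finally show "norm (real_of_int \<lfloor>real (Suc n) * fst x\<rfloor> / real (Suc n) - fst x) \<le> 1 / real (Suc n)" by simp
      qed
      show "(\<lambda>n. 1 / real (Suc n)) \<longlonglongrightarrow> 0" using LIMSEQ_Suc[OF lim_const_over_n[of 1]] by simp
    qed
    then have "(\<lambda>n. c0 (real_of_int \<lfloor>real (Suc n) * fst x\<rfloor> / real (Suc n))) \<longlonglongrightarrow> c0 (fst x)"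
      unfolding c0_def by (intro tendsto_max tendsto_min tendsto_const)
    then show "(\<lambda>n. h n x) \<longlonglongrightarrow> f (c0 (fst x)) (snd x)"
      unfolding h_def by (intro continuous_on_tendsto_compose[OF c[OF s]] c0 always_eventually allI)
  next
    fix n
    show "h n \<in> borel_measurable (borel \<Otimes>\<^sub>M F)"
      unfolding h_def
    proof (rule measurable_compose_countable[where f="\<lambda>(i::int) x. f (c0 (real_of_int i / real (Suc n))) (snd x)"])
      show "(\<lambda>x. f (c0 (real_of_int i / real (Suc n))) (snd x)) \<in> borel_measurable (borel \<Otimes>\<^sub>M F)" for i :: int
        by (rule measurable_compose[OF measurable_snd m[OF c0]])
    qed measurable
  qed
  then show ?thesis by (simp add: c0_def case_prod_unfold)
qed

lemma continuous_param_compose: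
  fixes f :: "real \<Rightarrow> 'w \<Rightarrow> real"
  assumes m: "\<And>t. t \<in> {0..T} \<Longrightarrow> f t \<in> borel_measurable F"
    and c: "\<And>\<omega>. \<omega> \<in> space F \<Longrightarrow> continuous_on {0..T} (\<lambda>t. f t \<omega>)"
    and g: "g \<in> borel_measurable N" "\<And>x. x \<in> space N \<Longrightarrow> g x \<in> {0..T}" and h: "h \<in> measurable N F" and T: "T \<ge> 0"
  shows "(\<lambda>x. f (g x) (h x)) \<in> borel_measurable N"
proof -
  have "(\<lambda>x. (\<lambda>(t, \<omega>). f (max 0 (min T t)) \<omega>) (g x, h x)) \<in> borel_measurable N"
    by (rule measurable_compose[OF measurable_Pair[OF g(1) h] continuous_param_measurable[OF T m c]])
  moreover have "(\<lambda>(t, \<omega>). f (max 0 (min T t)) \<omega>) (g x, h x) = f (g x) (h x)" if "x \<in> space N" for x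
    using g(2)[OF that] by (simp add: min_absorb2 max_absorb2)
  ultimately show ?thesis by (subst measurable_cong[where g="\<lambda>x. (\<lambda>(t, \<omega>). f (max 0 (min T t)) \<omega>) (g x, h x)"]) auto
qed

text \<open>For continuous paths the integral is a Lebesgue integral, whose measurability in the
  parameter follows from the joint measurability above.\<close>

lemma integral_param_measurable:
  fixes f :: "real \<Rightarrow> 'w \<Rightarrow> real"
  assumes m: "\<And>t. t \<in> {0..T} \<Longrightarrow> f t \<in> borel_measurable F"
    and c: "\<And>\<omega>. \<omega> \<in> space F \<Longrightarrow> continuous_on {0..T} (\<lambda>t. f t \<omega>)" and s: "s \<in> {0..T}"
  shows "(\<lambda>\<omega>. integral {0..s} (\<lambda>t. f t \<omega>)) \<in> borel_measurable F"
proof -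
  have T: "T \<ge> 0" using s by simp
  have "(\<lambda>x. f (max 0 (min T (snd x))) (fst x)) \<in> borel_measurable (F \<Otimes>\<^sub>M borel)"
  proof -
    have "(\<lambda>(t, \<omega>). f (max 0 (min T t)) \<omega>) \<in> borel_measurable (borel \<Otimes>\<^sub>M F)"
      by (rule continuous_param_measurable[OF T m c])
    then show ?thesis by (subst (asm) measurable_pair_swap_iff) (simp add: case_prod_unfold)
  qed
  then have "(\<lambda>(\<omega>, t). indicator {0..s} t *\<^sub>R f (max 0 (min T t)) \<omega>) \<in> borel_measurable (F \<Otimes>\<^sub>M borel)"
    unfolding case_prod_unfold by measurable
  then have "(\<lambda>(\<omega>, t). indicator {0..s} t *\<^sub>R f (max 0 (min T t)) \<omega>) \<in> borel_measurable (F \<Otimes>\<^sub>M lborel)"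
    by (subst measurable_cong_sets[OF sets_pair_measure_cong[OF refl sets_lborel] refl])
  then have "(\<lambda>\<omega>. LINT t|lborel. indicator {0..s} t *\<^sub>R f (max 0 (min T t)) \<omega>) \<in> borel_measurable F"
    by (rule lborel.borel_measurable_lebesgue_integral)
  moreover have "(LINT t|lborel. indicator {0..s} t *\<^sub>R f (max 0 (min T t)) \<omega>) = integral {0..s} (\<lambda>t. f t \<omega>)" if \<omega>: "\<omega> \<in> space F" for \<omega>
  proof -
    have "continuous_on {0..s} (\<lambda>t. f t \<omega>)" by (rule continuous_on_subset[OF c[OF \<omega>]]) (use s in auto)
    then have "set_integrable lborel {0..s} (\<lambda>t. f t \<omega>)" by (rule borel_integrable_atLeastAtMost')
    then have "(LINT t:{0..s}|lborel. f t \<omega>) = integral {0..s} (\<lambda>t. f t \<omega>)" by (rule set_borel_integral_eq_integral(2))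
    moreover have "(LINT t|lborel. indicator {0..s} t *\<^sub>R f (max 0 (min T t)) \<omega>) = (LINT t:{0..s}|lborel. f t \<omega>)"
      unfolding set_lebesgue_integral_def
      by (intro Bochner_Integration.integral_cong refl) (use s in \<open>auto simp: indicator_def min_absorb2 max_absorb2\<close>)
    ultimately show ?thesis by simp
  qed
  ultimately show ?thesis by (subst measurable_cong[where g="\<lambda>\<omega>. LINT t|lborel. indicator {0..s} t *\<^sub>R f (max 0 (min T t)) \<omega>"]) auto
qed

subsection \<open>The localising times\<close>

text \<open>The description uses \<open><\<close>, which is insensitive to whether the infimum is
  attained; the cap at \<open>T\<close> makes the extended real finite.\<close>

lemma S_kappa_range: assumes "T \<ge> 0" shows "S_kappa p T \<kappa> X \<in> {0..T}"
  and S_kappa_less: "S_kappa p T \<kappa> X < t \<longleftrightarrow> T < t \<or> (\<exists>u. 0 \<le> u \<and> u \<le> T \<and> u < t \<and> ennreal \<kappa> \<le> pvar_path p (level p) 0 u X)"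
proof -
  define A where "A = {t. 0 \<le> t \<and> t \<le> T \<and> pvar_path p (level p) 0 t X \<ge> ennreal \<kappa>}"
  define I where "I = min (ereal T) (Inf (ereal ` A))"
  have I: "0 \<le> I" "I \<le> ereal T" unfolding I_def using assms by (auto simp: A_def intro!: Inf_greatest)
  then obtain r where r: "I = ereal r" by (cases I) auto
  have S: "S_kappa p T \<kappa> X = r" using r by (simp add: S_kappa_def I_def A_def)
  show "S_kappa p T \<kappa> X \<in> {0..T}" using I by (simp add: S r)
  have "S_kappa p T \<kappa> X < t \<longleftrightarrow> I < ereal t" by (simp add: S r)
  also have "\<dots> \<longleftrightarrow> T < t \<or> (\<exists>u\<in>A. u < t)" unfolding I_def min_less_iff_disj Inf_less_iff by auto
  finally show "S_kappa p T \<kappa> X < t \<longleftrightarrow> T < t \<or> (\<exists>u. 0 \<le> u \<and> u \<le> T \<and> u < t \<and> ennreal \<kappa> \<le> pvar_path p (level p) 0 u X)"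
    by (auto simp: A_def)
qed

lemma pvar_mono:
  fixes A :: "real \<Rightarrow> real \<Rightarrow> 'a::finite tensor"
  assumes "u \<le> s" "p > 0" shows "pvar p N 0 u A \<le> pvar p N 0 s A"
  unfolding pvar_def psum_def[symmetric]
proof (intro SUP_mono)
  fix k assume k: "k \<in> {1..N}"
  have "(SUP ts\<in>partitions 0 u. ennreal ((\<Sum>i<length ts - 1. level_norm k (A (ts ! i) (ts ! Suc i)) powr (p / real k)) powr (real k / p)))
    \<le> (SUP ts\<in>partitions 0 s. ennreal ((\<Sum>i<length ts - 1. level_norm k (A (ts ! i) (ts ! Suc i)) powr (p / real k)) powr (real k / p)))"
  proof (rule SUP_mono)
    fix ts assume ts: "ts \<in> partitions 0 u"
    obtain ys where ys: "ys \<in> partitions u s" using partitions_ex[OF assms(1)] by blast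
    obtain zs where zs: "zs \<in> partitions 0 s" "\<And>f. psum f zs = psum f ts + psum f ys"
      using partitions_append[OF ts ys] by blast
    define f where "f u v = level_norm k (A u v) powr (p / real k)" for u v
    have nn: "0 \<le> psum f xs" for xs by (intro psum_nonneg) (simp add: f_def)
    have "psum f ts powr (real k / p) \<le> psum f zs powr (real k / p)"
      using assms nn zs(2)[of f] by (intro powr_mono2) auto
    then show "\<exists>zs\<in>partitions 0 s. ennreal ((\<Sum>i<length ts - 1. level_norm k (A (ts ! i) (ts ! Suc i)) powr (p / real k)) powr (real k / p))
        \<le> ennreal ((\<Sum>i<length zs - 1. level_norm k (A (zs ! i) (zs ! Suc i)) powr (p / real k)) powr (real k / p))"
      using zs(1) by (auto simp: psum_def f_def intro!: bexI[of _ zs] ennreal_leI)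
  qed
  then show "\<exists>k'\<in>{1..N}. (SUP ts\<in>partitions 0 u. ennreal ((\<Sum>i<length ts - 1. level_norm k (A (ts ! i) (ts ! Suc i)) powr (p / real k)) powr (real k / p)))
    \<le> (SUP ts\<in>partitions 0 s. ennreal ((\<Sum>i<length ts - 1. level_norm k' (A (ts ! i) (ts ! Suc i)) powr (p / real k')) powr (real k' / p)))"
    using k by blast
qed

text \<open>The variation increases in time, so a time below \<open>t\<close> at which it has
  reached \<kappa> can be moved up to a rational time below \<open>t\<close>. The event is thus a
  countable union.\<close>

lemma S_kappa_measurable:
  fixes X :: "'w \<Rightarrow> real \<Rightarrow> 'a::finite tensor"
  assumes p: "p \<ge> 1" and T: "T \<ge> 0" and X: "\<And>\<omega>. \<omega> \<in> space F \<Longrightarrow> X \<omega> \<in> rough_path_space p T"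
    and meas: "\<And>t w. t \<in> {0..T} \<Longrightarrow> (\<lambda>\<omega>. X \<omega> t w) \<in> borel_measurable F"
  shows "(\<lambda>\<omega>. S_kappa p T \<kappa> (X \<omega>)) \<in> borel_measurable F"
  unfolding borel_measurable_iff_less
proof
  fix t
  define Q where "Q = {q::rat. 0 \<le> real_of_rat q \<and> real_of_rat q \<le> T \<and> real_of_rat q < t}"
  have "S_kappa p T \<kappa> (X \<omega>) < t \<longleftrightarrow> T < t \<or> (\<exists>q\<in>Q. ennreal \<kappa> \<le> pvar_path p (level p) 0 (real_of_rat q) (X \<omega>))" for \<omega>
  proof (cases "T < t")
    case False
    show ?thesis
    proof
      assume "S_kappa p T \<kappa> (X \<omega>) < t"
      then obtain u where u: "0 \<le> u" "u \<le> T" "u < t" "ennreal \<kappa> \<le> pvar_path p (level p) 0 u (X \<omega>)"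
        using False unfolding S_kappa_less[OF T] by blast
      obtain q where q: "u < real_of_rat q" "real_of_rat q < t" using of_rat_dense[OF u(3)] by blast
      have "pvar_path p (level p) 0 u (X \<omega>) \<le> pvar_path p (level p) 0 (real_of_rat q) (X \<omega>)"
        using q p by (intro pvar_mono) auto
      then have "q \<in> Q \<and> ennreal \<kappa> \<le> pvar_path p (level p) 0 (real_of_rat q) (X \<omega>)"
        using u(1,4) q False order.strict_trans1[OF u(1) q(1)] order.trans[OF u(4)] by (simp add: Q_def)
      then show "T < t \<or> (\<exists>q\<in>Q. ennreal \<kappa> \<le> pvar_path p (level p) 0 (real_of_rat q) (X \<omega>))" by blast
    qed (auto simp: S_kappa_less[OF T] Q_def)
  qed (simp add: S_kappa_less[OF T])
  then have "{\<omega> \<in> space F. S_kappa p T \<kappa> (X \<omega>) < t} =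
     (if T < t then space F else (\<Union>q\<in>Q. {\<omega> \<in> space F. ennreal \<kappa> \<le> pvar_path p (level p) 0 (real_of_rat q) (X \<omega>)}))"
    by auto
  moreover have "(\<Union>q\<in>Q. {\<omega> \<in> space F. ennreal \<kappa> \<le> pvar_path p (level p) 0 (real_of_rat q) (X \<omega>)}) \<in> sets F"
  proof (rule sets.countable_UN'[OF countableI_type], clarify)
    fix q assume "q \<in> Q"
    then have q: "real_of_rat q \<in> {0..T}" by (auto simp: Q_def)
    have "(\<lambda>\<omega>. pvar_path p (level p) 0 (real_of_rat q) (X \<omega>)) \<in> borel_measurable F"
      by (rule pvar_measurable[OF p X meas q])
    then show "{\<omega> \<in> space F. ennreal \<kappa> \<le> pvar_path p (level p) 0 (real_of_rat q) (X \<omega>)} \<in> sets F" by measurable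
  qed
  ultimately show "{\<omega> \<in> space F. S_kappa p T \<kappa> (X \<omega>) < t} \<in> sets F" by simp
qed

text \<open>Strictly before the stopping time the variation is below \<kappa> and
  \<open>lift_coord_bound\<close> applies. At the stopping time itself the bound follows by left
  continuity of the coordinates, or from the starting value if that time is
  \<open>0\<close>.\<close>

lemma lift_bound_S_kappa:
  fixes S :: "real \<Rightarrow> 'a::finite tensor"
  assumes L: "is_lyons_lift p T X S" and X: "X \<in> rough_path_space p T" and p: "p \<ge> 1" and T: "T \<ge> 0"
    and \<kappa>: "\<kappa> \<ge> 0" and w: "length w \<le> n" and t: "t \<in> {0..S_kappa p T \<kappa> X}"
  shows "\<bar>S t w\<bar> \<le> lift_bound p \<kappa> n"
proof -
  define s where "s = S_kappa p T \<kappa> X"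
  have s: "s \<in> {0..T}" unfolding s_def by (rule S_kappa_range(1)[OF T])
  have lt: "\<bar>S u w\<bar> \<le> lift_bound p \<kappa> n" if u: "0 \<le> u" "u < s" for u
  proof (rule lift_coord_bound[OF L X p _ _ \<kappa> w])
    show uT: "u \<in> {0..T}" using u s by auto
    show "pvar_path p (level p) 0 u X \<le> ennreal \<kappa>"
    proof (rule ccontr)
      assume "\<not> pvar_path p (level p) 0 u X \<le> ennreal \<kappa>"
      then have "s < s" using u uT unfolding s_def[symmetric] S_kappa_less[OF T, of p \<kappa> X s, folded s_def]
        by (intro disjI2 exI[of _ u]) auto
      then show False by simp
    qed
  qed
  show ?thesis
  proof (cases "t < s")
    case True
    then show ?thesis using lt t by auto
  next
    case False
    then have ts: "t = s" using t by (simp add: s_def)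
    show ?thesis
    proof (cases "s = 0")
      case True
      then show ?thesis using lift_start[OF L] lift_bound_ge_1[OF p, of \<kappa> n] ts by (simp add: tone_def)
    next
      case False
      then have s0: "0 < s" using s by auto
      have "continuous_on {0..s} (\<lambda>t. \<bar>S t w\<bar>)"
        using s by (intro continuous_intros continuous_on_subset[OF lift_coord_continuous[OF L]]) auto
      then have "((\<lambda>t. \<bar>S t w\<bar>) \<longlongrightarrow> \<bar>S s w\<bar>) (at_left s)"
        using s0 continuous_on_Icc_at_leftD by blast
      moreover have "\<forall>\<^sub>F t in at_left s. \<bar>S t w\<bar> \<le> lift_bound p \<kappa> n"
        using eventually_at_left_real[OF s0] by eventually_elim (auto intro: lt)
      ultimately show ?thesis unfolding ts by (rule tendsto_upperbound) simp
    qed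
  qed
qed

lemma S_kappa_eq_T:
  assumes "T \<ge> 0" "p \<ge> 1" "pvar_path p (level p) 0 T (X :: real \<Rightarrow> 'a::finite tensor) < ennreal \<kappa>"
  shows "S_kappa p T \<kappa> X = T"
proof (rule ccontr)
  assume "S_kappa p T \<kappa> X \<noteq> T"
  then have "S_kappa p T \<kappa> X < T" using S_kappa_range(1)[OF assms(1), of p \<kappa> X] by simp
  then obtain u where u: "u \<le> T" "ennreal \<kappa> \<le> pvar_path p (level p) 0 u X"
    unfolding S_kappa_less[OF assms(1)] by auto
  have "pvar_path p (level p) 0 u X \<le> pvar_path p (level p) 0 T X" using u assms by (intro pvar_mono) auto
  with u assms(3) show False by (metis leD order.trans)
qed

subsection \<open>Polynomial norms and truncated exponentials\<close>

text \<open>The sum of absolute coefficients dominates the value at \<open>1\<close> as well as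
  every partial sum of coefficients, and it is submultiplicative.\<close>

definition poly_norm :: "real poly \<Rightarrow> real" where
  "poly_norm q = (\<Sum>n\<le>degree q. \<bar>coeff q n\<bar>)"

lemma poly_norm_eq: "degree q \<le> N \<Longrightarrow> poly_norm q = (\<Sum>n\<le>N. \<bar>coeff q n\<bar>)"
  unfolding poly_norm_def by (rule sum.mono_neutral_left) (auto simp: coeff_eq_0)

lemma poly_1_eq: "degree q \<le> N \<Longrightarrow> poly q 1 = (\<Sum>n\<le>N. coeff q n)" for q :: "real poly"
  by (simp add: poly_altdef) (rule sum.mono_neutral_left, auto simp: coeff_eq_0)

lemma poly_norm_nonneg: "0 \<le> poly_norm q"
  unfolding poly_norm_def by (intro sum_nonneg) auto

lemma coeff_sum_le_poly_norm: "\<bar>\<Sum>n\<le>N. coeff q n\<bar> \<le> poly_norm q"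
proof -
  have "\<bar>\<Sum>n\<le>N. coeff q n\<bar> \<le> (\<Sum>n\<le>N. \<bar>coeff q n\<bar>)" by (rule sum_abs)
  also have "\<dots> \<le> (\<Sum>n\<le>max N (degree q). \<bar>coeff q n\<bar>)" by (rule sum_mono2) auto
  also have "\<dots> = poly_norm q" by (rule poly_norm_eq[symmetric]) simp
  finally show ?thesis .
qed

lemma poly_1_le_poly_norm: "\<bar>poly q 1\<bar> \<le> poly_norm q"
  using coeff_sum_le_poly_norm[of q "degree q"] poly_1_eq[of q "degree q"] by simp

text \<open>Polynomials with coefficients replaced by absolute values have the norms as their values
  at \<open>1\<close>, and evaluation is multiplicative.\<close>

lemma poly_norm_mult: "poly_norm (q * r) \<le> poly_norm q * poly_norm r"
proof -
  define a where "a q = map_poly abs q" for q :: "real poly"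
  have ca: "coeff (a q) n = \<bar>coeff q n\<bar>" for q n by (simp add: a_def coeff_map_poly)
  have da: "degree (a q) \<le> degree q" for q by (rule degree_le) (simp add: ca coeff_eq_0)
  have na: "poly (a q) 1 = poly_norm q" for q
    using poly_1_eq[OF da[of q]] by (simp add: ca poly_norm_def)
  have "poly_norm (q * r) = (\<Sum>n\<le>degree q + degree r. \<bar>\<Sum>i\<le>n. coeff q i * coeff r (n - i)\<bar>)"
    by (subst poly_norm_eq[OF degree_mult_le]) (simp add: coeff_mult)
  also have "\<dots> \<le> (\<Sum>n\<le>degree q + degree r. coeff (a q * a r) n)"
    unfolding coeff_mult ca by (intro sum_mono order.trans[OF sum_abs]) (simp add: abs_mult)
  also have "\<dots> = poly (a q * a r) 1"
    using da[of q] da[of r] degree_mult_le[of "a q" "a r"] by (intro poly_1_eq[symmetric]) linarith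
  also have "\<dots> = poly_norm q * poly_norm r" by (simp add: na)
  finally show ?thesis .
qed

lemma poly_norm_power: "poly_norm (q ^ r) \<le> poly_norm q ^ r"
proof (induction r)
  case 0
  then show ?case by (simp add: poly_norm_def)
next
  case (Suc r)
  have "poly_norm (q ^ Suc r) \<le> poly_norm q * poly_norm (q ^ r)" by (simp add: poly_norm_mult)
  also have "\<dots> \<le> poly_norm q * poly_norm q ^ r" by (intro mult_left_mono Suc poly_norm_nonneg)
  finally show ?case by simp
qed

lemma poly_norm_smult: "poly_norm (smult c q) = \<bar>c\<bar> * poly_norm q"
  by (subst poly_norm_eq[of _ "degree q"]) (auto simp: poly_norm_def abs_mult sum_distrib_left degree_smult_le)

text \<open>A term with \<open>r <= N div D\<close> has degree at most \<open>N\<close> and is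
  summed completely. Each later term, cut in its coefficients or omitted because
  \<open>r > N\<close>, is off by at most \<open>2 * B r\<close>.\<close>

lemma truncated_series:
  assumes deg: "\<And>r. degree (A r) \<le> r * D" and nrm: "\<And>r. poly_norm (A r) \<le> B r" and sm: "summable B" and D: "D > 0"
  shows "\<bar>(\<Sum>r\<le>N. \<Sum>n\<le>N. coeff (A r) n) - (\<Sum>r. poly (A r) 1)\<bar> \<le> 2 * (\<Sum>r. B (r + Suc (N div D)))"
proof -
  define R where "R = Suc (N div D)"
  define c where "c r = (if r \<le> N then \<Sum>n\<le>N. coeff (A r) n else 0) - poly (A r) 1" for r
  have B: "0 \<le> B r" for r using nrm[of r] poly_norm_nonneg order.trans by blast
  have c_le: "\<bar>c r\<bar> \<le> 2 * B r" for r
    using coeff_sum_le_poly_norm[of "A r" N] poly_1_le_poly_norm[of "A r"] nrm[of r] B[of r] unfolding c_def by auto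
  have c0: "c r = 0" if "r < R" for r
  proof -
    have "r * D \<le> N div D * D" using that by (intro mult_right_mono) (auto simp: R_def)
    also have "\<dots> \<le> N" by (rule div_times_less_eq_dividend)
    finally have "r * D \<le> N" .
    moreover have "r \<le> r * D" using D by simp
    then have "r \<le> N" using \<open>r * D \<le> N\<close> by linarith
    ultimately show ?thesis using deg[of r] poly_1_eq[of "A r" N] unfolding c_def by simp
  qed
  have smA: "summable (\<lambda>r. poly (A r) 1)"
    by (rule summable_comparison_test'[OF sm, of 0]) (use poly_1_le_poly_norm nrm order.trans in fastforce)
  have smc: "summable (\<lambda>r. \<bar>c r\<bar>)"
    by (rule summable_comparison_test'[OF summable_mult[OF sm, of 2], of 0]) (use c_le in auto)
  have smf: "(\<lambda>r. if r \<le> N then \<Sum>n\<le>N. coeff (A r) n else 0) sums (\<Sum>r\<le>N. \<Sum>n\<le>N. coeff (A r) n)"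
    using sums_finite[of "{..N}" "\<lambda>r. if r \<le> N then \<Sum>n\<le>N. coeff (A r) n else 0"] by simp
  have "(\<Sum>r\<le>N. \<Sum>n\<le>N. coeff (A r) n) - (\<Sum>r. poly (A r) 1) = (\<Sum>r. c r)"
    unfolding c_def using sums_diff[OF smf summable_sums[OF smA]] by (simp add: sums_iff)
  also have "\<dots> = (\<Sum>r. c (r + R)) + (\<Sum>r<R. c r)"
    by (rule suminf_split_initial_segment) (use smc summable_rabs_cancel in blast)
  also have "\<dots> = (\<Sum>r. c (r + R))" using c0 by simp
  also have "\<bar>\<dots>\<bar> \<le> (\<Sum>r. \<bar>c (r + R)\<bar>)"
    by (rule summable_rabs) (use smc summable_ignore_initial_segment in blast)
  also have "\<dots> \<le> (\<Sum>r. 2 * B (r + R))"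
    using smc sm by (intro suminf_le c_le summable_mult) (auto intro: summable_ignore_initial_segment[where f="\<lambda>r. \<bar>c r\<bar>"] summable_ignore_initial_segment)
  also have "\<dots> = 2 * (\<Sum>r. B (r + R))"
    by (rule suminf_mult) (use sm summable_ignore_initial_segment in blast)
  finally show ?thesis unfolding R_def .
qed

subsection \<open>The shuffle exponential of the hazard rate\<close>

text \<open>The exponent in the payoff. Every word in it ends with the time letter, so it has no
  constant term and the factor \<open>exp (l [])\<close> in \<open>shuffle_exp\<close> is
  \<open>1\<close>.\<close>

definition neg_square :: "'a option tensor \<Rightarrow> 'a option tensor" where
  "neg_square l = (\<lambda>w. - snoc_letter (shuffle_prod l l) None w)"

lemma neg_square_nonzero: "neg_square l w \<noteq> 0 \<Longrightarrow> \<exists>v. w = v @ [None] \<and> shuffle_prod l l v \<noteq> 0"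
  unfolding neg_square_def snoc_letter_def
  by (auto split: if_splits) (metis append_butlast_last_id)

lemma neg_square_snoc [simp]: "neg_square l (w @ [None]) = - shuffle_prod l l w"
  by (simp add: neg_square_def snoc_letter_def)

lemma neg_square_tfin:
  fixes l :: "'a::finite option tensor"
  assumes "l \<in> tfin" shows "neg_square l \<in> tfin" "tdeg (neg_square l) \<le> 2 * tdeg l + 1"
proof -
  have *: "length w \<le> 2 * tdeg l + 1" if w: "neg_square l w \<noteq> 0" for w
  proof -
    obtain v where v: "w = v @ [None]" "shuffle_prod l l v \<noteq> 0" using neg_square_nonzero[OF w] by blast
    show ?thesis using shuffle_prod_nonzero[OF v(2) assms assms] v(1) by simp
  qed
  show t: "neg_square l \<in> tfin" by (rule tfinI[OF *])
  show "tdeg (neg_square l) \<le> 2 * tdeg l + 1" by (rule tdeg_leI[OF t *])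
qed

lemma level_pairing_neg_square_0: "level_pairing 0 (neg_square l) a = 0"
  by (simp add: level_pairing_def neg_square_def snoc_letter_def)

lemma level_pairing_neg_square_Suc:
  fixes l :: "'a::finite option tensor"
  shows "level_pairing (Suc n) (neg_square l) a = - (\<Sum>w | length w = n. shuffle_prod l l w * a (w @ [None]))"
proof -
  have "level_pairing (Suc n) (neg_square l) a = (\<Sum>w\<in>(\<lambda>w. w @ [None]) ` {w. length w = n}. neg_square l w * a w)"
    unfolding level_pairing_def
  proof (rule sum.mono_neutral_right)
    show "\<forall>w\<in>{w. length w = Suc n} - (\<lambda>w. w @ [None]) ` {w. length w = n}. neg_square l w * a w = 0"
      using neg_square_nonzero[of l] by fastforce
  qed auto
  also have "\<dots> = (\<Sum>w | length w = n. neg_square l (w @ [None]) * a (w @ [None]))"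
    by (subst sum.reindex) (auto intro: inj_onI)
  finally show ?thesis by (simp add: sum_negf)
qed

text \<open>Each factor without constant term contributes at least one letter. On words up to length
  \<open>N\<close> the exponential series therefore ends at \<open>r = N\<close>.\<close>

lemma shuffle_power_short:
  fixes m :: "'a::finite tensor"
  assumes "m [] = 0" "(shuffle_prod m ^^ r) tone u \<noteq> 0" shows "r \<le> length u"
  using assms(2)
proof (induction r arbitrary: u)
  case (Suc r)
  obtain w v where wv: "length w + length v = length u" "m w * (shuffle_prod m ^^ r) tone v * real (count (shuffle_word w v) u) \<noteq> 0"
    using Suc.prems unfolding funpow.simps o_def shuffle_prod_def[of m "(shuffle_prod m ^^ r) tone"]
    by (auto elim!: sum.not_neutral_contains_not_neutral)
  then have "r \<le> length v" "w \<noteq> []" using assms(1) by (auto intro!: Suc.IH)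
  then show ?case using wv(1) by (cases w) auto
qed simp

lemma shuffle_power_tfin: "m \<in> tfin \<Longrightarrow> (shuffle_prod m ^^ r) tone \<in> tfin" for m :: "'a::finite tensor"
proof (induction r)
  case 0
  then show ?case by (simp add: tfin_def tone_def)
qed (simp add: shuffle_prod_tfin)

lemma pairing_poly_tone: "a [] = 1 \<Longrightarrow> pairing_poly tone a = 1"
proof -
  assume a: "a [] = 1"
  have "tone \<in> (tfin :: 'a tensor set)" by (auto simp: tone_def tfin_def)
  then have "tdeg (tone :: 'a tensor) \<le> 0" by (rule tdeg_leI) (auto simp: tone_def split: if_splits)
  then show ?thesis using a by (simp add: pairing_poly_def level_pairing_def tone_def monom_0 flip: one_poly_eq_simps(1))
qed

lemma pairing_poly_power:
  fixes a :: "'a::finite tensor"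
  assumes "character a" "m \<in> tfin"
  shows "pairing_poly ((shuffle_prod m ^^ r) tone) a = pairing_poly m a ^ r"
  using assms by (induction r) (auto simp: pairing_poly_tone character_Nil pairing_poly_shuffle shuffle_power_tfin)

text \<open>Shuffle powers pair to powers of the polynomial, and truncating the signature means
  keeping the coefficients up to \<open>N\<close>. The bound \<open>N\<close> on \<open>r\<close>
  loses nothing by \<open>shuffle_power_short\<close>.\<close>

lemma pairing_shuffle_exp_trunc:
  fixes a :: "'a::finite tensor"
  assumes a: "character a" and m: "m \<in> tfin" "m [] = 0"
  shows "pairing (shuffle_exp m) (ttrunc N a) = (\<Sum>r\<le>N. \<Sum>n\<le>N. coeff (smult (1 / fact r) (pairing_poly m a ^ r)) n)"
proof -
  have m0: "m([] := 0) = m" using m(2) by auto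
  have se: "shuffle_exp m u = (\<Sum>r\<le>N. (shuffle_prod m ^^ r) tone u / fact r)" if "length u \<le> N" for u
  proof -
    have "(\<Sum>r. (shuffle_prod m ^^ r) tone u / fact r) = (\<Sum>r\<le>N. (shuffle_prod m ^^ r) tone u / fact r)"
    proof (rule suminf_finite)
      fix r assume "r \<notin> {..N}"
      then show "(shuffle_prod m ^^ r) tone u / fact r = 0"
        using shuffle_power_short[of m r u, OF m(2)] that by force
    qed simp
    then show ?thesis unfolding shuffle_exp_def m0 using m(2) by simp
  qed
  have "pairing (shuffle_exp m) (ttrunc N a) = (\<Sum>u | length u \<le> N. shuffle_exp m u * ttrunc N a u)"
    by (rule pairing_eq_sum) (auto simp: ttrunc_def split: if_splits)
  also have "\<dots> = (\<Sum>u | length u \<le> N. \<Sum>r\<le>N. 1 / fact r * ((shuffle_prod m ^^ r) tone u * a u))"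
    by (intro sum.cong refl) (simp add: se ttrunc_def sum_distrib_right)
  also have "\<dots> = (\<Sum>r\<le>N. 1 / fact r * (\<Sum>u | length u \<le> N. (shuffle_prod m ^^ r) tone u * a u))"
    by (subst sum.swap) (simp add: sum_distrib_left)
  also have "\<dots> = (\<Sum>r\<le>N. 1 / fact r * (\<Sum>n\<le>N. coeff (pairing_poly m a ^ r) n))"
    unfolding sum_words_le level_pairing_def[symmetric]
    by (simp add: coeff_pairing_poly[OF shuffle_power_tfin[OF m(1)], symmetric] pairing_poly_power[OF a m(1)])
  finally show ?thesis by (simp add: sum_distrib_left)
qed

lemma continuous_on_coeff_mult:
  assumes "\<And>n. continuous_on A (\<lambda>t. coeff (p t) n :: real)" "\<And>n. continuous_on A (\<lambda>t. coeff (q t) n)"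
  shows "continuous_on A (\<lambda>t. coeff (p t * q t) n)"
  unfolding coeff_mult by (intro continuous_intros assms)

lemma continuous_on_coeff_power:
  assumes "\<And>n. continuous_on A (\<lambda>t. coeff (p t) n :: real)"
  shows "continuous_on A (\<lambda>t. coeff (p t ^ r) n)"
proof (induction r arbitrary: n)
  case (Suc r)
  then show ?case unfolding power_Suc by (intro continuous_on_coeff_mult assms)
qed (simp add: coeff_1)

lemma measurable_coeff_mult:
  assumes "\<And>n. (\<lambda>t. coeff (p t) n :: real) \<in> borel_measurable A" "\<And>n. (\<lambda>t. coeff (q t) n) \<in> borel_measurable A"
  shows "(\<lambda>t. coeff (p t * q t) n) \<in> borel_measurable A"
  unfolding coeff_mult by (intro borel_measurable_sum borel_measurable_times assms)

lemma measurable_coeff_power: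
  assumes "\<And>n. (\<lambda>t. coeff (p t) n :: real) \<in> borel_measurable A"
  shows "(\<lambda>t. coeff (p t ^ r) n) \<in> borel_measurable A"
proof (induction r arbitrary: n)
  case (Suc r)
  then show ?case unfolding power_Suc by (intro measurable_coeff_mult assms)
qed (simp add: coeff_1)

text \<open>At \<open>1\<close> this polynomial takes minus the hazard rate as its value; it is the time derivative of
  \<open>pairing_poly (neg_square l) (S t)\<close>.\<close>

definition hazard_poly :: "'a option tensor \<Rightarrow> (real \<Rightarrow> 'a option tensor) \<Rightarrow> real \<Rightarrow> real poly" where
  "hazard_poly l S t = pCons 0 (- (pairing_poly l (S t))\<^sup>2)"

text \<open>Termwise time derivative of the truncated exponential, from
  \<open>(P^r / r!)' = r P^(r-1) P' / r!\<close>. At \<open>r = 0\<close>, where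
  \<open>r - 1\<close> is \<open>0\<close>, the factor \<open>real r\<close> removes the
  term.\<close>

definition trunc_exp_deriv :: "'a option tensor \<Rightarrow> nat \<Rightarrow> (real \<Rightarrow> 'a option tensor) \<Rightarrow> real \<Rightarrow> real" where
  "trunc_exp_deriv l N S t =
    (\<Sum>r\<le>N. \<Sum>n\<le>N. coeff (smult (real r / fact r) (pairing_poly (neg_square l) (S t) ^ (r - 1) * hazard_poly l S t)) n)"

definition cum_hazard :: "'a tensor \<Rightarrow> (real \<Rightarrow> 'a tensor) \<Rightarrow> real \<Rightarrow> real" where
  "cum_hazard l S t = integral {0..t} (\<lambda>s. (pairing l (S s))\<^sup>2)"

text \<open>The integral of \<open>exp (- cum_hazard)\<close> against \<open>y\<close> over
  \<open>[0, s]\<close>, by parts; the integrand equals \<open>1\<close> at time \<open>0\<close>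
  and has derivative minus itself times the squared pairing.\<close>

definition exp_payoff :: "'a tensor \<Rightarrow> (real \<Rightarrow> 'a tensor) \<Rightarrow> (real \<Rightarrow> real) \<Rightarrow> real \<Rightarrow> real" where
  "exp_payoff l S y s = exp (- cum_hazard l S s) * y s - y 0
     + integral {0..s} (\<lambda>t. y t * (exp (- cum_hazard l S t) * (pairing l (S t))\<^sup>2))"

text \<open>Here \<open>q\<close> bounds the norm of the squared pairing polynomial and
  \<open>Q\<close> that of the exponent, which has at most \<open>2 * k + 2\<close> coefficients,
  each at most \<open>T * q\<close>; \<open>R\<close> is the first power that may be cut. The
  \<open>4\<close> is the \<open>2\<close> of \<open>truncated_series\<close> at both boundary
  terms, and \<open>2 * T\<close> belongs to the derivative integrated over at most
  \<open>T\<close>.\<close>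

definition pay_bound :: "real \<Rightarrow> real \<Rightarrow> real \<Rightarrow> nat \<Rightarrow> nat \<Rightarrow> real" where
  "pay_bound T K B k N = (let q = (K * B)\<^sup>2; Q = (2 * real k + 2) * (T * q); R = Suc (N div (2 * k + 1)) in
     4 * (\<Sum>r. Q ^ (r + R) / fact (r + R)) + 2 * T * (\<Sum>r. real (r + R) / fact (r + R) * (Q ^ (r + R - 1) * q)))"

section \<open>Exponential series and their tails\<close>

lemma summable_exp_terms: "summable (\<lambda>r. Q ^ r / fact r)" for Q :: real
  using summable_exp[of Q] by (simp add: divide_inverse mult.commute)

lemma exp_deriv_terms: "real (Suc r) / fact (Suc r) * (Q ^ (Suc r - 1) * q) = q * (Q ^ r / fact r)" for Q q :: real
  by (simp add: fact_Suc del: of_nat_Suc)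

lemma summable_exp_deriv_terms: "summable (\<lambda>r. real r / fact r * (Q ^ (r - 1) * q))" for Q q :: real
  by (subst summable_Suc_iff[symmetric], subst exp_deriv_terms) (intro summable_mult summable_exp_terms)

lemma exp_deriv_series: "(\<lambda>r. real r / fact r * (x ^ (r - 1) * y)) sums (exp x * y)" for x y :: real
proof -
  have "(\<lambda>r. y * (x ^ r / fact r)) sums (y * exp x)"
    using exp_converges[of x] by (intro sums_mult) (simp add: divide_inverse mult.commute)
  then have "(\<lambda>r. real (Suc r) / fact (Suc r) * (x ^ (Suc r - 1) * y)) sums (exp x * y)"
    unfolding exp_deriv_terms by (simp add: mult.commute)
  then show ?thesis by (subst (asm) sums_Suc_iff) simp
qed

lemma pay_bound_tendsto: "(\<lambda>N. pay_bound T K B k N) \<longlonglongrightarrow> 0"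
proof -
  define q where "q = (K * B)\<^sup>2"
  define Q where "Q = (2 * real k + 2) * (T * q)"
  have tail: "(\<lambda>N. \<Sum>r. f (r + Suc (N div (2 * k + 1)))) \<longlonglongrightarrow> 0" if "summable f" for f :: "nat \<Rightarrow> real"
  proof -
    have "filterlim (\<lambda>N. Suc (N div (2 * k + 1))) sequentially sequentially"
      unfolding filterlim_at_top
    proof
      fix Z
      show "\<forall>\<^sub>F N in sequentially. Z \<le> Suc (N div (2 * k + 1))"
        using eventually_ge_at_top[of "Z * (2 * k + 1)"]
      proof eventually_elim
        case (elim N)
        then have "Z \<le> N div (2 * k + 1)" by (simp add: less_eq_div_iff_mult_less_eq)
        then show ?case by simp
      qed
    qed
    from filterlim_compose[OF suminf_exist_split2[OF that] this] show ?thesis by (simp add: o_def)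
  qed
  have "(\<lambda>N. 4 * (\<Sum>r. Q ^ (r + Suc (N div (2 * k + 1))) / fact (r + Suc (N div (2 * k + 1))))
     + 2 * T * (\<Sum>r. real (r + Suc (N div (2 * k + 1))) / fact (r + Suc (N div (2 * k + 1))) * (Q ^ (r + Suc (N div (2 * k + 1)) - 1) * q))) \<longlonglongrightarrow> 4 * 0 + 2 * T * 0"
    by (intro tendsto_add tendsto_mult tendsto_const tail[OF summable_exp_terms] tail[OF summable_exp_deriv_terms])
  then show ?thesis unfolding pay_bound_def Let_def q_def[symmetric] Q_def[symmetric] by simp
qed

text \<open>All that the pathwise analysis uses of a signature: character values, continuous
  coordinates, and integration in time by the time letter.\<close>

locale time_lift =
  fixes T :: real and S :: "real \<Rightarrow> ('d::finite option) tensor"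
  assumes T: "T > 0"
    and ch: "t \<in> {0..T} \<Longrightarrow> character (S t)"
    and cont: "continuous_on {0..T} (\<lambda>t. S t w)"
    and time: "t \<in> {0..T} \<Longrightarrow> S t (w @ [None]) = integral {0..t} (\<lambda>s. S s w)"
begin

lemma coord_deriv:
  assumes t: "t \<in> {0<..<T}" shows "((\<lambda>t. S t (w @ [None])) has_real_derivative S t w) (at t)"
proof -
  have "((\<lambda>u. integral {0..u} (\<lambda>s. S s w)) has_real_derivative S t w) (at t)"
    using integral_has_real_derivative[OF cont, of t w] t by (simp add: at_within_Icc_at)
  then show ?thesis
    by (rule has_field_derivative_transform_within_open[where S="{0<..<T}"]) (use t time in auto)
qed

lemma coeff_continuous: "l \<in> tfin \<Longrightarrow> continuous_on {0..T} (\<lambda>t. coeff (pairing_poly l (S t)) n)"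
  unfolding coeff_pairing_poly level_pairing_def by (intro continuous_intros cont)

lemma pairing_continuous: "l \<in> tfin \<Longrightarrow> continuous_on {0..T} (\<lambda>t. pairing l (S t))"
proof -
  assume l: "l \<in> tfin"
  have "pairing l (S t) = (\<Sum>n\<le>tdeg l. coeff (pairing_poly l (S t)) n)" for t
    by (simp add: pairing_eq_poly[OF l] poly_1_eq[OF degree_pairing_poly])
  then show ?thesis by (simp add: coeff_continuous[OF l] continuous_on_sum)
qed

lemma hazard_coeff_continuous:
  "l \<in> tfin \<Longrightarrow> continuous_on {0..T} (\<lambda>t. coeff (hazard_poly l S t) n)"
  unfolding hazard_poly_def coeff_pCons
  by (cases n) (auto intro!: continuous_intros continuous_on_coeff_power coeff_continuous)

lemma trunc_exp_deriv_continuous: "l \<in> tfin \<Longrightarrow> continuous_on {0..T} (trunc_exp_deriv l N S)"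
  unfolding trunc_exp_deriv_def[abs_def] coeff_smult
  by (intro continuous_intros continuous_on_coeff_mult continuous_on_coeff_power coeff_continuous hazard_coeff_continuous neg_square_tfin)

text \<open>Differentiation removes the final time letter and so lowers the word length by one. The
  shift \<open>pCons 0\<close> in \<open>hazard_poly\<close> restores it, so that coefficients with
  equal index correspond.\<close>

lemma neg_square_deriv:
  assumes l: "l \<in> tfin" and t: "t \<in> {0<..<T}"
  shows "((\<lambda>t. coeff (pairing_poly (neg_square l) (S t)) n) has_real_derivative coeff (hazard_poly l S t) n) (at t)"
proof (cases n)
  case 0
  then show ?thesis by (simp add: coeff_pairing_poly[OF neg_square_tfin(1)[OF l]] level_pairing_neg_square_0 hazard_poly_def)
next
  case (Suc k)
  have "t \<in> {0..T}" using t by auto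
  then have "coeff (hazard_poly l S t) n = - (\<Sum>w | length w = k. shuffle_prod l l w * S t w)"
    by (simp add: hazard_poly_def Suc power2_eq_square pairing_poly_shuffle[symmetric] ch l
        coeff_pairing_poly shuffle_prod_tfin level_pairing_def)
  then show ?thesis
    unfolding coeff_pairing_poly[OF neg_square_tfin(1)[OF l]] Suc level_pairing_neg_square_Suc
    by (auto intro!: derivative_eq_intros coord_deriv t sum.cong simp: mult.commute)
qed

lemma neg_square_power_deriv:
  assumes l: "l \<in> tfin" and t: "t \<in> {0<..<T}"
  shows "((\<lambda>t. coeff (pairing_poly (neg_square l) (S t) ^ r) n) has_real_derivative
    coeff (smult (real r) (pairing_poly (neg_square l) (S t) ^ (r - 1) * hazard_poly l S t)) n) (at t)"
proof (induction r arbitrary: n)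
  case (Suc r)
  define P where "P = (\<lambda>t. pairing_poly (neg_square l) (S t))"
  define H where "H = hazard_poly l S t"
  have "((\<lambda>t. \<Sum>i\<le>n. coeff (P t) i * coeff (P t ^ r) (n - i)) has_real_derivative
    (\<Sum>i\<le>n. coeff H i * coeff (P t ^ r) (n - i) + coeff (smult (real r) (P t ^ (r - 1) * H)) (n - i) * coeff (P t) i)) (at t)"
    unfolding P_def H_def by (intro DERIV_sum DERIV_mult neg_square_deriv[OF l t] Suc.IH)
  also have "(\<Sum>i\<le>n. coeff H i * coeff (P t ^ r) (n - i) + coeff (smult (real r) (P t ^ (r - 1) * H)) (n - i) * coeff (P t) i)
     = coeff (H * P t ^ r + P t * smult (real r) (P t ^ (r - 1) * H)) n"
    unfolding coeff_add coeff_mult[of H] coeff_mult[of "P t" "smult (real r) (P t ^ (r - 1) * H)"] sum.distrib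
    by (simp only: mult.commute)
  also have "H * P t ^ r + P t * smult (real r) (P t ^ (r - 1) * H) = smult (real (Suc r)) (P t ^ (Suc r - 1) * H)"
  proof -
    have "P t * smult (real r) (P t ^ (r - 1) * H) = smult (real r) (P t ^ r * H)"
      by (cases r) (simp_all add: mult.assoc del: of_nat_Suc)
    moreover have "smult (real (Suc r)) (P t ^ r * H) = P t ^ r * H + smult (real r) (P t ^ r * H)"
      by (simp add: smult_add_left)
    ultimately show ?thesis by (simp add: mult.commute)
  qed
  finally show ?case by (simp add: P_def H_def coeff_mult)
qed simp

lemma trunc_exp_eq:
  assumes "l \<in> tfin" "t \<in> {0..T}"
  shows "pairing (shuffle_exp (neg_square l)) (ttrunc N (S t)) =
    (\<Sum>r\<le>N. \<Sum>n\<le>N. coeff (smult (1 / fact r) (pairing_poly (neg_square l) (S t) ^ r)) n)"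
  using assms by (intro pairing_shuffle_exp_trunc ch neg_square_tfin) (auto simp: neg_square_def snoc_letter_def)

lemma trunc_exp_continuous:
  assumes "l \<in> tfin"
  shows "continuous_on {0..T} (\<lambda>t. pairing (shuffle_exp (neg_square l)) (ttrunc N (S t)))"
proof -
  have "continuous_on {0..T} (\<lambda>t. \<Sum>r\<le>N. \<Sum>n\<le>N. coeff (smult (1 / fact r) (pairing_poly (neg_square l) (S t) ^ r)) n)"
    unfolding coeff_smult by (intro continuous_intros continuous_on_coeff_power coeff_continuous neg_square_tfin assms)
  then show ?thesis by (rule continuous_on_eq) (simp add: trunc_exp_eq assms)
qed

lemma trunc_exp_has_deriv:
  assumes l: "l \<in> tfin" and t: "t \<in> {0<..<T}"
  shows "deriv (\<lambda>t. pairing (shuffle_exp (neg_square l)) (ttrunc N (S t))) t = trunc_exp_deriv l N S t"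
proof -
  have "((\<lambda>t. \<Sum>r\<le>N. \<Sum>n\<le>N. 1 / fact r * coeff (pairing_poly (neg_square l) (S t) ^ r) n) has_real_derivative
     (\<Sum>r\<le>N. \<Sum>n\<le>N. 1 / fact r * coeff (smult (real r) (pairing_poly (neg_square l) (S t) ^ (r - 1) * hazard_poly l S t)) n)) (at t)"
    by (intro DERIV_sum DERIV_cmult neg_square_power_deriv[OF l t])
  then have "((\<lambda>t. pairing (shuffle_exp (neg_square l)) (ttrunc N (S t))) has_real_derivative
     (\<Sum>r\<le>N. \<Sum>n\<le>N. 1 / fact r * coeff (smult (real r) (pairing_poly (neg_square l) (S t) ^ (r - 1) * hazard_poly l S t)) n)) (at t)"
    by (rule has_field_derivative_transform_within_open[where S="{0<..<T}"]) (use t in \<open>auto simp: trunc_exp_eq[OF l]\<close>)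
  then show ?thesis by (simp add: DERIV_imp_deriv trunc_exp_deriv_def)
qed

lemma neg_square_coeff_Suc:
  assumes l: "l \<in> tfin" and t: "t \<in> {0..T}"
  shows "coeff (pairing_poly (neg_square l) (S t)) (Suc n) = - integral {0..t} (\<lambda>s. coeff ((pairing_poly l (S s))\<^sup>2) n)"
proof -
  have int: "(\<lambda>s. S s w) integrable_on {0..t}" for w
    by (intro integrable_continuous_real continuous_on_subset[OF cont]) (use t in auto)
  have "coeff (pairing_poly (neg_square l) (S t)) (Suc n) = - (\<Sum>w | length w = n. shuffle_prod l l w * integral {0..t} (\<lambda>s. S s w))"
    by (simp add: coeff_pairing_poly[OF neg_square_tfin(1)[OF l]] level_pairing_neg_square_Suc time[OF t])
  also have "(\<Sum>w | length w = n. shuffle_prod l l w * integral {0..t} (\<lambda>s. S s w)) = integral {0..t} (\<lambda>s. \<Sum>w | length w = n. shuffle_prod l l w * S s w)"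
    by (subst integral_sum) (auto intro!: int integrable_on_mult_right)
  also have "\<dots> = integral {0..t} (\<lambda>s. coeff ((pairing_poly l (S s))\<^sup>2) n)"
    using t by (intro integral_cong) (simp add: power2_eq_square pairing_poly_shuffle[symmetric] ch l
        coeff_pairing_poly shuffle_prod_tfin level_pairing_def)
  finally show ?thesis .
qed

lemma square_coeff_continuous:
  "l \<in> tfin \<Longrightarrow> t \<le> T \<Longrightarrow> continuous_on {0..t} (\<lambda>s. coeff ((pairing_poly l (S s))\<^sup>2) n)"
  by (rule continuous_on_subset[OF continuous_on_coeff_power[OF coeff_continuous]]) auto

lemma neg_square_poly_1:
  assumes l: "l \<in> tfin" and t: "t \<in> {0..T}"
  shows "poly (pairing_poly (neg_square l) (S t)) 1 = - cum_hazard l S t"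
proof -
  define D where "D = 2 * tdeg l"
  have "degree (pairing_poly (neg_square l) (S t)) \<le> Suc D"
    using degree_pairing_poly[of "neg_square l" "S t"] neg_square_tfin(2)[OF l] by (simp add: D_def)
  then have "poly (pairing_poly (neg_square l) (S t)) 1 = (\<Sum>n\<le>Suc D. coeff (pairing_poly (neg_square l) (S t)) n)"
    by (rule poly_1_eq)
  also have "\<dots> = (\<Sum>n\<le>D. coeff (pairing_poly (neg_square l) (S t)) (Suc n))"
    by (subst sum.atMost_Suc_shift) (simp add: coeff_pairing_poly[OF neg_square_tfin(1)[OF l]] level_pairing_neg_square_0)
  also have "\<dots> = - (\<Sum>n\<le>D. integral {0..t} (\<lambda>s. coeff ((pairing_poly l (S s))\<^sup>2) n))"
    by (simp add: neg_square_coeff_Suc[OF l t] sum_negf)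
  also have "(\<Sum>n\<le>D. integral {0..t} (\<lambda>s. coeff ((pairing_poly l (S s))\<^sup>2) n)) = integral {0..t} (\<lambda>s. \<Sum>n\<le>D. coeff ((pairing_poly l (S s))\<^sup>2) n)"
    by (subst integral_sum) (use t in \<open>auto intro!: integrable_continuous_real square_coeff_continuous l\<close>)
  also have "\<dots> = cum_hazard l S t"
    unfolding cum_hazard_def
  proof (intro integral_cong)
    fix s
    have "degree ((pairing_poly l (S s))\<^sup>2) \<le> D"
      using degree_power_le[of "pairing_poly l (S s)" 2] degree_pairing_poly[of l "S s"] by (simp add: D_def)
    then show "(\<Sum>n\<le>D. coeff ((pairing_poly l (S s))\<^sup>2) n) = (pairing l (S s))\<^sup>2"
      by (simp add: poly_1_eq[symmetric] pairing_eq_poly[OF l])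
  qed
  finally show ?thesis .
qed

lemma hazard_poly_1:
  "l \<in> tfin \<Longrightarrow> poly (hazard_poly l S t) 1 = - (pairing l (S t))\<^sup>2"
  by (simp add: hazard_poly_def pairing_eq_poly)

lemma cum_hazard_continuous: "l \<in> tfin \<Longrightarrow> continuous_on {0..T} (cum_hazard l S)"
  unfolding cum_hazard_def[abs_def]
  by (intro indefinite_integral_continuous_1 integrable_continuous_real continuous_intros pairing_continuous)

lemma cum_hazard_deriv:
  assumes "l \<in> tfin" "t \<in> {0<..<T}"
  shows "(cum_hazard l S has_real_derivative (pairing l (S t))\<^sup>2) (at t)"
proof -
  have "continuous_on {0..T} (\<lambda>s. (pairing l (S s))\<^sup>2)"
    by (intro continuous_intros pairing_continuous assms)
  from integral_has_real_derivative[OF this, of t] show ?thesis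
    unfolding cum_hazard_def[abs_def] using assms(2) by (simp add: at_within_Icc_at)
qed

lemma density_integral:
  assumes l: "l \<in> tfin" and s: "s \<in> {0..T}"
  shows "((\<lambda>t. exp (- cum_hazard l S t) * (pairing l (S t))\<^sup>2) has_integral (1 - exp (- cum_hazard l S s))) {0..s}"
proof -
  have "((\<lambda>t. exp (- cum_hazard l S t) * (pairing l (S t))\<^sup>2) has_integral ((- exp (- cum_hazard l S s)) - (- exp (- cum_hazard l S 0)))) {0..s}"
  proof (rule fundamental_theorem_of_calculus_interior)
    show "0 \<le> s" using s by simp
    show "continuous_on {0..s} (\<lambda>t. - exp (- cum_hazard l S t))"
      using s by (intro continuous_intros continuous_on_subset[OF cum_hazard_continuous[OF l]]) auto
    fix t assume "t \<in> {0<..<s}"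
    then have t: "t \<in> {0<..<T}" using s by auto
    show "((\<lambda>t. - exp (- cum_hazard l S t)) has_vector_derivative exp (- cum_hazard l S t) * (pairing l (S t))\<^sup>2) (at t)"
      unfolding has_real_derivative_iff_has_vector_derivative[symmetric]
      by (auto intro!: derivative_eq_intros cum_hazard_deriv[OF l t])
  qed
  then show ?thesis by (simp add: cum_hazard_def)
qed

text \<open>The weight at time \<open>s\<close> and the density up to \<open>s\<close> have total
  mass \<open>1\<close> by \<open>density_integral\<close>, so together they contribute at most
  \<open>C\<close>, and \<open>y 0\<close> adds another \<open>C\<close>. The bound is independent
  of \<open>l\<close>.\<close>

lemma exp_payoff_bound:
  assumes l: "l \<in> tfin" and s: "s \<in> {0..T}" and y: "\<And>t. t \<in> {0..T} \<Longrightarrow> \<bar>y t\<bar> \<le> C" "continuous_on {0..T} y"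
  shows "\<bar>exp_payoff l S y s\<bar> \<le> 2 * C"
proof -
  define g where "g t = exp (- cum_hazard l S t) * (pairing l (S t))\<^sup>2" for t
  have g: "(g has_integral (1 - exp (- cum_hazard l S s))) {0..s}" unfolding g_def by (rule density_integral[OF l s])
  have "(\<lambda>t. y t * g t) integrable_on {0..s}" unfolding g_def
    using s by (intro integrable_continuous_real continuous_intros continuous_on_subset[OF y(2)] continuous_on_subset[OF cum_hazard_continuous[OF l]]
        continuous_on_subset[OF pairing_continuous[OF l]]) auto
  then have "norm (integral {0..s} (\<lambda>t. y t * g t)) \<le> integral {0..s} (\<lambda>t. C * g t)"
  proof (rule integral_norm_bound_integral)
    show "(\<lambda>t. C * g t) integrable_on {0..s}" using has_integral_mult_right[OF g, of C] by blast
    show "norm (y t * g t) \<le> C * g t" if "t \<in> {0..s}" for t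
      using y(1)[of t] that s by (auto simp: g_def abs_mult intro!: mult_right_mono)
  qed
  also have "\<dots> = C * (1 - exp (- cum_hazard l S s))" using integral_unique[OF g] by simp
  finally have 1: "\<bar>integral {0..s} (\<lambda>t. y t * g t)\<bar> \<le> C * (1 - exp (- cum_hazard l S s))" by simp
  have 2: "\<bar>exp (- cum_hazard l S s) * y s\<bar> \<le> exp (- cum_hazard l S s) * C" using y(1)[OF s] by (simp add: abs_mult)
  have 3: "\<bar>y 0\<bar> \<le> C" using y(1)[of 0] T by simp
  have "\<bar>exp_payoff l S y s\<bar> \<le> exp (- cum_hazard l S s) * C + C + C * (1 - exp (- cum_hazard l S s))"
    unfolding exp_payoff_def g_def[symmetric] using 1 2 3 by linarith
  then show ?thesis by (simp add: algebra_simps)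
qed

lemma ibp_trunc_exp:
  fixes N
  assumes l: "l \<in> tfin" and s: "s \<in> {0..T}"
  defines "f \<equiv> \<lambda>t. pairing (shuffle_exp (neg_square l)) (ttrunc N (S t))"
  shows "ibp_integral s f y = f s * y s - f 0 * y 0 - integral {0..s} (\<lambda>t. y t * trunc_exp_deriv l N S t)"
proof -
  have "integral {0..s} (\<lambda>t. y t * deriv f t) = integral {0..s} (\<lambda>t. y t * trunc_exp_deriv l N S t)"
  \<comment> \<open>\<open>deriv\<close> has been identified in the open interval only; the two end
    points form a null set.\<close>
  proof (rule integral_spike[where S="{0, s}"])
    fix t assume "t \<in> {0..s} - {0, s}"
    then have "t \<in> {0<..<T}" using s by auto
    then show "y t * trunc_exp_deriv l N S t = y t * deriv f t" unfolding f_def by (simp add: trunc_exp_has_deriv[OF l])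
  qed auto
  then show ?thesis by (simp add: ibp_integral_def)
qed

text \<open>\<open>truncated_series\<close> is applied to the exponential and to its time
  derivative, since both occur in the integral by parts. The coordinate bound \<open>B\<close> is
  demanded only up to \<open>s\<close>, as the stopping time provides it.\<close>

lemma payoff_error:
  assumes l: "l \<in> tfin" and s: "s \<in> {0..T}" and k: "tdeg l \<le> k" and K: "tabs l \<le> K"
    and B: "\<And>t w. t \<in> {0..s} \<Longrightarrow> length w \<le> k \<Longrightarrow> \<bar>S t w\<bar> \<le> B"
    and y: "\<And>t. t \<in> {0..T} \<Longrightarrow> \<bar>y t\<bar> \<le> C" "continuous_on {0..T} y"
  shows "\<bar>ibp_integral s (\<lambda>t. pairing (shuffle_exp (neg_square l)) (ttrunc N (S t))) y - exp_payoff l S y s\<bar>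
     \<le> C * pay_bound T K B k N"
proof -
  define q where "q = (K * B)\<^sup>2"
  define Q where "Q = (2 * real k + 2) * (T * q)"
  define D where "D = 2 * k + 1"
  define R where "R = Suc (N div D)"
  define P where "P t = pairing_poly (neg_square l) (S t)" for t
  define H where "H t = hazard_poly l S t" for t
  define f where "f t = pairing (shuffle_exp (neg_square l)) (ttrunc N (S t))" for t
  define E where "E t = exp (- cum_hazard l S t)" for t
  define G where "G t = E t * - (pairing l (S t))\<^sup>2" for t
  have q: "q \<ge> 0" "Q \<ge> 0" unfolding Q_def q_def using T by auto
  have K0: "0 \<le> K" using K unfolding tabs_def by (meson abs_ge_zero order.trans sum_nonneg)
  have B0: "0 \<le> B" using B[of 0 "[]"] s abs_ge_zero order.trans by fastforce
  have nL: "poly_norm (pairing_poly l (S t)) \<le> K * B" if t: "t \<in> {0..s}" for t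
  proof -
    have "poly_norm (pairing_poly l (S t)) = (\<Sum>n\<le>tdeg l. \<bar>level_pairing n l (S t)\<bar>)"
      by (simp add: poly_norm_eq[OF degree_pairing_poly] coeff_pairing_poly[OF l])
    also have "\<dots> \<le> (\<Sum>n\<le>tdeg l. \<Sum>w | length w = n. \<bar>l w\<bar> * B)"
      unfolding level_pairing_def
    proof (intro sum_mono order.trans[OF sum_abs])
      fix n w assume "n \<in> {..tdeg l}" "w \<in> {w::'d option list. length w = n}"
      then show "\<bar>l w * S t w\<bar> \<le> \<bar>l w\<bar> * B" unfolding abs_mult using k by (intro mult_left_mono B[OF t]) auto
    qed
    also have "\<dots> = (\<Sum>w | length w \<le> tdeg l. \<bar>l w\<bar>) * B" by (simp add: sum_words_le sum_distrib_right)
    also have "(\<Sum>w | length w \<le> tdeg l. \<bar>l w\<bar>) = tabs l"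
      unfolding tabs_def by (rule sum.mono_neutral_right) (use tfin_length_le_tdeg[OF l] in auto)
    also have "tabs l * B \<le> K * B" by (rule mult_right_mono[OF K B0])
    finally show ?thesis .
  qed
  have nL2: "poly_norm ((pairing_poly l (S t))\<^sup>2) \<le> q" if t: "t \<in> {0..s}" for t
    using poly_norm_power[of "pairing_poly l (S t)" 2] power_mono[OF nL[OF t] poly_norm_nonneg, of 2] unfolding q_def by linarith
  have nH: "poly_norm (H t) \<le> q" if t: "t \<in> {0..s}" for t
  proof -
    have "H t = [:0, -1:] * (pairing_poly l (S t))\<^sup>2" by (simp add: H_def hazard_poly_def)
    then have "poly_norm (H t) \<le> poly_norm [:0, -1:] * poly_norm ((pairing_poly l (S t))\<^sup>2)" by (simp only: poly_norm_mult)
    moreover have "poly_norm [:0, -1:] = 1" by (simp add: poly_norm_def)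
    ultimately show ?thesis using nL2[OF t] by simp
  qed
  have dP: "degree (P t) \<le> D" for t
    using degree_pairing_poly[of "neg_square l" "S t"] neg_square_tfin(2)[OF l] k by (simp add: D_def P_def)
  have dH: "degree (H t) \<le> D" for t
  proof -
    have "degree ((pairing_poly l (S t))\<^sup>2) \<le> 2 * tdeg l"
      using degree_power_le[of "pairing_poly l (S t)" 2] degree_pairing_poly[of l "S t"] by simp
    moreover have "degree (H t) \<le> Suc (degree ((pairing_poly l (S t))\<^sup>2))"
      unfolding H_def hazard_poly_def using degree_pCons_le[of 0 "- (pairing_poly l (S t))\<^sup>2"] by simp
    ultimately show ?thesis using k by (simp add: D_def)
  qed
  have nP: "poly_norm (P t) \<le> Q" if t: "t \<in> {0..s}" for t
  proof -
    have tT: "t \<in> {0..T}" using t s by auto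
    \<comment> \<open>Each coefficient is, up to sign, the time integral of a coefficient of the
      squared pairing polynomial, or zero for \<open>n = 0\<close>.\<close>
    have "\<bar>coeff (P t) n\<bar> \<le> T * q" for n
    proof (cases n)
      case 0
      then show ?thesis using q T by (simp add: P_def coeff_pairing_poly[OF neg_square_tfin(1)[OF l]] level_pairing_neg_square_0)
    next
      case (Suc j)
      have "((\<lambda>s. coeff ((pairing_poly l (S s))\<^sup>2) j) has_integral integral {0..t} (\<lambda>s. coeff ((pairing_poly l (S s))\<^sup>2) j)) {0..t}"
        using tT by (intro integrable_integral integrable_continuous_real square_coeff_continuous l) auto
      then have "norm (integral {0..t} (\<lambda>s. coeff ((pairing_poly l (S s))\<^sup>2) j)) \<le> q * measure lborel {0..t}"
      proof (rule has_integral_bound_real[OF q(1) finite.emptyI])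
        fix u assume "u \<in> {0..t} - {}"
        then have u: "u \<in> {0..s}" using t by auto
        have "\<bar>coeff ((pairing_poly l (S u))\<^sup>2) j\<bar> \<le> poly_norm ((pairing_poly l (S u))\<^sup>2)"
          unfolding poly_norm_eq[OF max.cobounded1[of "degree ((pairing_poly l (S u))\<^sup>2)" j]]
          by (rule member_le_sum) auto
        then show "norm (coeff ((pairing_poly l (S u))\<^sup>2) j) \<le> q" using nL2[OF u] by simp
      qed
      also have "\<dots> \<le> q * T" using tT q by (intro mult_left_mono) auto
      finally show ?thesis by (simp add: Suc P_def neg_square_coeff_Suc[OF l tT] mult.commute)
    qed
    then have "poly_norm (P t) \<le> (\<Sum>n\<le>D. T * q)"
      unfolding poly_norm_eq[OF dP] by (intro sum_mono) auto
    also have "\<dots> = Q" by (simp add: Q_def D_def algebra_simps)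
    finally show ?thesis .
  qed
  have D0: "D > 0" by (simp add: D_def)
  have ferr: "\<bar>f t - E t\<bar> \<le> 2 * (\<Sum>r. Q ^ (r + R) / fact (r + R))" if t: "t \<in> {0..s}" for t
  proof -
    have tT: "t \<in> {0..T}" using t s by auto
    have "(\<Sum>r. poly (smult (1 / fact r) (P t ^ r)) 1) = exp (poly (P t) 1)"
      using exp_converges[of "poly (P t) 1"] by (simp add: sums_iff divide_inverse)
    then have E: "E t = (\<Sum>r. poly (smult (1 / fact r) (P t ^ r)) 1)"
      by (simp add: E_def P_def neg_square_poly_1[OF l tT])
    show ?thesis unfolding f_def trunc_exp_eq[OF l tT] E P_def[symmetric] R_def
    proof (rule truncated_series[OF _ _ summable_exp_terms D0])
      fix r
      have "degree (smult (1 / fact r) (P t ^ r)) \<le> degree (P t) * r"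
        by (rule order.trans[OF degree_smult_le degree_power_le])
      also have "\<dots> \<le> r * D" using dP[of t] by (simp add: mult.commute)
      finally show "degree (smult (1 / fact r) (P t ^ r)) \<le> r * D" .
      have "poly_norm (P t ^ r) \<le> Q ^ r"
        using poly_norm_power[of "P t" r] power_mono[OF nP[OF t] poly_norm_nonneg, of r] by linarith
      then show "poly_norm (smult (1 / fact r) (P t ^ r)) \<le> Q ^ r / fact r"
        by (simp add: poly_norm_smult divide_right_mono)
    qed
  qed
  have gerr: "\<bar>trunc_exp_deriv l N S t - G t\<bar> \<le> 2 * (\<Sum>r. real (r + R) / fact (r + R) * (Q ^ (r + R - 1) * q))" if t: "t \<in> {0..s}" for t
  proof -
    have tT: "t \<in> {0..T}" using t s by auto
    have "(\<Sum>r. poly (smult (real r / fact r) (P t ^ (r - 1) * H t)) 1) = exp (poly (P t) 1) * poly (H t) 1"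
      using exp_deriv_series[of "poly (P t) 1" "poly (H t) 1"] by (simp add: sums_iff)
    then have G: "G t = (\<Sum>r. poly (smult (real r / fact r) (P t ^ (r - 1) * H t)) 1)"
      by (simp add: G_def E_def P_def neg_square_poly_1[OF l tT] H_def hazard_poly_1[OF l])
    show ?thesis unfolding trunc_exp_deriv_def G P_def[symmetric] H_def[symmetric] R_def
    proof (rule truncated_series[OF _ _ summable_exp_deriv_terms D0])
      fix r
      show "degree (smult (real r / fact r) (P t ^ (r - 1) * H t)) \<le> r * D"
      proof (cases r)
        case (Suc j)
        have "degree (P t ^ j) \<le> D * j"
          by (rule order.trans[OF degree_power_le mult_le_mono1[OF dP]])
        then have "degree (P t ^ j * H t) \<le> D * j + D"
          using degree_mult_le[of "P t ^ j" "H t"] dH[of t] by linarith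
        then show ?thesis unfolding Suc by (intro order.trans[OF degree_smult_le]) (simp add: mult.commute)
      qed simp
      have "poly_norm (P t ^ (r - 1)) \<le> Q ^ (r - 1)"
        using poly_norm_power[of "P t" "r - 1"] power_mono[OF nP[OF t] poly_norm_nonneg, of "r - 1"] by linarith
      then have "poly_norm (P t ^ (r - 1)) * poly_norm (H t) \<le> Q ^ (r - 1) * q"
        using nH[OF t] q by (intro mult_mono) (auto simp: poly_norm_nonneg)
      then have "poly_norm (P t ^ (r - 1) * H t) \<le> Q ^ (r - 1) * q" using poly_norm_mult[of "P t ^ (r - 1)" "H t"] by linarith
      then show "poly_norm (smult (real r / fact r) (P t ^ (r - 1) * H t)) \<le> real r / fact r * (Q ^ (r - 1) * q)"
        unfolding poly_norm_smult by (auto intro!: divide_right_mono mult_left_mono)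
    qed
  qed
  define ef where "ef = 2 * (\<Sum>r. Q ^ (r + R) / fact (r + R))"
  define eg where "eg = 2 * (\<Sum>r. real (r + R) / fact (r + R) * (Q ^ (r + R - 1) * q))"
  have s0: "0 \<in> {0..s}" "s \<in> {0..s}" using s by auto
  have C0: "0 \<le> C" using y(1)[of 0] T by force
  have eg0: "0 \<le> eg" using gerr[OF s0(1)] unfolding eg_def by linarith
  have ibp: "ibp_integral s f y = f s * y s - f 0 * y 0 - integral {0..s} (\<lambda>t. y t * trunc_exp_deriv l N S t)"
    unfolding f_def by (rule ibp_trunc_exp[OF l s])
  have ps: "exp_payoff l S y s = E s * y s - E 0 * y 0 - integral {0..s} (\<lambda>t. y t * G t)"
    by (simp add: exp_payoff_def E_def G_def cum_hazard_def)
  have cy: "continuous_on {0..s} y" by (rule continuous_on_subset[OF y(2)]) (use s in auto)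
  have cg: "continuous_on {0..s} (trunc_exp_deriv l N S)" by (rule continuous_on_subset[OF trunc_exp_deriv_continuous[OF l]]) (use s in auto)
  have cG: "continuous_on {0..s} G" unfolding G_def E_def
    using s by (intro continuous_intros continuous_on_subset[OF cum_hazard_continuous[OF l]]
        continuous_on_subset[OF pairing_continuous[OF l]]) auto
  have "((\<lambda>t. y t * trunc_exp_deriv l N S t - y t * G t) has_integral
      (integral {0..s} (\<lambda>t. y t * trunc_exp_deriv l N S t) - integral {0..s} (\<lambda>t. y t * G t))) {0..s}"
    by (intro has_integral_diff integrable_integral integrable_continuous_real continuous_intros cy cg cG)
  then have "norm (integral {0..s} (\<lambda>t. y t * trunc_exp_deriv l N S t) - integral {0..s} (\<lambda>t. y t * G t)) \<le> (C * eg) * measure lborel {0..s}"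
  proof (rule has_integral_bound_real[OF _ finite.emptyI, rotated])
    fix t assume "t \<in> {0..s} - {}"
    then have t: "t \<in> {0..s}" by simp
    then have "\<bar>y t\<bar> \<le> C" using s y(1)[of t] by auto
    then have "\<bar>y t\<bar> * \<bar>trunc_exp_deriv l N S t - G t\<bar> \<le> C * eg" using gerr[OF t] C0 unfolding eg_def by (intro mult_mono) auto
    then show "norm (y t * trunc_exp_deriv l N S t - y t * G t) \<le> C * eg" by (simp add: right_diff_distrib[symmetric] abs_mult)
  qed (use C0 eg0 in auto)
  also have "\<dots> \<le> (C * eg) * T" using s C0 eg0 by (intro mult_left_mono) auto
  finally have 1: "\<bar>integral {0..s} (\<lambda>t. y t * trunc_exp_deriv l N S t) - integral {0..s} (\<lambda>t. y t * G t)\<bar> \<le> C * (T * eg)"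
    by (simp add: mult_ac)
  have 2: "\<bar>(f t - E t) * y t\<bar> \<le> C * ef" if "t \<in> {0..s}" for t
  proof -
    have "\<bar>y t\<bar> \<le> C" using s that y(1)[of t] by auto
    then have "\<bar>f t - E t\<bar> * \<bar>y t\<bar> \<le> ef * C" using ferr[OF that] unfolding ef_def by (intro mult_mono) auto
    then show ?thesis by (simp add: abs_mult mult.commute)
  qed
  have "\<bar>ibp_integral s f y - exp_payoff l S y s\<bar> \<le> C * ef + C * ef + C * (T * eg)"
    unfolding ibp ps using 1 2[OF s0(1)] 2[OF s0(2)] by (simp add: left_diff_distrib)
  also have "\<dots> = C * pay_bound T K B k N"
    unfolding pay_bound_def Let_def ef_def eg_def q_def[symmetric] Q_def[symmetric] D_def[symmetric] R_def[symmetric]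
    by (simp add: algebra_simps)
  finally show ?thesis unfolding f_def .
qed

end

subsection \<open>Randomised stopping\<close>

text \<open>\<open>tau_r\<close> capped at \<open>T\<close>, for an abstract cumulative hazard and a
  clock value \<open>z\<close>. If \<open>z\<close> is never reached, the infimum is infinite and
  the cap gives \<open>T\<close>.\<close>

definition rand_stop :: "real \<Rightarrow> (real \<Rightarrow> real) \<Rightarrow> real \<Rightarrow> real" where
  "rand_stop T \<Lambda> z = real_of_ereal (min (Inf (ereal ` {t. 0 \<le> t \<and> z \<le> \<Lambda> (min t T)})) (ereal T))"

lemma rand_stop_range: assumes "T \<ge> 0" shows "rand_stop T \<Lambda> z \<in> {0..T}"
  and rand_stop_ereal: "min (Inf (ereal ` {t. 0 \<le> t \<and> z \<le> \<Lambda> (min t T)})) (ereal T) = ereal (rand_stop T \<Lambda> z)"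
proof -
  define I where "I = min (Inf (ereal ` {t. 0 \<le> t \<and> z \<le> \<Lambda> (min t T)})) (ereal T)"
  have I: "0 \<le> I" "I \<le> ereal T" unfolding I_def using assms by (auto intro!: Inf_greatest)
  then obtain r where r: "I = ereal r" by (cases I) auto
  show "rand_stop T \<Lambda> z \<in> {0..T}" using I r by (simp add: rand_stop_def I_def[symmetric])
  show "min (Inf (ereal ` {t. 0 \<le> t \<and> z \<le> \<Lambda> (min t T)})) (ereal T) = ereal (rand_stop T \<Lambda> z)"
    using r by (simp add: rand_stop_def I_def[symmetric])
qed

text \<open>By continuity the cumulative hazard cannot stay below \<open>z\<close> up to the infimum
  and exceed it at once afterwards. The case \<open>t = T\<close> is excluded because the cap makes
  its left side true for every \<open>z\<close>.\<close>

lemma rand_stop_le_iff: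
  assumes c: "continuous_on {0..T} \<Lambda>" and mono: "\<And>s t. 0 \<le> s \<Longrightarrow> s \<le> t \<Longrightarrow> t \<le> T \<Longrightarrow> \<Lambda> s \<le> \<Lambda> t"
    and t: "0 \<le> t" "t < T"
  shows "rand_stop T \<Lambda> z \<le> t \<longleftrightarrow> z \<le> \<Lambda> t"
proof -
  define A where "A = {t. 0 \<le> t \<and> z \<le> \<Lambda> (min t T)}"
  have T0: "T \<ge> 0" using t by simp
  have "rand_stop T \<Lambda> z \<le> t \<longleftrightarrow> min (Inf (ereal ` A)) (ereal T) \<le> ereal t"
    unfolding A_def rand_stop_ereal[OF T0] by simp
  also have "\<dots> \<longleftrightarrow> Inf (ereal ` A) \<le> ereal t" using t by (simp add: min_le_iff_disj)
  also have "\<dots> \<longleftrightarrow> z \<le> \<Lambda> t"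
  proof
    assume "z \<le> \<Lambda> t"
    then have "t \<in> A" using t by (simp add: A_def)
    then show "Inf (ereal ` A) \<le> ereal t" by (intro Inf_lower) auto
  next
    assume inf: "Inf (ereal ` A) \<le> ereal t"
    show "z \<le> \<Lambda> t"
    proof (rule ccontr)
      assume "\<not> z \<le> \<Lambda> t"
      then have e: "z - \<Lambda> t > 0" by simp
      obtain d where d: "d > 0" "\<And>u. u \<in> {0..T} \<Longrightarrow> dist u t < d \<Longrightarrow> dist (\<Lambda> u) (\<Lambda> t) < z - \<Lambda> t"
        using c t e unfolding continuous_on_iff by (metis atLeastAtMost_iff less_imp_le)
      define v where "v = min T (t + d / 2)"
      have v: "t < v" "v \<in> {0..T}" using t d by (auto simp: v_def)
      have "v - t < d" using d(1) unfolding v_def by (auto simp: min_def)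
      then have "dist (\<Lambda> v) (\<Lambda> t) < z - \<Lambda> t" using v by (intro d(2)) (auto simp: dist_real_def)
      then have "\<Lambda> v < z" by (auto simp: dist_real_def abs_less_iff)
      then have "ereal v \<le> ereal u" if "u \<in> A" for u
        using mono[of "min u T" v] that v by (force simp: A_def not_le[symmetric])
      then have "ereal v \<le> Inf (ereal ` A)" by (intro Inf_greatest) auto
      then show False using inf v(1) by (metis ereal_less_eq(3) not_le order.trans)
    qed
  qed
  finally show ?thesis .
qed

context time_lift
begin

lemma cum_hazard_mono:
  assumes l: "l \<in> tfin" and st: "0 \<le> s" "s \<le> t" "t \<le> T" shows "cum_hazard l S s \<le> cum_hazard l S t"
  unfolding cum_hazard_def
  by (rule integral_subset_le)
     (use st in \<open>auto intro!: integrable_continuous_real continuous_intros continuous_on_subset[OF pairing_continuous[OF l]]\<close>)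

text \<open>A continuous nonnegative function with zero integral vanishes. This handles the
  intervals on which the substitution \<open>z = \<Lambda> t\<close> is not injective.\<close>

lemma cum_hazard_flat:
  assumes l: "l \<in> tfin" and st: "0 \<le> s" "s < t" "t \<le> T" and eq: "cum_hazard l S t \<le> cum_hazard l S s"
  shows "pairing l (S t) = 0"
proof -
  have c: "continuous_on {a..b} (\<lambda>s. (pairing l (S s))\<^sup>2)" if "0 \<le> a" "b \<le> T" for a b
    using that by (intro continuous_intros continuous_on_subset[OF pairing_continuous[OF l]]) auto
  have "cum_hazard l S s + integral {s..t} (\<lambda>s. (pairing l (S s))\<^sup>2) = cum_hazard l S t"
    unfolding cum_hazard_def using st by (intro Henstock_Kurzweil_Integration.integral_combine integrable_continuous_real c) auto
  moreover have "integral {s..t} (\<lambda>s. (pairing l (S s))\<^sup>2) \<ge> 0" by (rule integral_nonneg) (use st in \<open>auto intro!: integrable_continuous_real c\<close>)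
  ultimately have "integral {s..t} (\<lambda>s. (pairing l (S s))\<^sup>2) = 0" using eq by simp
  then have "\<forall>x\<in>{s..t}. (pairing l (S x))\<^sup>2 = 0" using st by (subst (asm) integral_eq_0_iff) (auto intro!: c)
  then show ?thesis using st by auto
qed

text \<open>Integrating out the exponential clock: on \<open>{z \<le> \<Lambda>\<^sub>T}\<close> one substitutes \<open>z = \<Lambda>\<^sub>t\<close>, and the stopping time
  is \<open>t\<close> itself unless the hazard rate vanishes there.\<close>

lemma expectation_rand_stop:
  assumes l: "l \<in> tfin" and y: "continuous_on {0..T} y"
    and meas: "(\<lambda>z. y (rand_stop T (cum_hazard l S) z)) \<in> borel_measurable borel"
  shows "(LINT z|density lborel (exponential_density 1). y (rand_stop T (cum_hazard l S) z)) = exp_payoff l S y T + y 0"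
proof -
  define \<Lambda> where "\<Lambda> = cum_hazard l S"
  define \<tau> where "\<tau> = rand_stop T \<Lambda>"
  define \<mu> where "\<mu> = density lborel (\<lambda>x. ennreal (exponential_density 1 x))"
  interpret mu: prob_space \<mu> unfolding \<mu>_def by (rule prob_space_exponential_density) simp
  have T0: "T \<ge> 0" using T by simp
  have \<Lambda>c: "continuous_on {0..T} \<Lambda>" unfolding \<Lambda>_def by (rule cum_hazard_continuous[OF l])
  have \<Lambda>m: "\<Lambda> s \<le> \<Lambda> t" if "0 \<le> s" "s \<le> t" "t \<le> T" for s t unfolding \<Lambda>_def by (rule cum_hazard_mono[OF l that])
  have \<Lambda>0: "\<Lambda> 0 = 0" by (simp add: \<Lambda>_def cum_hazard_def)
  have LT: "0 \<le> \<Lambda> T" using \<Lambda>m[of 0 T] \<Lambda>0 T0 by simp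
  have ymeas[measurable]: "(\<lambda>z. y (\<tau> z)) \<in> borel_measurable borel" using meas by (simp add: \<tau>_def \<Lambda>_def)
  obtain C where C: "\<And>t. t \<in> {0..T} \<Longrightarrow> \<bar>y t\<bar> \<le> C"
    using compact_imp_bounded[OF compact_continuous_image[OF y compact_Icc]] unfolding bounded_iff
    by (metis imageI real_norm_def)
  have \<tau>r: "\<tau> z \<in> {0..T}" for z unfolding \<tau>_def by (rule rand_stop_range(1)[OF T0])
  have yC: "\<bar>y (\<tau> z)\<bar> \<le> C" for z by (rule C[OF \<tau>r])
  have \<tau>T: "\<tau> z = T" if "\<Lambda> T < z" for z
  proof (rule ccontr)
    assume "\<tau> z \<noteq> T"
    then have "0 \<le> \<tau> z" "\<tau> z < T" using \<tau>r[of z] by auto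
    then have "z \<le> \<Lambda> (\<tau> z)" using rand_stop_le_iff[OF \<Lambda>c \<Lambda>m, of "\<tau> z" z] by (simp add: \<tau>_def)
    also have "\<dots> \<le> \<Lambda> T" using \<tau>r[of z] by (intro \<Lambda>m) auto
    finally show False using that by simp
  qed
  have key: "y (\<tau> (\<Lambda> t)) * (pairing l (S t))\<^sup>2 = y t * (pairing l (S t))\<^sup>2" if t: "t \<in> {0..T}" for t
  proof (cases "\<tau> (\<Lambda> t) = t")
    case False
    have "\<tau> (\<Lambda> t) \<le> t"
    proof (cases "t = T")
      case False
      then show ?thesis using rand_stop_le_iff[OF \<Lambda>c \<Lambda>m, of t "\<Lambda> t"] t by (simp add: \<tau>_def)
    qed (use \<tau>r[of "\<Lambda> t"] in simp)
    then have lt: "\<tau> (\<Lambda> t) < t" using False by simp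
    then have "\<Lambda> t \<le> \<Lambda> (\<tau> (\<Lambda> t))"
      using rand_stop_le_iff[OF \<Lambda>c \<Lambda>m, of "\<tau> (\<Lambda> t)" "\<Lambda> t"] \<tau>r[of "\<Lambda> t"] t by (simp add: \<tau>_def)
    then have "pairing l (S t) = 0"
      using cum_hazard_flat[OF l, of "\<tau> (\<Lambda> t)" t] lt \<tau>r[of "\<Lambda> t"] t by (simp add: \<Lambda>_def)
    then show ?thesis by simp
  qed simp
  define f where "f z = exp (- z) * y (\<tau> z)" for z
  \<comment> \<open>The substitution rule asks for two-sided derivatives on the closed interval. The
    hazard rate is therefore extended as a constant beyond \<open>[0, T]\<close> and integrated from
    \<open>-1\<close>, normalised to \<open>g 0 = 0\<close>.\<close>
  define g' where "g' t = (pairing l (S (max 0 (min T t))))\<^sup>2" for t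
  define g where "g t = integral {-1..t} g' - integral {-1..0} g'" for t
  have g'c: "continuous_on UNIV g'"
    unfolding g'_def by (intro continuous_intros continuous_on_compose2[OF pairing_continuous[OF l]]) (use T0 in auto)
  have gder: "(g has_real_derivative g' t) (at t)" if t: "t \<in> {0..T}" for t
  proof -
    have "((\<lambda>t. integral {-1..t} g') has_real_derivative g' t) (at t within {-1..T+1})"
      by (rule integral_has_real_derivative) (use t in \<open>auto intro: continuous_on_subset[OF g'c]\<close>)
    then have "((\<lambda>t. integral {-1..t} g') has_real_derivative g' t) (at t)"
      using t by (subst (asm) at_within_Icc_at) auto
    then show ?thesis unfolding g_def by (auto intro!: derivative_eq_intros)
  qed
  have g\<Lambda>: "g t = \<Lambda> t" if t: "t \<in> {0..T}" for t
  proof -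
    have "integral {-1..0} g' + integral {0..t} g' = integral {-1..t} g'"
      using t by (intro Henstock_Kurzweil_Integration.integral_combine integrable_continuous_real continuous_on_subset[OF g'c]) auto
    then have "g t = integral {0..t} g'" by (simp add: g_def)
    also have "\<dots> = \<Lambda> t" unfolding \<Lambda>_def cum_hazard_def
      using t by (intro integral_cong) (auto simp: g'_def min_absorb2 max_absorb2)
    finally show ?thesis .
  qed
  have gT: "g 0 = 0" "g T = \<Lambda> T" using g\<Lambda>[of 0] g\<Lambda>[of T] T0 \<Lambda>0 by auto
  have fmeas[measurable]: "f \<in> borel_measurable borel" unfolding f_def by measurable
  have fint: "set_integrable lborel {g 0..g T} f"
    unfolding set_integrable_def gT
  proof (rule Bochner_Integration.integrable_bound[of _ "\<lambda>z. indicator {0..\<Lambda> T} z *\<^sub>R C"])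
    show "integrable lborel (\<lambda>z. indicator {0..\<Lambda> T} z *\<^sub>R C)" by (intro integrable_scaleR_left integrable_real_indicator) (auto simp: emeasure_lborel_Icc_eq)
    show "AE z in lborel. norm (indicator {0..\<Lambda> T} z *\<^sub>R f z) \<le> norm (indicator {0..\<Lambda> T} z *\<^sub>R C)"
    proof (rule AE_I2)
      fix z
      have "\<bar>f z\<bar> \<le> \<bar>C\<bar>" if "z \<ge> 0"
      proof -
        have "exp (- z) * \<bar>y (\<tau> z)\<bar> \<le> 1 * \<bar>C\<bar>" using that yC[of z] by (intro mult_mono) auto
        then show ?thesis by (simp add: f_def abs_mult)
      qed
      then show "norm (indicator {0..\<Lambda> T} z *\<^sub>R f z) \<le> norm (indicator {0..\<Lambda> T} z *\<^sub>R C)"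
        by (auto simp: indicator_def)
    qed
  qed measurable
  have sub: "(LBINT z. f z * indicator {0..\<Lambda> T} z) = (LBINT t. f (g t) * g' t * indicator {0..T} t)"
    using integral_substitution(2)[OF fint gder _ _ T0] g'c unfolding gT
    by (auto simp: g'_def intro: continuous_on_subset)
  have "(LBINT t. f (g t) * g' t * indicator {0..T} t) = (LBINT t:{0..T}. y t * (exp (- \<Lambda> t) * (pairing l (S t))\<^sup>2))"
    unfolding set_lebesgue_integral_def
  proof (rule Bochner_Integration.integral_cong[OF refl])
    fix t
    show "f (g t) * g' t * indicator {0..T} t = indicator {0..T} t *\<^sub>R (y t * (exp (- \<Lambda> t) * (pairing l (S t))\<^sup>2))"
    proof (cases "t \<in> {0..T}")
      case True
      then have "g' t = (pairing l (S t))\<^sup>2" by (auto simp: g'_def min_absorb2 max_absorb2)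
      then show ?thesis using key[OF True] True by (simp add: f_def g\<Lambda>)
    qed simp
  qed
  also have "\<dots> = integral {0..T} (\<lambda>t. y t * (exp (- \<Lambda> t) * (pairing l (S t))\<^sup>2))"
    by (intro set_borel_integral_eq_integral borel_integrable_atLeastAtMost' continuous_intros y \<Lambda>c pairing_continuous[OF l])
  finally have 1: "(LBINT z. f z * indicator {0..\<Lambda> T} z) = integral {0..T} (\<lambda>t. y t * (exp (- \<Lambda> t) * (pairing l (S t))\<^sup>2))"
    using sub by simp
  have sb[simp]: "sets \<mu> = sets borel" by (simp add: \<mu>_def)
  have i1: "integrable \<mu> (\<lambda>z. indicator {..\<Lambda> T} z * y (\<tau> z))"
  proof (rule mu.integrable_const_bound[where B="\<bar>C\<bar>"])
    show "AE z in \<mu>. norm (indicator {..\<Lambda> T} z * y (\<tau> z)) \<le> \<bar>C\<bar>"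
    proof (rule AE_I2)
      fix z show "norm (indicator {..\<Lambda> T} z * y (\<tau> z)) \<le> \<bar>C\<bar>" using yC[of z] by (auto simp: indicator_def)
    qed
    show "(\<lambda>z. indicator {..\<Lambda> T} z * y (\<tau> z)) \<in> borel_measurable \<mu>"
      by (subst measurable_cong_sets[OF sb refl]) measurable
  qed
  have i2: "integrable \<mu> (\<lambda>z. y T * indicator {\<Lambda> T<..} z)"
    by (intro integrable_mult_right integrable_real_indicator) (auto simp: mu.emeasure_eq_measure)
  \<comment> \<open>Split at \<Lambda> \<open>T\<close>: beyond it the clock does not ring before
    \<open>T\<close>, and \<open>y T\<close> is weighted with the exponential tail.\<close>
  have "(LINT z|\<mu>. y (\<tau> z)) = (LINT z|\<mu>. indicator {..\<Lambda> T} z * y (\<tau> z) + y T * indicator {\<Lambda> T<..} z)"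
    by (intro Bochner_Integration.integral_cong refl) (auto simp: indicator_def \<tau>T)
  also have "\<dots> = (LINT z|\<mu>. indicator {..\<Lambda> T} z * y (\<tau> z)) + y T * measure \<mu> {\<Lambda> T<..}"
    by (subst Bochner_Integration.integral_add[OF i1 i2]) (simp add: \<mu>_def)
  also have "(LINT z|\<mu>. indicator {..\<Lambda> T} z * y (\<tau> z)) = (LBINT z. exponential_density 1 z *\<^sub>R (indicator {..\<Lambda> T} z * y (\<tau> z)))"
    unfolding \<mu>_def by (rule integral_density) (auto simp: exponential_density_def)
  also have "\<dots> = (LBINT z. f z * indicator {0..\<Lambda> T} z)"
    by (intro Bochner_Integration.integral_cong refl) (auto simp: indicator_def f_def exponential_density_def)
  also have "measure \<mu> {\<Lambda> T<..} = exp (- \<Lambda> T)"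
  proof -
    have "distributed \<mu> lborel (\<lambda>x. x) (exponential_density 1)"
      unfolding distributed_def \<mu>_def
      by (auto simp: distr_id2 intro!: measurable_ident_sets)
    from mu.exponential_distributedD_gt[OF this LT] show ?thesis
      by (simp add: \<mu>_def greaterThan_def)
  qed
  finally show ?thesis
    using 1 unfolding \<tau>_def \<mu>_def exp_payoff_def \<Lambda>_def by simp
qed

end

subsection \<open>Suprema and limits\<close>

text \<open>Taking suprema does not increase the uniform distance. The bound \<open>C\<close>
  ensures that both sets are bounded, since otherwise a real supremum carries no
  information.\<close>

lemma abs_SUP_diff_le:
  fixes f g :: "'b \<Rightarrow> real"
  assumes ne: "A \<noteq> {}" and d: "\<And>x. x \<in> A \<Longrightarrow> \<bar>f x - g x\<bar> \<le> e" and b: "\<And>x. x \<in> A \<Longrightarrow> \<bar>g x\<bar> \<le> C"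
  shows "\<bar>(SUP x\<in>A. f x) - (SUP x\<in>A. g x)\<bar> \<le> e"
proof -
  have bg: "bdd_above (g ` A)" by (intro bdd_aboveI2[of _ _ C]) (use b in \<open>auto simp: abs_le_iff\<close>)
  have bf: "bdd_above (f ` A)" by (intro bdd_aboveI2[of _ _ "C + e"]) (use b d in \<open>force simp: abs_le_iff\<close>)
  have "f x \<le> (SUP x\<in>A. g x) + e" if "x \<in> A" for x
    using cSUP_upper[OF that bg] d[OF that] by linarith
  then have 1: "(SUP x\<in>A. f x) \<le> (SUP x\<in>A. g x) + e" by (rule cSUP_least[OF ne])
  have "g x \<le> (SUP x\<in>A. f x) + e" if "x \<in> A" for x
    using cSUP_upper[OF that bf] d[OF that] by linarith
  then have 2: "(SUP x\<in>A. g x) \<le> (SUP x\<in>A. f x) + e" by (rule cSUP_least[OF ne])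
  show ?thesis using 1 2 by linarith
qed

lemma SUP_add_const:
  fixes f :: "'b \<Rightarrow> real"
  assumes ne: "A \<noteq> {}" and b: "\<And>x. x \<in> A \<Longrightarrow> \<bar>f x\<bar> \<le> C"
  shows "(SUP x\<in>A. f x + c) = (SUP x\<in>A. f x) + c"
proof (rule antisym)
  have bf: "bdd_above (f ` A)" by (intro bdd_aboveI2[of _ _ C]) (use b in \<open>auto simp: abs_le_iff\<close>)
  have bfc: "bdd_above ((\<lambda>x. f x + c) ` A)" by (intro bdd_aboveI2[of _ _ "C + c"]) (use b in \<open>auto simp: abs_le_iff\<close>)
  show "(SUP x\<in>A. f x + c) \<le> (SUP x\<in>A. f x) + c"
    by (intro cSUP_least[OF ne] add_right_mono cSUP_upper[OF _ bf])
  have "(SUP x\<in>A. f x) \<le> (SUP x\<in>A. f x + c) - c"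
    by (intro cSUP_least[OF ne]) (use cSUP_upper[OF _ bfc] in \<open>auto simp: le_diff_eq\<close>)
  then show "(SUP x\<in>A. f x) + c \<le> (SUP x\<in>A. f x + c)" by simp
qed

definition size_ball :: "real \<Rightarrow> 'a tensor set" where
  "size_ball K = {l \<in> tfin. tabs l + real (tdeg l) \<le> K}"

lemma tabs_nonneg: "0 \<le> tabs l" unfolding tabs_def by (intro sum_nonneg) auto

lemma zero_in_size_ball: "K \<ge> 0 \<Longrightarrow> (\<lambda>_. 0) \<in> size_ball K"
  by (simp add: size_ball_def tfin_def tabs_def tdeg_def)

text \<open>The balls increase with \<open>K\<close>, and each \<open>l\<close> in
  \<open>tfin\<close>, in particular a near-maximiser, lies in all large ones.\<close>

lemma SUP_size_ball_tendsto:
  fixes f :: "'a tensor \<Rightarrow> real"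
  assumes b: "\<And>l. l \<in> tfin \<Longrightarrow> \<bar>f l\<bar> \<le> C"
  shows "((\<lambda>K. SUP l\<in>size_ball K. f l) \<longlongrightarrow> (SUP l\<in>tfin. f l)) at_top"
proof (rule tendstoI)
  fix e :: real assume e: "e > 0"
  have bd: "bdd_above (f ` A)" if "A \<subseteq> tfin" for A
    by (intro bdd_aboveI2[of _ _ C]) (use b that in \<open>force simp: abs_le_iff\<close>)
  have z: "(\<lambda>_. 0) \<in> (tfin :: 'a tensor set)" by (simp add: tfin_def)
  then have ne: "(tfin :: 'a tensor set) \<noteq> {}" by blast
  have "(SUP l\<in>tfin. f l) - e < (SUP l\<in>tfin. f l)" using e by simp
  then obtain l where l: "l \<in> tfin" "(SUP l\<in>tfin. f l) - e < f l"
    by (subst (asm) less_cSUP_iff[OF ne bd]) auto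
  show "\<forall>\<^sub>F K in at_top. dist (SUP l\<in>size_ball K. f l) (SUP l\<in>tfin. f l) < e"
    using eventually_ge_at_top[of "tabs l + real (tdeg l)"]
  proof eventually_elim
    case (elim K)
    have lK: "l \<in> size_ball K" using l elim by (simp add: size_ball_def)
    have sub: "size_ball K \<subseteq> (tfin :: 'a tensor set)" by (auto simp: size_ball_def)
    have "f l \<le> (SUP l\<in>size_ball K. f l)" by (rule cSUP_upper[OF lK bd[OF sub]])
    moreover have "(SUP l\<in>size_ball K. f l) \<le> (SUP l\<in>tfin. f l)"
      using lK by (intro cSUP_subset_mono bd sub) auto
    ultimately show ?case using l by (simp add: dist_real_def)
  qed
qed

subsection \<open>The stopping problem\<close>

locale stopping_problem = prob_space M for M :: "'w measure" +
  fixes p T :: real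
    and X :: "'w \<Rightarrow> real \<Rightarrow> ('d::finite option) tensor"
    and Y :: "real \<Rightarrow> 'w \<Rightarrow> real"
    and Z :: "'w \<Rightarrow> real"
  assumes p: "p \<ge> 1" and T: "T > 0"
    and X_process: "\<And>t. t \<in> {0..T} \<Longrightarrow> (\<lambda>\<omega>. X \<omega> t) \<in> borel_measurable M"
    and X_paths: "\<And>\<omega>. \<omega> \<in> space M \<Longrightarrow> X \<omega> \<in> Omega_hat p T"
    and Y_adapted: "\<And>t. t \<in> {0..T} \<Longrightarrow> Y t \<in> borel_measurable (path_filtration M X t)"
    and Y_continuous: "\<And>\<omega>. \<omega> \<in> space M \<Longrightarrow> continuous_on {0..T} (\<lambda>t. Y t \<omega>)"
    and Y_integrable: "integrable M (\<lambda>\<omega>. SUP t\<in>{0..T}. \<bar>Y t \<omega>\<bar>)"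
    and Z_exp: "distributed M lborel Z (exponential_density 1)"
    and Z_indep: "indep_set (sets (path_filtration M X T)) (sets (vimage_algebra (space M) Z borel))"
begin

lemma T_mem: "T \<in> {0..T}" "0 \<in> {0..T}" using T by auto

abbreviation F where "F \<equiv> path_filtration M X T"
abbreviation Sig where "Sig \<omega> \<equiv> signature p T (X \<omega>)"
abbreviation pay where "pay l s \<omega> \<equiv> exp_payoff l (Sig \<omega>) (\<lambda>t. Y t \<omega>) s"
abbreviation sup_Y where "sup_Y \<omega> \<equiv> SUP t\<in>{0..T}. \<bar>Y t \<omega>\<bar>"
abbreviation stop_k where "stop_k \<kappa> \<omega> \<equiv> S_kappa p T \<kappa> (X \<omega>)"

section \<open>Measurability and integrability of the payoffs\<close>

lemma space_filtration [simp]: "space (path_filtration M X t) = space M"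
  unfolding path_filtration_def by (rule space_measure_of) auto

lemma sets_filtration: "sets (path_filtration M X t) = sigma_sets (space M)
   {(\<lambda>\<omega>. X \<omega> s) -` B \<inter> space M | s B. 0 \<le> s \<and> s \<le> t \<and> B \<in> sets borel}"
  unfolding path_filtration_def by (rule sets_measure_of) auto

lemma subalgebra_F: "subalgebra M F"
  unfolding subalgebra_def
proof
  show "sets F \<subseteq> sets M"
    unfolding sets_filtration by (rule sets.sigma_sets_subset) (auto intro!: measurable_sets[OF X_process])
qed simp

lemma X_measurable: "t \<in> {0..T} \<Longrightarrow> (\<lambda>\<omega>. X \<omega> t w) \<in> borel_measurable F"
proof -
  assume t: "t \<in> {0..T}"
  have "(\<lambda>\<omega>. X \<omega> t) \<in> measurable F borel"
    using t by (intro measurableI) (auto simp: sets_filtration intro!: sigma_sets.Basic)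
  moreover have "(\<lambda>f :: 'd option tensor. f w) \<in> borel_measurable borel"
    by (intro borel_measurable_continuous_onI continuous_on_product_coordinates)
  ultimately show ?thesis by (rule measurable_compose)
qed

lemma Y_measurable: assumes t: "t \<in> {0..T}" shows "Y t \<in> borel_measurable F"
proof -
  have "sets (path_filtration M X t) \<subseteq> sets F"
    unfolding sets_filtration using t by (intro sigma_sets_mono') force
  then have "subalgebra F (path_filtration M X t)" by (simp add: subalgebra_def)
  then show ?thesis by (rule measurable_from_subalg[OF _ Y_adapted[OF t]])
qed

lemma F_to_M: "f \<in> borel_measurable F \<Longrightarrow> f \<in> borel_measurable M"
  by (rule measurable_from_subalg[OF subalgebra_F])

lemma rough: "\<omega> \<in> space M \<Longrightarrow> X \<omega> \<in> rough_path_space p T"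
  using X_paths[of \<omega>] by (simp add: Omega_hat_def)

lemma lift: "\<omega> \<in> space M \<Longrightarrow> is_lyons_lift p T (X \<omega>) (Sig \<omega>)"
  by (rule signature_lift[OF p T X_paths])

lemma time_lift_Sig: "\<omega> \<in> space M \<Longrightarrow> time_lift T (Sig \<omega>)"
  by unfold_locales (auto intro: T lift_character[OF lift] lift_coord_continuous[OF lift] signature_snoc_None[OF p T X_paths])

lemma Sig_measurable: "t \<in> {0..T} \<Longrightarrow> (\<lambda>\<omega>. Sig \<omega> t w) \<in> borel_measurable F"
  by (rule signature_measurable[OF p T _ X_measurable]) (auto intro: X_paths)

lemma coeff_Sig_measurable:
  assumes "l \<in> tfin" "t \<in> {0..T}" shows "(\<lambda>\<omega>. coeff (pairing_poly l (Sig \<omega> t)) n) \<in> borel_measurable F"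
  unfolding coeff_pairing_poly[OF assms(1)] level_pairing_def
  by (intro borel_measurable_sum borel_measurable_times borel_measurable_const Sig_measurable assms)

lemma pairing_Sig_measurable:
  assumes "l \<in> tfin" "t \<in> {0..T}" shows "(\<lambda>\<omega>. pairing l (Sig \<omega> t)) \<in> borel_measurable F"
  unfolding pairing_eq_poly[OF assms(1)] poly_1_eq[OF degree_pairing_poly]
  by (intro borel_measurable_sum coeff_Sig_measurable assms)

lemma cum_hazard_measurable:
  assumes "l \<in> tfin" "t \<in> {0..T}" shows "(\<lambda>\<omega>. cum_hazard l (Sig \<omega>) t) \<in> borel_measurable F"
  unfolding cum_hazard_def
  by (intro integral_param_measurable[where T=T] borel_measurable_power pairing_Sig_measurable assms continuous_intros
      time_lift.pairing_continuous[OF time_lift_Sig]) auto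

lemma exp_hazard_measurable:
  assumes "l \<in> tfin" "t \<in> {0..T}" shows "(\<lambda>\<omega>. exp (- cum_hazard l (Sig \<omega>) t)) \<in> borel_measurable F"
  using cum_hazard_measurable[OF assms] by measurable

lemma pay_fixed_measurable:
  assumes l: "l \<in> tfin" and s: "s \<in> {0..T}" shows "(\<lambda>\<omega>. pay l s \<omega>) \<in> borel_measurable F"
proof -
  have 0: "0 \<in> {0..T}" using T by simp
  have "(\<lambda>\<omega>. integral {0..s} (\<lambda>t. Y t \<omega> * (exp (- cum_hazard l (Sig \<omega>) t) * (pairing l (Sig \<omega> t))\<^sup>2))) \<in> borel_measurable F"
    using l s by (intro integral_param_measurable[where T=T] borel_measurable_times exp_hazard_measurable
        borel_measurable_power pairing_Sig_measurable Y_measurable continuous_intros Y_continuous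
        time_lift.pairing_continuous[OF time_lift_Sig] time_lift.cum_hazard_continuous[OF time_lift_Sig]) auto
  then show ?thesis unfolding exp_payoff_def
    by (intro borel_measurable_add borel_measurable_diff borel_measurable_times exp_hazard_measurable Y_measurable l s 0)
qed

lemma pay_continuous:
  assumes l: "l \<in> tfin" and \<omega>: "\<omega> \<in> space M" shows "continuous_on {0..T} (\<lambda>s. pay l s \<omega>)"
  unfolding exp_payoff_def
  by (intro continuous_intros indefinite_integral_continuous_1 integrable_continuous_real Y_continuous \<omega> l
      time_lift.pairing_continuous[OF time_lift_Sig] time_lift.cum_hazard_continuous[OF time_lift_Sig])

lemma pay_measurable:
  assumes l: "l \<in> tfin" and g: "g \<in> borel_measurable F" "\<And>\<omega>. \<omega> \<in> space M \<Longrightarrow> g \<omega> \<in> {0..T}"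
  shows "(\<lambda>\<omega>. pay l (g \<omega>) \<omega>) \<in> borel_measurable F"
  by (rule continuous_param_compose[OF pay_fixed_measurable[OF l] pay_continuous[OF l] g(1) _ measurable_ident_sets[OF refl]])
     (use g T in auto)

lemma stop_k_range: "stop_k \<kappa> \<omega> \<in> {0..T}" using S_kappa_range(1)[of T p \<kappa> "X \<omega>"] T by simp

lemma stop_k_measurable: "stop_k \<kappa> \<in> borel_measurable F"
  by (rule S_kappa_measurable[OF p _ rough X_measurable]) (use T in auto)

lemma abs_Y_le: assumes "\<omega> \<in> space M" "t \<in> {0..T}" shows "\<bar>Y t \<omega>\<bar> \<le> sup_Y \<omega>"
proof (rule cSUP_upper[OF assms(2)])
  have "compact ((\<lambda>t. \<bar>Y t \<omega>\<bar>) ` {0..T})"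
    by (intro compact_continuous_image continuous_intros Y_continuous assms) auto
  then show "bdd_above ((\<lambda>t. \<bar>Y t \<omega>\<bar>) ` {0..T})" by (intro bounded_imp_bdd_above compact_imp_bounded)
qed

lemma sup_Y_nonneg: "\<omega> \<in> space M \<Longrightarrow> 0 \<le> sup_Y \<omega>"
  using abs_Y_le[of \<omega> 0] T by force

lemma abs_pay_le: "l \<in> tfin \<Longrightarrow> \<omega> \<in> space M \<Longrightarrow> s \<in> {0..T} \<Longrightarrow> \<bar>pay l s \<omega>\<bar> \<le> 2 * sup_Y \<omega>"
  by (rule time_lift.exp_payoff_bound[OF time_lift_Sig _ _ abs_Y_le Y_continuous])

lemma integrable_dominated:
  assumes "f \<in> borel_measurable F" "\<And>\<omega>. \<omega> \<in> space M \<Longrightarrow> \<bar>f \<omega>\<bar> \<le> C * sup_Y \<omega>"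
  shows "integrable M f"
  by (rule Bochner_Integration.integrable_bound[OF integrable_mult_right[OF Y_integrable, of C] F_to_M[OF assms(1)]])
     (use assms(2) in \<open>auto intro!: AE_I2 intro: order.trans[OF _ abs_ge_self]\<close>)

lemma pay_integrable:
  assumes "l \<in> tfin" "g \<in> borel_measurable F" "\<And>\<omega>. \<omega> \<in> space M \<Longrightarrow> g \<omega> \<in> {0..T}"
  shows "integrable M (\<lambda>\<omega>. pay l (g \<omega>) \<omega>)"
  by (rule integrable_dominated[OF pay_measurable[OF assms], of 2]) (use assms in \<open>auto intro: abs_pay_le\<close>)

lemma abs_expectation_le:
  assumes "integrable M f" "\<And>\<omega>. \<omega> \<in> space M \<Longrightarrow> \<bar>f \<omega>\<bar> \<le> C * sup_Y \<omega>"
  shows "\<bar>LINT \<omega>|M. f \<omega>\<bar> \<le> C * (LINT \<omega>|M. sup_Y \<omega>)"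
proof -
  have "\<bar>LINT \<omega>|M. f \<omega>\<bar> \<le> (LINT \<omega>|M. \<bar>f \<omega>\<bar>)" by (rule integral_abs_bound)
  also have "\<dots> \<le> (LINT \<omega>|M. C * sup_Y \<omega>)"
    by (rule integral_mono[OF integrable_abs[OF assms(1)] integrable_mult_right[OF Y_integrable] assms(2)])
  finally show ?thesis by simp
qed

text \<open>\<open>J l\<close> plus the expectation of \<open>Y 0\<close> is the value of the
  stopping rule given by \<open>l\<close>, see \<open>expectation_stopped\<close>. \<open>Jk\<close>
  is the version stopped at \<open>S_kappa\<close> and will be the limit in
  \<open>N\<close>.\<close>

definition J :: "('d option) tensor \<Rightarrow> real" where "J l = (LINT \<omega>|M. pay l T \<omega>)"
definition Jk :: "real \<Rightarrow> ('d option) tensor \<Rightarrow> real" where "Jk \<kappa> l = (LINT \<omega>|M. pay l (stop_k \<kappa> \<omega>) \<omega>)"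

lemma J_bound: "l \<in> tfin \<Longrightarrow> \<bar>J l\<bar> \<le> 2 * (LINT \<omega>|M. sup_Y \<omega>)"
  unfolding J_def by (intro abs_expectation_le pay_integrable abs_pay_le T_mem) auto

lemma Jk_bound: "l \<in> tfin \<Longrightarrow> \<bar>Jk \<kappa> l\<bar> \<le> 2 * (LINT \<omega>|M. sup_Y \<omega>)"
  unfolding Jk_def by (intro abs_expectation_le pay_integrable abs_pay_le stop_k_range stop_k_measurable) auto

text \<open>The payoffs at \<open>stop_k\<close> and at \<open>T\<close> are each bounded by
  \<open>2 * sup_Y\<close> and coincide where \<open>stop_k\<close> equals \<open>T\<close>. Neither
  \<open>l\<close> nor \<open>K\<close> occurs.\<close>

definition \<delta> :: "real \<Rightarrow> real" where "\<delta> \<kappa> = (LINT \<omega>|M. 4 * sup_Y \<omega> * (if stop_k \<kappa> \<omega> = T then 0 else 1))"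

lemma sup_Y_measurable: "(\<lambda>\<omega>. sup_Y \<omega>) \<in> borel_measurable M"
  using Y_integrable by (rule borel_measurable_integrable)

lemma cutoff_measurable: "(\<lambda>\<omega>. 4 * sup_Y \<omega> * (if stop_k \<kappa> \<omega> = T then 0 else 1)) \<in> borel_measurable M"
proof -
  note [measurable] = sup_Y_measurable F_to_M[OF stop_k_measurable[of \<kappa>]]
  show ?thesis by measurable
qed

lemma cutoff_integrable: "integrable M (\<lambda>\<omega>. 4 * sup_Y \<omega> * (if stop_k \<kappa> \<omega> = T then 0 else 1))"
  by (rule Bochner_Integration.integrable_bound[OF integrable_mult_right[OF Y_integrable, of 4] cutoff_measurable])
     (use sup_Y_nonneg in \<open>auto intro!: AE_I2\<close>)

lemma abs_Jk_diff_J_le: assumes l: "l \<in> tfin" shows "\<bar>Jk \<kappa> l - J l\<bar> \<le> \<delta> \<kappa>"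
proof -
  have i: "integrable M (\<lambda>\<omega>. pay l (stop_k \<kappa> \<omega>) \<omega>)" "integrable M (\<lambda>\<omega>. pay l T \<omega>)"
    by (intro pay_integrable l stop_k_range stop_k_measurable T_mem borel_measurable_const)+
  have eq: "Jk \<kappa> l - J l = (LINT \<omega>|M. pay l (stop_k \<kappa> \<omega>) \<omega> - pay l T \<omega>)"
    unfolding Jk_def J_def by (rule Bochner_Integration.integral_diff[OF i, symmetric])
  have "\<bar>Jk \<kappa> l - J l\<bar> \<le> (LINT \<omega>|M. \<bar>pay l (stop_k \<kappa> \<omega>) \<omega> - pay l T \<omega>\<bar>)"
    unfolding eq by (rule integral_abs_bound)
  also have "\<dots> \<le> \<delta> \<kappa>"
    unfolding \<delta>_def
  proof (rule integral_mono[OF _ cutoff_integrable])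
    show "integrable M (\<lambda>\<omega>. \<bar>pay l (stop_k \<kappa> \<omega>) \<omega> - pay l T \<omega>\<bar>)" by (intro integrable_abs Bochner_Integration.integrable_diff i)
    fix \<omega> assume \<omega>: "\<omega> \<in> space M"
    have "\<bar>pay l (stop_k \<kappa> \<omega>) \<omega>\<bar> \<le> 2 * sup_Y \<omega>" "\<bar>pay l T \<omega>\<bar> \<le> 2 * sup_Y \<omega>"
      by (intro abs_pay_le[OF l \<omega>] stop_k_range T_mem)+
    then show "\<bar>pay l (stop_k \<kappa> \<omega>) \<omega> - pay l T \<omega>\<bar> \<le> 4 * sup_Y \<omega> * (if stop_k \<kappa> \<omega> = T then 0 else 1)" by auto
  qed
  finally show ?thesis .
qed

text \<open>Each path has finite variation, so it is not stopped early once \<kappa> exceeds that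
  variation; \<open>4 * sup_Y\<close> dominates.\<close>

lemma \<delta>_tendsto: "(\<delta> \<longlongrightarrow> 0) at_top"
proof -
  have "((\<lambda>\<kappa>. LINT \<omega>|M. 4 * sup_Y \<omega> * (if stop_k \<kappa> \<omega> = T then 0 else 1)) \<longlongrightarrow> (LINT \<omega>|M. 0)) at_top"
  proof (rule integral_dominated_convergence_at_top[where w="\<lambda>\<omega>. 4 * sup_Y \<omega>"])
    show "AE \<omega> in M. ((\<lambda>\<kappa>. 4 * sup_Y \<omega> * (if stop_k \<kappa> \<omega> = T then 0 else 1)) \<longlongrightarrow> 0) at_top"
    proof (rule AE_I2)
      fix \<omega> assume \<omega>: "\<omega> \<in> space M"
      have "pvar_path p (level p) 0 T (X \<omega>) < \<infinity>" using rough[OF \<omega>] by (simp add: rough_path_space_def)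
      then obtain c where c: "c \<ge> 0" "pvar_path p (level p) 0 T (X \<omega>) = ennreal c"
        by (cases "pvar_path p (level p) 0 T (X \<omega>)") auto
      have "\<forall>\<^sub>F \<kappa> in at_top. 4 * sup_Y \<omega> * (if stop_k \<kappa> \<omega> = T then 0 else 1) = 0"
        using eventually_gt_at_top[of c]
      proof eventually_elim
        case (elim \<kappa>)
        have "stop_k \<kappa> \<omega> = T" using T p c elim by (intro S_kappa_eq_T) (auto simp: ennreal_lessI)
        then show ?case by simp
      qed
      then show "((\<lambda>\<kappa>. 4 * sup_Y \<omega> * (if stop_k \<kappa> \<omega> = T then 0 else 1)) \<longlongrightarrow> 0) at_top"
        by (rule tendsto_eventually)
    qed
    show "\<forall>\<^sub>F \<kappa> in at_top. AE \<omega> in M. norm (4 * sup_Y \<omega> * (if stop_k \<kappa> \<omega> = T then 0 else 1)) \<le> 4 * sup_Y \<omega>"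
      using sup_Y_nonneg by (auto intro!: always_eventually AE_I2)
    show "integrable M (\<lambda>\<omega>. 4 * sup_Y \<omega>)" by (rule integrable_mult_right[OF Y_integrable])
  qed (simp, rule cutoff_measurable)
  then show ?thesis by (simp add: \<delta>_def[abs_def])
qed

lemma stopping_payoff_eq:
  "stopping_payoff p T \<kappa> N l (X \<omega>) y =
    ibp_integral (stop_k \<kappa> \<omega>) (\<lambda>t. pairing (shuffle_exp (neg_square l)) (ttrunc N (Sig \<omega> t))) y"
  unfolding stopping_payoff_def neg_square_def ..

lemma trunc_exp_measurable:
  assumes "l \<in> tfin" "t \<in> {0..T}"
  shows "(\<lambda>\<omega>. pairing (shuffle_exp (neg_square l)) (ttrunc N (Sig \<omega> t))) \<in> borel_measurable F"
proof -
  have "(\<lambda>\<omega>. \<Sum>w | length w \<le> N. shuffle_exp (neg_square l) w * Sig \<omega> t w) \<in> borel_measurable F"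
    by (intro borel_measurable_sum borel_measurable_times borel_measurable_const Sig_measurable assms)
  moreover have "pairing (shuffle_exp (neg_square l)) (ttrunc N a) = (\<Sum>w | length w \<le> N. shuffle_exp (neg_square l) w * a w)" for a
    by (subst pairing_eq_sum[where W="{w. length w \<le> N}"]) (auto simp: ttrunc_def split: if_splits)
  ultimately show ?thesis by simp
qed

lemma trunc_exp_deriv_measurable:
  assumes l: "l \<in> tfin" and t: "t \<in> {0..T}"
  shows "(\<lambda>\<omega>. trunc_exp_deriv l N (Sig \<omega>) t) \<in> borel_measurable F"
proof -
  have H: "(\<lambda>\<omega>. coeff (hazard_poly l (Sig \<omega>) t) n) \<in> borel_measurable F" for n
    unfolding hazard_poly_def coeff_pCons
    by (cases n) (auto intro!: measurable_coeff_power coeff_Sig_measurable l t simp del: atLeastAtMost_iff)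
  show ?thesis unfolding trunc_exp_deriv_def coeff_smult
    by (intro borel_measurable_sum borel_measurable_times borel_measurable_const measurable_coeff_mult measurable_coeff_power
        coeff_Sig_measurable neg_square_tfin l t H)
qed

text \<open>Integration by parts makes the payoff a continuous function of the upper limit, into
  which the measurable time \<open>stop_k\<close> is inserted.\<close>

lemma stopping_payoff_measurable:
  assumes l: "l \<in> tfin"
  shows "(\<lambda>\<omega>. stopping_payoff p T \<kappa> N l (X \<omega>) (\<lambda>t. Y t \<omega>)) \<in> borel_measurable F"
proof -
  define f where "f s \<omega> = pairing (shuffle_exp (neg_square l)) (ttrunc N (Sig \<omega> s)) * Y s \<omega>
      - pairing (shuffle_exp (neg_square l)) (ttrunc N (Sig \<omega> 0)) * Y 0 \<omega>
      - integral {0..s} (\<lambda>t. Y t \<omega> * trunc_exp_deriv l N (Sig \<omega>) t)" for s \<omega>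
  have 0: "0 \<in> {0..T}" using T by simp
  have "(\<lambda>\<omega>. f (stop_k \<kappa> \<omega>) \<omega>) \<in> borel_measurable F"
  proof (rule continuous_param_compose[where T=T and f=f and g="stop_k \<kappa>" and h="\<lambda>\<omega>. \<omega>"])
    fix s assume s: "s \<in> {0..T}"
    have "(\<lambda>\<omega>. integral {0..s} (\<lambda>t. Y t \<omega> * trunc_exp_deriv l N (Sig \<omega>) t)) \<in> borel_measurable F"
      using s by (intro integral_param_measurable[where T=T] borel_measurable_times trunc_exp_deriv_measurable l Y_measurable
        continuous_intros Y_continuous time_lift.trunc_exp_deriv_continuous[OF time_lift_Sig]) auto
    then show "f s \<in> borel_measurable F" unfolding f_def[abs_def]
      by (intro borel_measurable_diff borel_measurable_times trunc_exp_measurable Y_measurable l s 0)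
  next
    fix \<omega> assume "\<omega> \<in> space F"
    then have \<omega>: "\<omega> \<in> space M" by simp
    show "continuous_on {0..T} (\<lambda>s. f s \<omega>)" unfolding f_def
      by (intro continuous_intros indefinite_integral_continuous_1 integrable_continuous_real Y_continuous \<omega> l
        time_lift.trunc_exp_continuous[OF time_lift_Sig] time_lift.trunc_exp_deriv_continuous[OF time_lift_Sig])
  qed (use T stop_k_range stop_k_measurable in \<open>auto simp del: atLeastAtMost_iff\<close>)
  moreover have "stopping_payoff p T \<kappa> N l (X \<omega>) (\<lambda>t. Y t \<omega>) = f (stop_k \<kappa> \<omega>) \<omega>" if "\<omega> \<in> space F" for \<omega>
    using that unfolding stopping_payoff_eq f_def
    by (intro time_lift.ibp_trunc_exp[OF time_lift_Sig l stop_k_range]) simp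
  ultimately show ?thesis by (subst measurable_cong[where g="\<lambda>\<omega>. f (stop_k \<kappa> \<omega>) \<omega>"]) auto
qed

text \<open>The pathwise error is a deterministic factor times \<open>sup_Y\<close>. As
  \<open>nat \<lfloor>K\<rfloor>\<close> bounds the degree of every \<open>l\<close> in the ball,
  the factor is the same for all of them.\<close>

lemma trunc_payoff_error:
  assumes l: "l \<in> size_ball K" and K: "K \<ge> 0" and \<kappa>: "\<kappa> > 0"
  defines "b \<equiv> pay_bound T K (lift_bound p \<kappa> (nat \<lfloor>K\<rfloor>)) (nat \<lfloor>K\<rfloor>)"
  shows "\<bar>(LINT \<omega>|M. stopping_payoff p T \<kappa> N l (X \<omega>) (\<lambda>t. Y t \<omega>)) - Jk \<kappa> l\<bar> \<le> b N * (LINT \<omega>|M. sup_Y \<omega>)"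
proof -
  have lt: "l \<in> tfin" and lK: "tabs l \<le> K" "real (tdeg l) \<le> K"
    using l tabs_nonneg[of l] by (auto simp: size_ball_def)
  have k: "tdeg l \<le> nat \<lfloor>K\<rfloor>" using lK(2) K by (simp add: le_nat_floor)
  have err: "\<bar>stopping_payoff p T \<kappa> N l (X \<omega>) (\<lambda>t. Y t \<omega>) - pay l (stop_k \<kappa> \<omega>) \<omega>\<bar> \<le> b N * sup_Y \<omega>"
    if \<omega>: "\<omega> \<in> space M" for \<omega>
    unfolding stopping_payoff_eq b_def mult.commute[of _ "sup_Y \<omega>"]
    by (rule time_lift.payoff_error[OF time_lift_Sig[OF \<omega>] lt stop_k_range k lK(1) lift_bound_S_kappa[OF lift[OF \<omega>] rough[OF \<omega>] p]
        abs_Y_le[OF \<omega>] Y_continuous[OF \<omega>]]) (use T \<kappa> in auto)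
  have i2: "integrable M (\<lambda>\<omega>. pay l (stop_k \<kappa> \<omega>) \<omega>)" by (intro pay_integrable lt stop_k_range stop_k_measurable)
  have i1: "integrable M (\<lambda>\<omega>. stopping_payoff p T \<kappa> N l (X \<omega>) (\<lambda>t. Y t \<omega>))"
  proof (rule integrable_dominated[OF stopping_payoff_measurable[OF lt], of _ _ "b N + 2"])
    fix \<omega> assume \<omega>: "\<omega> \<in> space M"
    show "\<bar>stopping_payoff p T \<kappa> N l (X \<omega>) (\<lambda>t. Y t \<omega>)\<bar> \<le> (b N + 2) * sup_Y \<omega>"
      using err[OF \<omega>] abs_pay_le[OF lt \<omega> stop_k_range[of \<kappa> \<omega>]] by (simp add: algebra_simps)
  qed
  have eq: "(LINT \<omega>|M. stopping_payoff p T \<kappa> N l (X \<omega>) (\<lambda>t. Y t \<omega>)) - Jk \<kappa> l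
     = (LINT \<omega>|M. stopping_payoff p T \<kappa> N l (X \<omega>) (\<lambda>t. Y t \<omega>) - pay l (stop_k \<kappa> \<omega>) \<omega>)"
    unfolding Jk_def by (rule Bochner_Integration.integral_diff[OF i1 i2, symmetric])
  show ?thesis unfolding eq
    by (rule abs_expectation_le[OF Bochner_Integration.integrable_diff[OF i1 i2] err])
qed

section \<open>The expectation at the randomised stopping time\<close>

lemma rand_stop_eq: "real_of_ereal (min (tau_r p T l (X \<omega>) z) (ereal T)) = rand_stop T (cum_hazard l (Sig \<omega>)) z"
  unfolding tau_r_def rand_stop_def cum_hazard_def ..

text \<open>For \<open>t\<close> in \<open>[0, T)\<close> the event is that the clock value is at
  most the cumulative hazard at \<open>t\<close>; for other \<open>t\<close> it is empty or
  everything.\<close>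

lemma rand_stop_measurable:
  assumes l: "l \<in> tfin"
  shows "(\<lambda>x. rand_stop T (cum_hazard l (Sig (fst x))) (snd x)) \<in> borel_measurable (F \<Otimes>\<^sub>M borel)"
  unfolding borel_measurable_iff_le
proof
  fix t
  have r: "rand_stop T \<Lambda> z \<in> {0..T}" for \<Lambda> z using rand_stop_range(1)[of T \<Lambda> z] T by simp
  consider "t < 0" | "T \<le> t" | "0 \<le> t" "t < T" by linarith
  then show "{x \<in> space (F \<Otimes>\<^sub>M borel). rand_stop T (cum_hazard l (Sig (fst x))) (snd x) \<le> t} \<in> sets (F \<Otimes>\<^sub>M borel)"
  proof cases
    case 1
    then have eq: "{x \<in> space (F \<Otimes>\<^sub>M borel). rand_stop T (cum_hazard l (Sig (fst x))) (snd x) \<le> t} = {}"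
      using r by (auto simp: not_le intro: less_le_trans)
    show ?thesis unfolding eq by simp
  next
    case 2
    then have eq: "{x \<in> space (F \<Otimes>\<^sub>M borel). rand_stop T (cum_hazard l (Sig (fst x))) (snd x) \<le> t} = space (F \<Otimes>\<^sub>M borel)"
      using r order.trans[OF _ 2] by auto
    show ?thesis unfolding eq by simp
  next
    case 3
    have "{x \<in> space (F \<Otimes>\<^sub>M borel). rand_stop T (cum_hazard l (Sig (fst x))) (snd x) \<le> t}
        = {x \<in> space (F \<Otimes>\<^sub>M borel). snd x \<le> cum_hazard l (Sig (fst x)) t}"
    proof (intro Collect_cong conj_cong refl)
      fix x :: "'w \<times> real" assume "x \<in> space (F \<Otimes>\<^sub>M borel)"
      then have \<omega>: "fst x \<in> space M" by (auto simp: space_pair_measure)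
      show "rand_stop T (cum_hazard l (Sig (fst x))) (snd x) \<le> t \<longleftrightarrow> snd x \<le> cum_hazard l (Sig (fst x)) t"
        by (rule rand_stop_le_iff[OF time_lift.cum_hazard_continuous[OF time_lift_Sig[OF \<omega>] l]
            time_lift.cum_hazard_mono[OF time_lift_Sig[OF \<omega>] l] 3])
    qed
    moreover have [measurable]: "(\<lambda>x. cum_hazard l (Sig (fst x)) t) \<in> borel_measurable (F \<Otimes>\<^sub>M borel)"
      by (rule measurable_compose[OF measurable_fst cum_hazard_measurable[OF l]]) (use 3 in auto)
    ultimately show ?thesis by simp
  qed
qed

lemma expectation_stopped:
  assumes l: "l \<in> tfin"
  shows "(LINT \<omega>|M. Y (rand_stop T (cum_hazard l (Sig \<omega>)) (Z \<omega>)) \<omega>) = J l + (LINT \<omega>|M. Y 0 \<omega>)"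
proof -
  define G where "G x = Y (rand_stop T (cum_hazard l (Sig (fst x))) (snd x)) (fst x)" for x
  have r: "rand_stop T \<Lambda> z \<in> {0..T}" for \<Lambda> z using rand_stop_range(1)[of T \<Lambda> z] T by simp
  have Gm: "G \<in> borel_measurable (F \<Otimes>\<^sub>M borel)"
    unfolding G_def
    by (rule continuous_param_compose[OF Y_measurable _ rand_stop_measurable[OF l] r measurable_fst])
       (use T Y_continuous in auto)
  have Zm: "Z \<in> borel_measurable M" using distributed_measurable[OF Z_exp] by simp
  have idm: "(\<lambda>\<omega>. \<omega>) \<in> measurable M F"
    by (rule measurable_from_subalg[OF subalgebra_F measurable_ident_sets[OF refl]])
  have pm: "(\<lambda>\<omega>. (\<omega>, Z \<omega>)) \<in> measurable M (F \<Otimes>\<^sub>M borel)" by (intro measurable_Pair idm Zm)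
  interpret D1: prob_space "distr M F (\<lambda>\<omega>. \<omega>)" by (rule prob_space_distr[OF idm])
  interpret D2: prob_space "distr M borel Z" by (rule prob_space_distr[OF Zm])
  \<comment> \<open>Independence in the form of a product law. The first factor is \<open>M\<close>
    restricted to \<open>F\<close>, written as the law of the identity map, so that Fubini
    integrates out the clock for a fixed path.\<close>
  have joint: "distr M F (\<lambda>\<omega>. \<omega>) \<Otimes>\<^sub>M distr M borel Z = distr M (F \<Otimes>\<^sub>M borel) (\<lambda>\<omega>. (\<omega>, Z \<omega>))"
  proof (rule pair_measure_eqI)
    show "sigma_finite_measure (distr M F (\<lambda>\<omega>. \<omega>))" "sigma_finite_measure (distr M borel Z)" by unfold_locales
    show "sets (distr M F (\<lambda>\<omega>. \<omega>) \<Otimes>\<^sub>M distr M borel Z) = sets (distr M (F \<Otimes>\<^sub>M borel) (\<lambda>\<omega>. (\<omega>, Z \<omega>)))" by simp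
    fix A B assume "A \<in> sets (distr M F (\<lambda>\<omega>. \<omega>))" "B \<in> sets (distr M borel Z)"
    then have AB: "A \<in> sets F" "B \<in> sets borel" by auto
    have As: "A \<subseteq> space M" using sets.sets_into_space[OF AB(1)] by simp
    have "Z -` B \<inter> space M \<in> sets (vimage_algebra (space M) Z borel)" by (rule in_vimage_algebra[OF AB(2)])
    then have "prob (A \<inter> (Z -` B \<inter> space M)) = prob A * prob (Z -` B \<inter> space M)"
      by (rule indep_setD[OF Z_indep AB(1)])
    moreover have "(\<lambda>\<omega>. (\<omega>, Z \<omega>)) -` (A \<times> B) \<inter> space M = A \<inter> (Z -` B \<inter> space M)" by auto
    ultimately show "emeasure (distr M F (\<lambda>\<omega>. \<omega>)) A * emeasure (distr M borel Z) B
        = emeasure (distr M (F \<Otimes>\<^sub>M borel) (\<lambda>\<omega>. (\<omega>, Z \<omega>))) (A \<times> B)"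
      using As AB by (simp add: emeasure_distr[OF idm] emeasure_distr[OF Zm] emeasure_distr[OF pm]
          emeasure_eq_measure Int_absorb2 ennreal_mult[symmetric])
  qed
  interpret P: pair_prob_space "distr M F (\<lambda>\<omega>. \<omega>)" "distr M borel Z" ..
  have GmM: "(\<lambda>\<omega>. G (\<omega>, Z \<omega>)) \<in> borel_measurable M" by (rule measurable_compose[OF pm Gm])
  have Gi: "integrable M (\<lambda>\<omega>. G (\<omega>, Z \<omega>))"
    by (rule Bochner_Integration.integrable_bound[OF Y_integrable GmM])
       (use abs_Y_le r in \<open>auto intro!: AE_I2 order.trans[OF _ abs_ge_self] simp: G_def simp del: atLeastAtMost_iff\<close>)
  have dZ: "distr M borel Z = density lborel (exponential_density 1)"
    using distributed_distr_eq_density[OF Z_exp] by (metis distr_cong sets_lborel)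
  have "(LINT \<omega>|M. G (\<omega>, Z \<omega>)) = integral\<^sup>L (distr M F (\<lambda>\<omega>. \<omega>) \<Otimes>\<^sub>M distr M borel Z) G"
    unfolding joint by (rule integral_distr[OF pm Gm, symmetric])
  also have "\<dots> = (LINT \<omega>|distr M F (\<lambda>\<omega>. \<omega>). LINT z|distr M borel Z. G (\<omega>, z))"
    by (rule P.integral_fst'[symmetric]) (simp add: joint integrable_distr_eq[OF pm Gm] Gi)
  also have "\<dots> = (LINT \<omega>|distr M F (\<lambda>\<omega>. \<omega>). pay l T \<omega> + Y 0 \<omega>)"
  proof (rule Bochner_Integration.integral_cong[OF refl])
    fix \<omega> assume "\<omega> \<in> space (distr M F (\<lambda>\<omega>. \<omega>))"
    then have \<omega>: "\<omega> \<in> space M" by simp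
    have "(\<lambda>z. G (\<omega>, z)) \<in> borel_measurable borel"
      by (rule measurable_compose[OF measurable_Pair1' Gm]) (use \<omega> in simp)
    then show "(LINT z|distr M borel Z. G (\<omega>, z)) = pay l T \<omega> + Y 0 \<omega>"
      unfolding dZ G_def fst_conv snd_conv
      by (rule time_lift.expectation_rand_stop[OF time_lift_Sig[OF \<omega>] l Y_continuous[OF \<omega>]])
  qed
  also have "\<dots> = (LINT \<omega>|M. pay l T \<omega> + Y 0 \<omega>)"
    by (rule integral_distr[OF idm]) (use T in \<open>auto intro!: borel_measurable_add pay_fixed_measurable[OF l] Y_measurable\<close>)
  also have "\<dots> = J l + (LINT \<omega>|M. Y 0 \<omega>)"
    unfolding J_def
  proof (rule Bochner_Integration.integral_add)
    show "integrable M (\<lambda>\<omega>. pay l T \<omega>)" by (rule pay_integrable[OF l _ T_mem(1)]) simp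
    show "integrable M (\<lambda>\<omega>. Y 0 \<omega>)" by (rule integrable_dominated[OF Y_measurable, of 0 1]) (use T abs_Y_le in auto)
  qed
  finally show ?thesis by (simp add: G_def)
qed

text \<open>The intermediate limits are explicit suprema of \<open>Jk\<close> and \<open>J\<close>.
  For \<open>K >= 0\<close> the ball contains the zero functional, so no supremum is over an empty
  set; both orders of limits end at the supremum of \<open>J\<close> over
  \<open>tfin\<close>.\<close>

lemma stopping_limits:
  defines "V \<equiv> (SUP l\<in>tfin. LINT \<omega>|M. Y (real_of_ereal (min (tau_r p T l (X \<omega>) (Z \<omega>)) (ereal T))) \<omega>)"
    and "A \<equiv> (\<lambda>\<kappa> K N. SUP l\<in>size_ball K. LINT \<omega>|M. stopping_payoff p T \<kappa> N l (X \<omega>) (\<lambda>t. Y t \<omega>))"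
    and "a \<equiv> (\<lambda>\<kappa> K. SUP l\<in>size_ball K. Jk \<kappa> l)" and "b \<equiv> (\<lambda>\<kappa>. SUP l\<in>tfin. Jk \<kappa> l)"
    and "c \<equiv> (\<lambda>K. SUP l\<in>size_ball K. J l)"
  shows "\<kappa> > 0 \<Longrightarrow> K \<ge> 0 \<Longrightarrow> (\<lambda>N. A \<kappa> K N) \<longlonglongrightarrow> a \<kappa> K"
    and "((\<lambda>K. a \<kappa> K) \<longlongrightarrow> b \<kappa>) at_top"
    and "((\<lambda>\<kappa>. b \<kappa> + (LINT \<omega>|M. Y 0 \<omega>)) \<longlongrightarrow> V) at_top"
    and "K \<ge> 0 \<Longrightarrow> ((\<lambda>\<kappa>. a \<kappa> K) \<longlongrightarrow> c K) at_top"
    and "((\<lambda>K. c K + (LINT \<omega>|M. Y 0 \<omega>)) \<longlongrightarrow> V) at_top"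
proof -
  define E where "E = (LINT \<omega>|M. sup_Y \<omega>)"
  have ne: "(tfin :: 'd option tensor set) \<noteq> {}" using zero_in_size_ball[of 0] by (auto simp: size_ball_def)
  have neK: "(size_ball K :: 'd option tensor set) \<noteq> {}" if "K \<ge> 0" for K using zero_in_size_ball[OF that] by auto
  have ball: "l \<in> tfin" if "l \<in> size_ball K" for l :: "'d option tensor" and K using that by (simp add: size_ball_def)
  have V: "V = (SUP l\<in>tfin. J l) + (LINT \<omega>|M. Y 0 \<omega>)"
    unfolding V_def rand_stop_eq using SUP_add_const[OF ne J_bound] by (simp add: expectation_stopped cong: SUP_cong)
  show "(\<lambda>N. A \<kappa> K N) \<longlonglongrightarrow> a \<kappa> K" if "\<kappa> > 0" "K \<ge> 0" for \<kappa> K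
  proof (rule Lim_transform[OF tendsto_const], rule Lim_null_comparison[OF always_eventually])
    define \<beta> where "\<beta> = pay_bound T K (lift_bound p \<kappa> (nat \<lfloor>K\<rfloor>)) (nat \<lfloor>K\<rfloor>)"
    show "\<forall>N. norm (A \<kappa> K N - a \<kappa> K) \<le> \<beta> N * E"
      unfolding A_def a_def real_norm_def \<beta>_def E_def
      by (intro allI abs_SUP_diff_le[OF neK[OF that(2)], where C="2 * E"] trunc_payoff_error that)
         (auto simp: E_def intro!: Jk_bound ball)
    show "(\<lambda>N. \<beta> N * E) \<longlonglongrightarrow> 0" unfolding \<beta>_def by (rule tendsto_mult_left_zero[OF pay_bound_tendsto])
  qed
  show "((\<lambda>K. a \<kappa> K) \<longlongrightarrow> b \<kappa>) at_top" for \<kappa>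
    unfolding a_def b_def by (rule SUP_size_ball_tendsto[OF Jk_bound])
  have "((\<lambda>\<kappa>. b \<kappa>) \<longlongrightarrow> (SUP l\<in>tfin. J l)) at_top"
  proof (rule Lim_transform[OF tendsto_const], rule Lim_null_comparison[OF always_eventually])
    show "\<forall>\<kappa>. norm (b \<kappa> - (SUP l\<in>tfin. J l)) \<le> \<delta> \<kappa>"
      unfolding b_def real_norm_def by (intro allI abs_SUP_diff_le[OF ne abs_Jk_diff_J_le J_bound])
  qed (rule \<delta>_tendsto)
  then show "((\<lambda>\<kappa>. b \<kappa> + (LINT \<omega>|M. Y 0 \<omega>)) \<longlongrightarrow> V) at_top"
    unfolding V by (intro tendsto_add tendsto_const)
  show "((\<lambda>\<kappa>. a \<kappa> K) \<longlongrightarrow> c K) at_top" if "K \<ge> 0" for K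
  proof (rule Lim_transform[OF tendsto_const], rule Lim_null_comparison[OF always_eventually])
    show "\<forall>\<kappa>. norm (a \<kappa> K - c K) \<le> \<delta> \<kappa>"
      unfolding a_def c_def real_norm_def
      by (intro allI abs_SUP_diff_le[OF neK[OF that] abs_Jk_diff_J_le[OF ball] J_bound[OF ball]])
  qed (rule \<delta>_tendsto)
  show "((\<lambda>K. c K + (LINT \<omega>|M. Y 0 \<omega>)) \<longlongrightarrow> V) at_top"
    unfolding V c_def by (intro tendsto_add tendsto_const SUP_size_ball_tendsto[OF J_bound])
qed

end

theorem proposition5:
  fixes M :: "'w measure"
    and p T :: real
    and X :: "'w \<Rightarrow> real \<Rightarrow> ('d::finite option) tensor"
    and Y :: "real \<Rightarrow> 'w \<Rightarrow> real"
    and Z :: "'w \<Rightarrow> real"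
  assumes "p \<ge> 1" and "T > 0"
    and "prob_space M"
    and X_process: "\<And>t. t \<in> {0..T} \<Longrightarrow> (\<lambda>\<omega>. X \<omega> t) \<in> borel_measurable M"
    and X_paths: "\<And>\<omega>. \<omega> \<in> space M \<Longrightarrow> X \<omega> \<in> Omega_hat p T"
    and Y_adapted: "\<And>t. t \<in> {0..T} \<Longrightarrow> Y t \<in> borel_measurable (path_filtration M X t)"
    and Y_continuous: "\<And>\<omega>. \<omega> \<in> space M \<Longrightarrow> continuous_on {0..T} (\<lambda>t. Y t \<omega>)"
    and Y_integrable: "integrable M (\<lambda>\<omega>. SUP t\<in>{0..T}. \<bar>Y t \<omega>\<bar>)"
    and Z_exp: "distributed M lborel Z (exponential_density 1)"
    and Z_indep: "prob_space.indep_set M (sets (path_filtration M X T))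
                    (sets (vimage_algebra (space M) Z borel))"
  defines "V \<equiv> (SUP l\<in>tfin. LINT \<omega>|M. Y (real_of_ereal (min (tau_r p T l (X \<omega>) (Z \<omega>)) (ereal T))) \<omega>)"
    and "A \<equiv> (\<lambda>\<kappa> K N. SUP l\<in>{l\<in>tfin. tabs l + real (tdeg l) \<le> K}.
               LINT \<omega>|M. stopping_payoff p T \<kappa> N l (X \<omega>) (\<lambda>t. Y t \<omega>))"
  shows "\<exists>(a :: real \<Rightarrow> real \<Rightarrow> real) b c.
      (\<forall>\<kappa>>0. \<forall>K\<ge>0. (\<lambda>N. A \<kappa> K N) \<longlonglongrightarrow> a \<kappa> K) \<and>
      (\<forall>\<kappa>>0. ((\<lambda>K. a \<kappa> K) \<longlongrightarrow> b \<kappa>) at_top) \<and>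
      ((\<lambda>\<kappa>. b \<kappa> + (LINT \<omega>|M. Y 0 \<omega>)) \<longlongrightarrow> V) at_top \<and>
      (\<forall>K\<ge>0. ((\<lambda>\<kappa>. a \<kappa> K) \<longlongrightarrow> c K) at_top) \<and>
      ((\<lambda>K. c K + (LINT \<omega>|M. Y 0 \<omega>)) \<longlongrightarrow> V) at_top"
proof -
  interpret stopping_problem M p T X Y Z
    using assms(3) by (rule stopping_problem.intro)
      (rule stopping_problem_axioms.intro[OF assms(1,2) X_process X_paths Y_adapted Y_continuous Y_integrable Z_exp Z_indep])
  show ?thesis
    unfolding V_def A_def size_ball_def[symmetric]
    by (rule exI[of _ "\<lambda>\<kappa> K. SUP l\<in>size_ball K. Jk \<kappa> l"], rule exI[of _ "\<lambda>\<kappa>. SUP l\<in>tfin. Jk \<kappa> l"],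
        rule exI[of _ "\<lambda>K. SUP l\<in>size_ball K. J l"]) (intro conjI allI impI stopping_limits)
qed

end
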